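(* There are no minimal tEI theories with respect to interpretability. Moreover, given any tEI theory $U$, one can effectively find a theory that is tEI and strictly weaker than $U$ with respect to interpretability: there is an algorithm which, for every tEI theory $U$, given the signature of $U$ and an index of $U$ as an RE set, outputs the signature and an RE index of a theory $T$ such that $T$ is tEI and $T \lhd U$.
   Context: All theories are first-order theories (with equality) in finite signatures and are recursively enumerable (RE). A theory is identified with the set of sentences provable in it. A Gödel numbering of sentences is fixed and a set of sentences is identified with the set of Gödel numbers of its elements. $W_i$ denotes the RE set with index $i$. "Recursive function" means partial recursive function. For a theory $T$, $T_P=\{\phi : T\vdash\phi\}$ and $T_R=\{\phi: T\vdash\neg\phi\}$ (as $\phi$ ranges over sentences of the language of $T$). Filter and ideal. A set $X$ of sentences is a filter if (1) $\alpha\in X$ and $\alpha\vdash\beta$ imply $\beta\in X$; (2) $\alpha,\beta\in X$ imply $\alpha\wedge\beta\in X$; (3) $\bot\notin X$. A set $Y$ of sentences is an ideal if (A) $\alpha\in Y$ and $\beta\vdash\alpha$ imply $\beta\in Y$; (B) $\alpha,\beta\in Y$ imply $\alpha\vee\beta\in Y$; (C) $\top\notin Y$. tEI. A consistent RE theory $T$ is tEI if there is a recursive function $f$ such that whenever $X$ is an RE filter of sentences with index $i$, $Y$ is an RE ideal of sentences with index $j$, $T_P\subseteq X$, $T_R\subseteq Y$ and $X\cap Y=\emptyset$, then $f(i,j)$ converges and outputs a sentence with $f(i,j)\notin X\cup Y$. Interpretations (one-dimensional, parameter-free, one-piece). A translation $I$ of a language $L(T)$ into a language $L(S)$ consists of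 an $L(S)$-formula $\delta_I(x)$ (the domain), for each relation symbol $R$ of $L(T)$ and also for equality an $L(S)$-formula $R_I$ of the same arity, and for each $k$-ary function symbol $F$ of $L(T)$ an $L(S)$-formula $F_I$ of arity $k+1$. The translation $\phi^I$ of an $L(T)$-formula $\phi$ is obtained by first rewriting $\phi$ equivalently so that function symbols occur only in atomic formulas $F(\bar x)=y$ with $\bar x,y$ variables, replacing each such atomic formula by $F_I(\bar x,y)$ and each $R(\bar x)$ by $R_I(\bar x)$, and restricting all quantifiers and free variables to $\delta_I$ (renaming bound variables to avoid capture). $I$ is an interpretation of $T$ in $S$ if $S$ proves, for each function symbol $F$, that $F_I$ is total on $\delta_I$, and $S$ proves the $I$-translations of all theorems of $T$ and of the axioms of equality. Write $T\unlhd S$ if there is an interpretation of $T$ in $S$, and $S\lhd T$ ("$S$ is strictly weaker than $T$ with respect to interpretability") if $S\unlhd T$ and not $T\unlhd S$. A tEI theory $S$ is minimal with respect to interpretability if there is no tEI theory $T$ with $T\lhd S$. *)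

theory Defs
  imports Main "HOL-Library.Nat_Bijection"
begin

section \<open>Partial recursive functions and RE sets\<close>

text \<open>Unary functions on the naturals suffice, because the Cantor pairing is among the basic
  operations; \<open>Min f\<close> is unbounded minimisation of the last argument.\<close>

datatype recf =
    Zero | Succ | Fst | Snd
  | Pairing recf recf
  | Comp recf recf
  | Prec recf recf
  | Min recf

inductive computes :: "recf \<Rightarrow> nat \<Rightarrow> nat \<Rightarrow> bool" where
  computes_Zero: "computes Zero x 0"
| computes_Succ: "computes Succ x (Suc x)"
| computes_Fst: "computes Fst (prod_encode (a, b)) a"
| computes_Snd: "computes Snd (prod_encode (a, b)) b"
| computes_Pairing: "computes f x a \<Longrightarrow> computes g x b \<Longrightarrow> computes (Pairing f g) x (prod_encode (a, b))"
| computes_Comp: "computes g x a \<Longrightarrow> computes f a b \<Longrightarrow> computes (Comp f g) x b"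
| computes_Prec_0: "computes f a b \<Longrightarrow> computes (Prec f g) (prod_encode (a, 0)) b"
| computes_Prec_Suc: "computes (Prec f g) (prod_encode (a, n)) b \<Longrightarrow>
    computes g (prod_encode (a, prod_encode (n, b))) c \<Longrightarrow>
    computes (Prec f g) (prod_encode (a, Suc n)) c"
| computes_Min: "computes f (prod_encode (a, m)) 0 \<Longrightarrow>
    (\<And>k. k < m \<Longrightarrow> \<exists>v. computes f (prod_encode (a, k)) (Suc v)) \<Longrightarrow>
    computes (Min f) a m"

definition partial_recursive2 :: "(nat \<Rightarrow> nat \<Rightarrow> nat option) \<Rightarrow> bool" where
  "partial_recursive2 f \<longleftrightarrow>
     (\<exists>c. \<forall>i j y. f i j = Some y \<longleftrightarrow> computes c (prod_encode (i, j)) y)"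

text \<open>The numbering must be effective, so the \<open>to_nat\<close> of class \<open>countable\<close>, which comes from an
  arbitrary choice, would not do.\<close>

primrec recf_code :: "recf \<Rightarrow> nat" where
  "recf_code Zero = prod_encode (0, 0)"
| "recf_code Succ = prod_encode (1, 0)"
| "recf_code Fst = prod_encode (2, 0)"
| "recf_code Snd = prod_encode (3, 0)"
| "recf_code (Pairing f g) = prod_encode (4, prod_encode (recf_code f, recf_code g))"
| "recf_code (Comp f g) = prod_encode (5, prod_encode (recf_code f, recf_code g))"
| "recf_code (Prec f g) = prod_encode (6, prod_encode (recf_code f, recf_code g))"
| "recf_code (Min f) = prod_encode (7, recf_code f)"

definition W :: "nat \<Rightarrow> nat set" where
  "W i = {x. \<exists>c y. recf_code c = i \<and> computes c x y}"

inductive_cases computes_elims: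
  "computes Zero x y" "computes Succ x y" "computes Fst x y" "computes Snd x y"
  "computes (Pairing f g) x y" "computes (Comp f g) x y" "computes (Prec f g) x y"
  "computes (Min f) x y"

lemma computes_deterministic: "computes c x y \<Longrightarrow> computes c x z \<Longrightarrow> y = z"
proof (induction arbitrary: z rule: computes.induct)
  case (computes_Min f a m)
  from computes_Min.prems have w: "computes f (prod_encode (a, z)) 0"
    "\<And>k. k < z \<Longrightarrow> \<exists>v. computes f (prod_encode (a, k)) (Suc v)"
    by (auto elim: computes_elims)
  show ?case
  proof (rule linorder_cases[of m z])
    assume "m < z"
    with w(2) computes_Min.IH(1) show ?thesis by blast
  next
    assume "z < m"
    with w(1) computes_Min.IH(2) show ?thesis by blast
  qed
next
  case (computes_Pairing f x a g b)
  from computes_Pairing.prems computes_Pairing.IH show ?case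
    by (elim computes_elims) blast
next
  case (computes_Comp g x a f b)
  from computes_Comp.prems computes_Comp.IH show ?case
    by (elim computes_elims) blast
next
  case (computes_Prec_0 f a b g)
  show ?case
    by (rule computes_elims(7)[OF computes_Prec_0.prems]) (auto dest: computes_Prec_0.IH)
next
  case (computes_Prec_Suc f g a n b c)
  obtain b' where "computes (Prec f g) (prod_encode (a, n)) b'"
    "computes g (prod_encode (a, prod_encode (n, b'))) z"
    by (rule computes_elims(7)[OF computes_Prec_Suc.prems]) auto
  with computes_Prec_Suc.IH show ?case by blast
qed (auto elim: computes_elims(1-4))

lemma inj_recf_code: "inj recf_code"
proof (rule injI)
  fix c d show "recf_code c = recf_code d \<Longrightarrow> c = d"
    by (induction c arbitrary: d) (case_tac d; force)+
qed


section \<open>First-order logic with equality over finite signatures\<close>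

text \<open>A finite signature is given by the lists of arities of its function symbols (constants
  are 0-ary) and of its relation symbols; a symbol is its position in the list. Equality is
  logical and not listed.\<close>

datatype signature = Signature (funs: "nat list") (rels: "nat list")

definition sig_code :: "signature \<Rightarrow> nat" where
  "sig_code L = prod_encode (list_encode (funs L), list_encode (rels L))"

text \<open>Variables are de Bruijn indices: \<open>Forall\<close> binds index 0 of its body.\<close>

datatype tm = Var nat | Fn nat "tm list"

datatype fm = Bot | Eq tm tm | Rel nat "tm list" | Imp fm fm | Forall fm

abbreviation Neg :: "fm \<Rightarrow> fm" where "Neg p \<equiv> Imp p Bot"
abbreviation Top :: fm where "Top \<equiv> Neg Bot"
abbreviation And :: "fm \<Rightarrow> fm \<Rightarrow> fm" where "And p q \<equiv> Neg (Imp p (Neg q))"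
abbreviation Or :: "fm \<Rightarrow> fm \<Rightarrow> fm" where "Or p q \<equiv> Imp (Neg p) q"
abbreviation Exists :: "fm \<Rightarrow> fm" where "Exists p \<equiv> Neg (Forall (Neg p))"

text \<open>\<open>wft L n\<close> and \<open>wff L n\<close>: terms and formulas of \<open>L\<close> whose free variables are below \<open>n\<close>.\<close>

primrec wft :: "signature \<Rightarrow> nat \<Rightarrow> tm \<Rightarrow> bool" where
  "wft L n (Var x) \<longleftrightarrow> x < n"
| "wft L n (Fn f ts) \<longleftrightarrow>
     f < length (funs L) \<and> length ts = funs L ! f \<and> list_all (wft L n) ts"

primrec wff :: "signature \<Rightarrow> nat \<Rightarrow> fm \<Rightarrow> bool" where
  "wff L n Bot \<longleftrightarrow> True"
| "wff L n (Eq s t) \<longleftrightarrow> wft L n s \<and> wft L n t"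
| "wff L n (Rel r ts) \<longleftrightarrow>
     r < length (rels L) \<and> length ts = rels L ! r \<and> list_all (wft L n) ts"
| "wff L n (Imp p q) \<longleftrightarrow> wff L n p \<and> wff L n q"
| "wff L n (Forall p) \<longleftrightarrow> wff L (Suc n) p"

definition is_term :: "signature \<Rightarrow> tm \<Rightarrow> bool" where
  "is_term L t \<longleftrightarrow> (\<exists>n. wft L n t)"

definition is_formula :: "signature \<Rightarrow> fm \<Rightarrow> bool" where
  "is_formula L p \<longleftrightarrow> (\<exists>n. wff L n p)"

definition sentences :: "signature \<Rightarrow> fm set" where
  "sentences L = {p. wff L 0 p}"

text \<open>Simultaneous capture-avoiding substitution.\<close>

primrec tsubst :: "(nat \<Rightarrow> tm) \<Rightarrow> tm \<Rightarrow> tm" where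
  "tsubst \<sigma> (Var x) = \<sigma> x"
| "tsubst \<sigma> (Fn f ts) = Fn f (map (tsubst \<sigma>) ts)"

primrec subst :: "(nat \<Rightarrow> tm) \<Rightarrow> fm \<Rightarrow> fm" where
  "subst \<sigma> Bot = Bot"
| "subst \<sigma> (Eq s t) = Eq (tsubst \<sigma> s) (tsubst \<sigma> t)"
| "subst \<sigma> (Rel r ts) = Rel r (map (tsubst \<sigma>) ts)"
| "subst \<sigma> (Imp p q) = Imp (subst \<sigma> p) (subst \<sigma> q)"
| "subst \<sigma> (Forall p) = Forall (subst (case_nat (Var 0) (\<lambda>x. tsubst (\<lambda>y. Var (Suc y)) (\<sigma> x))) p)"

definition lift :: "fm \<Rightarrow> fm" where
  "lift p = subst (\<lambda>x. Var (Suc x)) p"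

text \<open>\<open>inst p t\<close> instantiates the variable 0 by \<open>t\<close> and lowers the other variables.\<close>

definition inst :: "fm \<Rightarrow> tm \<Rightarrow> fm" where
  "inst p t = subst (case_nat t Var) p"

text \<open>Classical natural deduction inside the language \<open>L\<close>.\<close>

inductive proves :: "signature \<Rightarrow> fm set \<Rightarrow> fm \<Rightarrow> bool" for L :: signature where
  Assm: "p \<in> \<Gamma> \<Longrightarrow> proves L \<Gamma> p"
| ImpI: "is_formula L p \<Longrightarrow> proves L (insert p \<Gamma>) q \<Longrightarrow> proves L \<Gamma> (Imp p q)"
| ImpE: "proves L \<Gamma> (Imp p q) \<Longrightarrow> proves L \<Gamma> p \<Longrightarrow> proves L \<Gamma> q"
| Raa: "is_formula L p \<Longrightarrow> proves L (insert (Neg p) \<Gamma>) Bot \<Longrightarrow> proves L \<Gamma> p"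
| AllI: "proves L (lift ` \<Gamma>) p \<Longrightarrow> proves L \<Gamma> (Forall p)"
| AllE: "is_term L t \<Longrightarrow> proves L \<Gamma> (Forall p) \<Longrightarrow> proves L \<Gamma> (inst p t)"
| EqRefl: "is_term L t \<Longrightarrow> proves L \<Gamma> (Eq t t)"
| EqSubst: "is_formula L p \<Longrightarrow> proves L \<Gamma> (Eq s t) \<Longrightarrow> proves L \<Gamma> (inst p s) \<Longrightarrow>
    proves L \<Gamma> (inst p t)"

text \<open>A Goedel numbering of formulas, uniform in the signature.\<close>

primrec tm_code :: "tm \<Rightarrow> nat" where
  "tm_code (Var x) = prod_encode (0, x)"
| "tm_code (Fn f ts) = prod_encode (1, prod_encode (f, list_encode (map tm_code ts)))"

primrec fm_code :: "fm \<Rightarrow> nat" where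
  "fm_code Bot = prod_encode (0, 0)"
| "fm_code (Eq s t) = prod_encode (1, prod_encode (tm_code s, tm_code t))"
| "fm_code (Rel r ts) = prod_encode (2, prod_encode (r, list_encode (map tm_code ts)))"
| "fm_code (Imp p q) = prod_encode (3, prod_encode (fm_code p, fm_code q))"
| "fm_code (Forall p) = prod_encode (4, fm_code p)"

lemma inj_tm_code: "inj tm_code"
proof (rule injI)
  fix s t show "tm_code s = tm_code t \<Longrightarrow> s = t"
  proof (induction s arbitrary: t)
    case (Var x)
    then show ?case by (cases t) auto
  next
    case (Fn f ts)
    from Fn.prems obtain us where t: "t = Fn f us" "map tm_code ts = map tm_code us"
      by (cases t) (auto simp: list_encode_eq)
    from t(2) have "ts = us"
      using Fn.IH by (auto intro!: nth_equalityI dest: map_eq_imp_length_eq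
        simp: list_eq_iff_nth_eq)
    with t(1) show ?case by simp
  qed
qed

lemma inj_fm_code: "inj fm_code"
proof (rule injI)
  fix p q show "fm_code p = fm_code q \<Longrightarrow> p = q"
    by (induction p arbitrary: q)
      (case_tac q; force simp: inj_eq[OF inj_tm_code] inj_map_eq_map[OF inj_tm_code] list_encode_eq)+
qed

definition re_index :: "nat \<Rightarrow> fm set \<Rightarrow> bool" where
  "re_index i X \<longleftrightarrow> W i = fm_code ` X"


section \<open>Theories and tEI\<close>

text \<open>A theory is identified with the set of its theorems; \<open>is_theory\<close> says that this set consists
  of sentences and is deductively closed.\<close>

datatype fo_theory = Theory (lang: signature) (thms: "fm set")

definition is_theory :: "fo_theory \<Rightarrow> bool" where
  "is_theory T \<longleftrightarrow> thms T = {p \<in> sentences (lang T). proves (lang T) (thms T) p}"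

definition consistent :: "fo_theory \<Rightarrow> bool" where
  "consistent T \<longleftrightarrow> Bot \<notin> thms T"

definition refuted :: "fo_theory \<Rightarrow> fm set" where
  "refuted T = {p \<in> sentences (lang T). Neg p \<in> thms T}"

definition is_filter :: "signature \<Rightarrow> fm set \<Rightarrow> bool" where
  "is_filter L X \<longleftrightarrow> X \<subseteq> sentences L \<and>
     (\<forall>a\<in>X. \<forall>b\<in>sentences L. proves L {a} b \<longrightarrow> b \<in> X) \<and>
     (\<forall>a\<in>X. \<forall>b\<in>X. And a b \<in> X) \<and>
     Bot \<notin> X"

definition is_ideal :: "signature \<Rightarrow> fm set \<Rightarrow> bool" where
  "is_ideal L Y \<longleftrightarrow> Y \<subseteq> sentences L \<and>
     (\<forall>a\<in>Y. \<forall>b\<in>sentences L. proves L {b} a \<longrightarrow> b \<in> Y) \<and>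
     (\<forall>a\<in>Y. \<forall>b\<in>Y. Or a b \<in> Y) \<and>
     Top \<notin> Y"

definition tEI :: "fo_theory \<Rightarrow> bool" where
  "tEI T \<longleftrightarrow> is_theory T \<and> consistent T \<and> (\<exists>i. re_index i (thms T)) \<and>
     (\<exists>f. partial_recursive2 f \<and>
        (\<forall>i j X Y. is_filter (lang T) X \<and> re_index i X \<and> is_ideal (lang T) Y \<and> re_index j Y \<and>
           thms T \<subseteq> X \<and> refuted T \<subseteq> Y \<and> X \<inter> Y = {} \<longrightarrow>
           (\<exists>p\<in>sentences (lang T). f i j = Some (fm_code p) \<and> p \<notin> X \<union> Y)))"


section \<open>Interpretations\<close>

text \<open>The arguments of the formulas of a translation are their free variables: 0 for \<open>tr_dom\<close>;
  0 and 1 for \<open>tr_eq\<close>; \<open>0, \<dots>, k - 1\<close> for a \<open>k\<close>-ary relation symbol; and \<open>0, \<dots>, k - 1\<close> for the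
  arguments and \<open>k\<close> for the value of a \<open>k\<close>-ary function symbol.\<close>

datatype translation = Translation
  (tr_dom: fm) (tr_eq: fm) (tr_rel: "nat \<Rightarrow> fm") (tr_fun: "nat \<Rightarrow> fm")

definition is_translation :: "translation \<Rightarrow> signature \<Rightarrow> signature \<Rightarrow> bool" where
  "is_translation I L L' \<longleftrightarrow>
     wff L' 1 (tr_dom I) \<and> wff L' 2 (tr_eq I) \<and>
     (\<forall>r < length (rels L). wff L' (rels L ! r) (tr_rel I r)) \<and>
     (\<forall>f < length (funs L). wff L' (Suc (funs L ! f)) (tr_fun I f))"

text \<open>\<open>at_vars p xs\<close> puts the variables \<open>xs\<close> for the variables \<open>0, 1, \<dots>\<close> of \<open>p\<close>.\<close>

definition at_vars :: "fm \<Rightarrow> nat list \<Rightarrow> fm" where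
  "at_vars p xs = subst (\<lambda>i. Var (xs ! i)) p"

definition conjs :: "fm list \<Rightarrow> fm" where
  "conjs ps = foldr And ps Top"

text \<open>Quantifier blocks relativised to the domain; the bound variables are \<open>0, \<dots>, k - 1\<close>.\<close>

primrec all_dom :: "translation \<Rightarrow> nat \<Rightarrow> fm \<Rightarrow> fm" where
  "all_dom I 0 p = p"
| "all_dom I (Suc k) p = Forall (Imp (tr_dom I) (all_dom I k p))"

primrec ex_dom :: "translation \<Rightarrow> nat \<Rightarrow> fm \<Rightarrow> fm" where
  "ex_dom I 0 p = p"
| "ex_dom I (Suc k) p = Exists (And (tr_dom I) (ex_dom I k p))"

text \<open>\<open>tr_val I t k y\<close> translates the unnested form of \<open>t = y\<close>, where the variables of \<open>t\<close> are
  shifted by \<open>k\<close>: the unnested form of \<open>F(t\<^sub>1, \<dots>, t\<^sub>m) = y\<close> is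
  \<open>\<exists>z\<^sub>1 \<dots> z\<^sub>m. t\<^sub>1 = z\<^sub>1 \<and> \<dots> \<and> t\<^sub>m = z\<^sub>m \<and> F(z\<^sub>1, \<dots>, z\<^sub>m) = y\<close>, with the \<open>t\<^sub>i = z\<^sub>i\<close> unnested in turn.
  \<open>tr_args\<close> gives the conjunction of the \<open>t\<^sub>i = z\<^sub>i\<close>.\<close>

definition tr_args :: "(nat \<Rightarrow> nat \<Rightarrow> fm) list \<Rightarrow> nat \<Rightarrow> fm" where
  "tr_args vs k = conjs (map (\<lambda>i. (vs ! i) k i) [0..<length vs])"

primrec tr_val :: "translation \<Rightarrow> tm \<Rightarrow> nat \<Rightarrow> nat \<Rightarrow> fm" where
  "tr_val I (Var x) = (\<lambda>k y. at_vars (tr_eq I) [x + k, y])"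
| "tr_val I (Fn f ts) = (\<lambda>k y. let m = length ts in
     ex_dom I m (And (tr_args (map (tr_val I) ts) (k + m))
       (at_vars (tr_fun I f) ([0..<m] @ [y + m]))))"

text \<open>Unnesting and translation in one step: atoms \<open>s = t\<close> and \<open>R(t\<^sub>1, \<dots>, t\<^sub>m)\<close> are unnested like
  \<open>tr_val\<close> does. Free variables are not relativised, because only sentences are translated.\<close>

primrec tr_fm :: "translation \<Rightarrow> fm \<Rightarrow> fm" where
  "tr_fm I Bot = Bot"
| "tr_fm I (Eq s t) =
     ex_dom I 2 (And (tr_args (map (tr_val I) [s, t]) 2) (at_vars (tr_eq I) [0, 1]))"
| "tr_fm I (Rel r ts) = (let m = length ts in
     ex_dom I m (And (tr_args (map (tr_val I) ts) m) (at_vars (tr_rel I r) [0..<m])))"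
| "tr_fm I (Imp p q) = Imp (tr_fm I p) (tr_fm I q)"
| "tr_fm I (Forall p) = Forall (Imp (tr_dom I) (tr_fm I p))"

text \<open>The universally closed axioms of equality: an equivalence relation, and a congruence for
  the symbols of the signature.\<close>

definition Foralls :: "nat \<Rightarrow> fm \<Rightarrow> fm" where
  "Foralls n p = (Forall ^^ n) p"

definition eqs :: "nat \<Rightarrow> fm" where
  "eqs k = conjs (map (\<lambda>i. Eq (Var i) (Var (k + i))) [0..<k])"

definition eq_axioms :: "signature \<Rightarrow> fm set" where
  "eq_axioms L =
     {Foralls 1 (Eq (Var 0) (Var 0)),
      Foralls 2 (Imp (Eq (Var 0) (Var 1)) (Eq (Var 1) (Var 0))),
      Foralls 3 (Imp (Eq (Var 0) (Var 1)) (Imp (Eq (Var 1) (Var 2)) (Eq (Var 0) (Var 2))))} \<union>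
     {Foralls (2 * k) (Imp (eqs k) (Eq (Fn f (map Var [0..<k])) (Fn f (map Var [k..<2 * k]))))
       | f k. f < length (funs L) \<and> k = funs L ! f} \<union>
     {Foralls (2 * k) (Imp (eqs k) (Imp (Rel r (map Var [0..<k])) (Rel r (map Var [k..<2 * k]))))
       | r k. r < length (rels L) \<and> k = rels L ! r}"

definition fun_total :: "translation \<Rightarrow> nat \<Rightarrow> nat \<Rightarrow> fm" where
  "fun_total I f k = all_dom I k (ex_dom I 1 (at_vars (tr_fun I f) ([1..<Suc k] @ [0])))"

definition interpretation_of :: "translation \<Rightarrow> fo_theory \<Rightarrow> fo_theory \<Rightarrow> bool" where
  "interpretation_of I T S \<longleftrightarrow>
     is_translation I (lang T) (lang S) \<and>
     (\<forall>f < length (funs (lang T)). fun_total I f (funs (lang T) ! f) \<in> thms S) \<and>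
     (\<forall>p \<in> thms T \<union> eq_axioms (lang T). tr_fm I p \<in> thms S)"

definition interpretable :: "fo_theory \<Rightarrow> fo_theory \<Rightarrow> bool" (infix "\<unlhd>" 50) where
  "T \<unlhd> S \<longleftrightarrow> (\<exists>I. interpretation_of I T S)"

definition strictly_weaker :: "fo_theory \<Rightarrow> fo_theory \<Rightarrow> bool" (infix "\<lhd>" 50) where
  "S \<lhd> T \<longleftrightarrow> S \<unlhd> T \<and> \<not> T \<unlhd> S"

definition minimal_tEI :: "fo_theory \<Rightarrow> bool" where
  "minimal_tEI S \<longleftrightarrow> tEI S \<and> \<not> (\<exists>T. tEI T \<and> T \<lhd> S)"

end

theory Submission
  imports Defs
begin

text \<open>Given a tEI theory \<open>U\<close>, let \<open>V\<close> be a theory of equivalence relations in which the sentence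
  "some class has exactly \<open>n + 1\<close> elements" acts as an independent bit for each \<open>n\<close>; the truth of a
  sentence depends on finitely many bits, by a back-and-forth argument. The bit sequences of models
  of \<open>V\<close> are the images \<open>\<Phi>(c)\<close> of the separations \<open>c\<close> of two effectively inseparable sets, where
  \<open>\<Phi>\<close> interleaves the bits of \<open>c\<close> with finite blocks: the \<open>n\<close>-th block makes the \<open>n\<close>-th translation of
  the language of \<open>U\<close> violate some theorem of \<open>U\<close>. Such a block is found by search. Otherwise a
  structure with eventually vanishing bits would satisfy the translations of all theorems of \<open>U\<close>,
  and its theory, which is decidable, would give a complete decidable extension of \<open>U\<close>. So \<open>V\<close> is
  tEI and does not interpret \<open>U\<close>. The theory sought is "\<open>U\<close> if \<open>P\<close>, and \<open>V\<close> if not \<open>P\<close>" for a new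
  proposition letter \<open>P\<close>. It is interpretable in \<open>U\<close> by making \<open>P\<close> true; it does not interpret \<open>U\<close>
  since \<open>V\<close> does not; and an independent sentence is glued from those of its two parts.

  Provability is never enumerated: \<open>V\<close> is given semantically, and consequences are read off from
  the given filters and ideals.\<close>

text \<open>Equivalence structures are chosen because a sentence depends, computably, on finitely
  many bits: that a given translation violates a theorem of \<open>U\<close> is then a finite event,
  which a finite block can force whatever bits were fixed before. Every separation has to meet all
  these blocks, so they are attached to the nodes of a binary tree, and one free bit before each
  block keeps \<open>c\<close> readable from \<open>\<Phi>(c)\<close>. This gives \<open>V\<close>
  the effective inseparability that a tEI theory needs, although it interprets so little. The search
  for a block needs an index of \<open>U\<close> and nothing else, so the construction is uniform;
  it cannot fail because the two halves of a complete decidable extension would be a filter and an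
  ideal that leave no sentence outside. The case distinction on \<open>P\<close> makes the result
  interpretable in \<open>U\<close> at once, without any interpretation of \<open>V\<close> in
  \<open>U\<close>. Its price is that an extension may refute \<open>P\<close>; the procedure of
  \<open>U\<close> then has no admissible input and may diverge, so its run is dovetailed with a
  search for that refutation.\<close>

abbreviation "pi1 n \<equiv> fst (prod_decode n)"
abbreviation "pi2 n \<equiv> snd (prod_decode n)"

section \<open>Computable functions and recursively enumerable predicates\<close>

definition computable :: "(nat \<Rightarrow> nat) \<Rightarrow> bool" where
  "computable f \<longleftrightarrow> (\<exists>c. \<forall>x. computes c x (f x))"

named_theorems computable_intros
named_theorems re_intros

lemma computes_fst_snd:
  "computes Fst x (pi1 x)" "computes Snd x (pi2 x)"
  using computes_Fst[of "pi1 x" "pi2 x"]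
    computes_Snd[of "pi1 x" "pi2 x"] by simp_all

lemma computes_id: "computes (Pairing Fst Snd) x x"
  using computes_Pairing[OF computes_fst_snd] by simp

lemma computable_id [computable_intros]: "computable (\<lambda>x. x)"
  unfolding computable_def using computes_id by blast

lemma computable_comp:
  assumes "computable f" "computable g"
  shows "computable (\<lambda>x. f (g x))"
  using assms unfolding computable_def by (meson computes_Comp)

lemma computable_Suc [computable_intros]:
  assumes "computable f" shows "computable (\<lambda>x. Suc (f x))"
  by (rule computable_comp[OF _ assms]) (use computes_Succ computable_def in blast)

lemma computable_const [computable_intros]: "computable (\<lambda>x. n)"
proof (induction n)
  case 0
  show ?case unfolding computable_def using computes_Zero by blast
next
  case (Suc n)
  then show ?case by (rule computable_Suc)
qed

lemma computable_fst [computable_intros]: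
  assumes "computable f" shows "computable (\<lambda>x. pi1 (f x))"
  by (rule computable_comp[OF _ assms]) (use computes_fst_snd computable_def in blast)

lemma computable_snd [computable_intros]:
  assumes "computable f" shows "computable (\<lambda>x. pi2 (f x))"
  by (rule computable_comp[OF _ assms]) (use computes_fst_snd computable_def in blast)

lemma computable_pair [computable_intros]:
  assumes "computable f" "computable g" shows "computable (\<lambda>x. prod_encode (f x, g x))"
  using assms unfolding computable_def by (meson computes_Pairing)

lemma computes_Prec_rec_nat:
  assumes "\<And>x. computes f x (a x)"
    and "\<And>x n r. computes g (prod_encode (x, prod_encode (n, r))) (h x n r)"
  shows "computes (Prec f g) (prod_encode (x, n)) (rec_nat (a x) (h x) n)"
  by (induction n) (auto intro: computes_Prec_0 computes_Prec_Suc assms)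

lemma computable_rec_nat [computable_intros]:
  assumes "computable a" "computable b"
    and "computable (\<lambda>p. h (pi1 p) (pi1 (pi2 p))
      (pi2 (pi2 p)))"
  shows "computable (\<lambda>x. rec_nat (a x) (h x) (b x))"
proof -
  from assms(1) obtain f where f: "\<And>x. computes f x (a x)" unfolding computable_def by blast
  from assms(3) obtain g where g: "\<And>p. computes g p (h (pi1 p)
      (pi1 (pi2 p)) (pi2 (pi2 p)))"
    unfolding computable_def by blast
  have g': "computes g (prod_encode (x, prod_encode (n, r))) (h x n r)" for x n r
    using g[of "prod_encode (x, prod_encode (n, r))"] by simp
  have "computable (\<lambda>p. rec_nat (a (pi1 p)) (h (pi1 p)) (pi2 p))"
    unfolding computable_def
  proof (intro exI allI)
    fix p show "computes (Prec f g) p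
        (rec_nat (a (pi1 p)) (h (pi1 p)) (pi2 p))"
      using computes_Prec_rec_nat[OF f g', of "pi1 p" "pi2 p"] by simp
  qed
  from computable_comp[OF this computable_pair[OF computable_id assms(2)]] show ?thesis by simp
qed

lemma computable_add [computable_intros]:
  assumes "computable f" "computable g" shows "computable (\<lambda>x. f x + g x)"
proof -
  have "m + n = rec_nat m (\<lambda>_ r. Suc r) n" for m n :: nat by (induction n) auto
  then show ?thesis by (simp only:) (intro computable_intros assms)
qed

lemma computable_pred: 
  assumes "computable f" shows "computable (\<lambda>x. f x - 1)"
proof -
  have "n - 1 = rec_nat 0 (\<lambda>k _. k) n" for n :: nat by (cases n) auto
  then show ?thesis by (simp only:) (intro computable_intros assms)
qed

lemma computable_diff [computable_intros]:
  assumes "computable f" "computable g" shows "computable (\<lambda>x. f x - g x)"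
proof -
  have "m - n = rec_nat m (\<lambda>_ r. r - 1) n" for m n :: nat by (induction n) auto
  then have "(\<lambda>x. f x - g x) = (\<lambda>x. rec_nat (f x) (\<lambda>_ r. r - 1) (g x))" by blast
  then show ?thesis by (simp only:) (intro computable_intros computable_pred assms)
qed

lemma computable_mult [computable_intros]:
  assumes "computable f" "computable g" shows "computable (\<lambda>x. f x * g x)"
proof -
  have "m * n = rec_nat 0 (\<lambda>_ r. r + m) n" for m n :: nat by (induction n) auto
  then show ?thesis by (simp only:) (intro computable_intros assms computable_comp[OF assms(1)])
qed

section \<open>Coded lists\<close>

definition hdc :: "nat \<Rightarrow> nat" where "hdc w = pi1 (w - 1)"
definition tlc :: "nat \<Rightarrow> nat" where "tlc w = pi2 (w - 1)"
definition consc :: "nat \<Rightarrow> nat \<Rightarrow> nat" where "consc a w = Suc (prod_encode (a, w))"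
text \<open>Entries past the end read as 0, so every number codes an infinite sequence that vanishes
  from some place on. Parameters with finitely many true bits are later given by such
  numbers.\<close>

definition nthc :: "nat \<Rightarrow> nat \<Rightarrow> nat" where "nthc w k = hdc (rec_nat w (\<lambda>_ r. tlc r) k)"

lemma tlc_0: "tlc 0 = 0" and hdc_0: "hdc 0 = 0"
  by (simp_all add: tlc_def hdc_def prod_decode_def prod_decode_aux.simps)

lemma nthc_0: "nthc 0 k = 0"
proof -
  have "rec_nat 0 (\<lambda>_ r. tlc r) k = 0" by (induction k) (auto simp: tlc_0)
  then show ?thesis by (simp add: nthc_def hdc_0)
qed

lemma nthc_consc_0 [simp]: "nthc (consc a w) 0 = a"
  by (simp add: nthc_def consc_def hdc_def)

lemma nthc_consc_Suc [simp]: "nthc (consc a w) (Suc k) = nthc w k"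
proof -
  have "rec_nat (consc a w) (\<lambda>_ r. tlc r) (Suc k) = rec_nat w (\<lambda>_ r. tlc r) k"
    by (induction k) (auto simp: tlc_def consc_def)
  then show ?thesis by (simp add: nthc_def)
qed

lemma nthc_consc: "nthc (consc a w) = case_nat a (nthc w)"
  by (rule ext) (auto split: nat.split)

lemma list_encode_consc: "list_encode (x # xs) = consc x (list_encode xs)"
  by (simp add: consc_def)

lemma nthc_list_encode: "nthc (list_encode xs) k = (if k < length xs then xs ! k else 0)"
proof (induction xs arbitrary: k)
  case (Cons x xs)
  then show ?case unfolding list_encode_consc by (cases k) auto
qed (simp add: nthc_0)

lemma ex_nthc: "\<exists>w. \<forall>k<n. nthc w k = f k"
  by (rule exI[of _ "list_encode (map f [0..<n])"]) (simp add: nthc_list_encode)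

lemma computable_hdc [computable_intros]: "computable f \<Longrightarrow> computable (\<lambda>x. hdc (f x))"
  unfolding hdc_def by (intro computable_intros)

lemma computable_tlc [computable_intros]: "computable f \<Longrightarrow> computable (\<lambda>x. tlc (f x))"
  unfolding tlc_def by (intro computable_intros)

lemma computable_consc [computable_intros]:
  "computable f \<Longrightarrow> computable g \<Longrightarrow> computable (\<lambda>x. consc (f x) (g x))"
  unfolding consc_def by (intro computable_intros)

lemma computable_nthc [computable_intros]:
  "computable f \<Longrightarrow> computable g \<Longrightarrow> computable (\<lambda>x. nthc (f x) (g x))"
  unfolding nthc_def by (intro computable_intros)

text \<open>Kleene's normal form is taken as the definition; that the domain of a program has this form is
  derived from the fact that \<open>computes\<close> is an inductive relation with decidable rules.\<close>

definition re :: "(nat \<Rightarrow> bool) \<Rightarrow> bool" where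
  "re P \<longleftrightarrow> (\<exists>D. computable D \<and> (\<forall>x. P x \<longleftrightarrow> (\<exists>w. D (prod_encode (x, w)) = 0)))"

lemma reI:
  assumes "computable (\<lambda>p. D (pi1 p) (pi2 p))"
    and "\<And>x. P x \<longleftrightarrow> (\<exists>w. D x w = 0)"
  shows "re P"
  unfolding re_def by (rule exI, rule conjI, rule assms(1)) (simp add: assms(2))

lemma reD:
  assumes "re P"
  shows "\<exists>D. computable (\<lambda>p. D (pi1 p) (pi2 p))
    \<and> (\<forall>x. P x \<longleftrightarrow> (\<exists>w. D x w = (0::nat)))"
proof -
  from assms obtain D where D: "computable D" "\<forall>x. P x \<longleftrightarrow> (\<exists>w. D (prod_encode (x, w)) = 0)"
    unfolding re_def by blast
  then show ?thesis by (intro exI[of _ "\<lambda>x w. D (prod_encode (x, w))"]) simp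
qed

section \<open>Closure properties of recursively enumerable predicates\<close>

lemma computable_rel2:
  assumes "computable (\<lambda>p. D (pi1 p) (pi2 p))"
    and "computable f" "computable g"
  shows "computable (\<lambda>x. D (f x) (g x))"
  using computable_comp[OF assms(1) computable_pair[OF assms(2,3)]] by simp

lemma re_comp:
  assumes "re P" "computable f" shows "re (\<lambda>x. P (f x))"
proof -
  from reD[OF assms(1)] obtain D where D: "computable (\<lambda>p. D (pi1 p) (pi2 p))"
    "\<And>x. P x \<longleftrightarrow> (\<exists>w. D x w = (0::nat))" by blast
  show ?thesis
    by (rule reI[where D = "\<lambda>x w. D (f x) w"])
      (auto simp: D(2) intro!: computable_intros computable_rel2[OF D(1)] computable_comp[OF assms(2)])
qed

lemma re_eq [re_intros]:
  assumes "computable f" "computable g" shows "re (\<lambda>x. f x = g x)"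
  by (rule reI[where D = "\<lambda>x _. (f x - g x) + (g x - f x)"])
    (auto intro!: computable_intros intro: computable_comp[OF assms(1)] computable_comp[OF assms(2)])

lemma re_less [re_intros]:
  assumes "computable f" "computable g" shows "re (\<lambda>x. f x < g x)"
  by (rule reI[where D = "\<lambda>x _. Suc (f x) - g x"])
    (auto intro!: computable_intros intro: computable_comp[OF assms(1)] computable_comp[OF assms(2)])

lemma re_le [re_intros]:
  assumes "computable f" "computable g" shows "re (\<lambda>x. f x \<le> g x)"
  by (rule reI[where D = "\<lambda>x _. f x - g x"])
    (auto intro!: computable_intros intro: computable_comp[OF assms(1)] computable_comp[OF assms(2)])

lemma re_conj [re_intros]:
  assumes "re P" "re Q" shows "re (\<lambda>x. P x \<and> Q x)"
proof -
  from reD[OF assms(1)] obtain D where D: "computable (\<lambda>p. D (pi1 p) (pi2 p))"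
    "\<And>x. P x \<longleftrightarrow> (\<exists>w. D x w = (0::nat))" by blast
  from reD[OF assms(2)] obtain E where E: "computable (\<lambda>p. E (pi1 p) (pi2 p))"
    "\<And>x. Q x \<longleftrightarrow> (\<exists>w. E x w = (0::nat))" by blast
  show ?thesis
  proof (rule reI[where D = "\<lambda>x w. D x (pi1 w) + E x (pi2 w)"])
    fix x
    show "P x \<and> Q x \<longleftrightarrow> (\<exists>w. D x (pi1 w) + E x (pi2 w) = 0)"
    proof
      assume "P x \<and> Q x"
      then obtain v w where "D x v = 0" "E x w = 0" using D(2) E(2) by blast
      then have "D x (pi1 (prod_encode (v, w))) + E x (pi2 (prod_encode (v, w))) = 0"
        by simp
      then show "\<exists>w. D x (pi1 w) + E x (pi2 w) = 0" by blast
    qed (use D(2) E(2) in auto)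
  qed (intro computable_intros computable_rel2[OF D(1)] computable_rel2[OF E(1)])
qed

lemma re_disj [re_intros]:
  assumes "re P" "re Q" shows "re (\<lambda>x. P x \<or> Q x)"
proof -
  from reD[OF assms(1)] obtain D where D: "computable (\<lambda>p. D (pi1 p) (pi2 p))"
    "\<And>x. P x \<longleftrightarrow> (\<exists>w. D x w = (0::nat))" by blast
  from reD[OF assms(2)] obtain E where E: "computable (\<lambda>p. E (pi1 p) (pi2 p))"
    "\<And>x. Q x \<longleftrightarrow> (\<exists>w. E x w = (0::nat))" by blast
  show ?thesis
    by (rule reI[where D = "\<lambda>x w. D x w * E x w"])
      (auto simp: D(2) E(2) intro!: computable_intros computable_rel2[OF D(1)] computable_rel2[OF E(1)])
qed

lemma re_ex [re_intros]:
  assumes "re (\<lambda>p. P (pi1 p) (pi2 p))"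
  shows "re (\<lambda>x. \<exists>y. P x y)"
proof -
  from reD[OF assms] obtain D where D: "computable (\<lambda>p. D (pi1 p) (pi2 p))"
    "\<And>p. P (pi1 p) (pi2 p) \<longleftrightarrow> (\<exists>w. D p w = (0::nat))" by blast
  have P: "P x y \<longleftrightarrow> (\<exists>w. D (prod_encode (x, y)) w = 0)" for x y
    using D(2)[of "prod_encode (x, y)"] by simp
  show ?thesis
  proof (rule reI[where D = "\<lambda>x w. D (prod_encode (x, pi1 w)) (pi2 w)"])
    fix x
    show "(\<exists>y. P x y) \<longleftrightarrow> (\<exists>w. D (prod_encode (x, pi1 w)) (pi2 w) = 0)"
    proof
      assume "\<exists>y. P x y"
      then obtain y w where "D (prod_encode (x, y)) w = 0" using P by blast
      then show "\<exists>w. D (prod_encode (x, pi1 w)) (pi2 w) = 0"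
        by (intro exI[of _ "prod_encode (y, w)"]) simp
    qed (use P in blast)
  qed (intro computable_intros computable_rel2[OF D(1)])
qed

text \<open>One coded list holds the finitely many witnesses, and the sum of the values that have to
  be 0 is computed by recursion; it vanishes only if each summand does.\<close>

lemma re_all_less [re_intros]:
  assumes "computable g" "re (\<lambda>p. P (pi1 p) (pi2 p))"
  shows "re (\<lambda>x. \<forall>k < g x. P x k)"
proof -
  from reD[OF assms(2)] obtain D where D: "computable (\<lambda>p. D (pi1 p) (pi2 p))"
    "\<And>p. P (pi1 p) (pi2 p) \<longleftrightarrow> (\<exists>w. D p w = (0::nat))" by blast
  have P: "P x y \<longleftrightarrow> (\<exists>w. D (prod_encode (x, y)) w = 0)" for x y
    using D(2)[of "prod_encode (x, y)"] by simp
  let ?E = "\<lambda>x w. rec_nat 0 (\<lambda>k r. r + D (prod_encode (x, k)) (nthc w k)) (g x)"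
  have E: "rec_nat 0 (\<lambda>k r. r + D (prod_encode (x, k)) (nthc w k)) n = 0 \<longleftrightarrow>
      (\<forall>k<n. D (prod_encode (x, k)) (nthc w k) = 0)" for x w n
    by (induction n) (auto simp: less_Suc_eq)
  show ?thesis
  proof (rule reI[where D = ?E])
    fix x
    show "(\<forall>k<g x. P x k) \<longleftrightarrow> (\<exists>w. ?E x w = 0)"
    proof
      assume "\<forall>k<g x. P x k"
      then have "\<forall>k. \<exists>v. k < g x \<longrightarrow> D (prod_encode (x, k)) v = 0" using P by blast
      then obtain v where v: "\<And>k. k < g x \<Longrightarrow> D (prod_encode (x, k)) (v k) = 0" by metis
      obtain w where "\<forall>k<g x. nthc w k = v k" using ex_nthc by blast
      with v show "\<exists>w. ?E x w = 0" unfolding E by (intro exI[of _ w]) auto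
    qed (use P E in blast)
  qed (intro computable_intros computable_rel2[OF D(1)] computable_comp[OF assms(1)])
qed

lemma re_cong: "(\<And>x. P x \<longleftrightarrow> Q x) \<Longrightarrow> re P \<Longrightarrow> re Q"
  by presburger

section \<open>Inductive relations with recursively enumerable rules\<close>

text \<open>The universal machine, evaluation, translation, the tree and its bars are all presented
  by rules with at most two premises, so that one enumerability proof serves them all. A rule with
  one premise leaves the last argument of \<open>R\<close> free and is applied with the same premise
  twice.\<close>

inductive closure :: "(nat \<Rightarrow> bool) \<Rightarrow> (nat \<Rightarrow> nat \<Rightarrow> nat \<Rightarrow> bool) \<Rightarrow> nat \<Rightarrow> bool" for A R where
  closure_base: "A c \<Longrightarrow> closure A R c"
| closure_step: "R c p q \<Longrightarrow> closure A R p \<Longrightarrow> closure A R q \<Longrightarrow> closure A R c"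

definition derivation :: "(nat \<Rightarrow> bool) \<Rightarrow> (nat \<Rightarrow> nat \<Rightarrow> nat \<Rightarrow> bool) \<Rightarrow> nat \<Rightarrow> (nat \<Rightarrow> nat) \<Rightarrow> bool" where
  "derivation A R n f \<longleftrightarrow>
     (\<forall>k<n. A (f k) \<or> (\<exists>i j. i < k \<and> j < k \<and> R (f k) (f i) (f j)))"

lemma closure_iff_derivation:
  "closure A R x \<longleftrightarrow> (\<exists>n f. derivation A R n f \<and> (\<exists>k<n. f k = x))"
proof
  assume "closure A R x"
  then show "\<exists>n f. derivation A R n f \<and> (\<exists>k<n. f k = x)"
  proof induction
    case (closure_base c)
    then show ?case by (intro exI[of _ 1] exI[of _ "\<lambda>_. c"]) (auto simp: derivation_def)
  next
    case (closure_step c p q)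
    then obtain n f i m g j where *: "derivation A R n f" "i < n" "f i = p"
      "derivation A R m g" "j < m" "g j = q" by blast
    \<comment> \<open>The derivations of the two premises are concatenated and the conclusion comes
      last, at place \<open>n + m\<close>; references inside the second derivation move by
      \<open>n\<close>.\<close>
    define h where "h k = (if k < n then f k else if k < n + m then g (k - n) else c)" for k
    have "derivation A R (Suc (n + m)) h" unfolding derivation_def
    proof (intro allI impI)
      fix k assume k: "k < Suc (n + m)"
      consider "k < n" | "\<not> k < n" "k < n + m" | "k = n + m" using k by linarith
      then show "A (h k) \<or> (\<exists>i j. i < k \<and> j < k \<and> R (h k) (h i) (h j))"
      proof cases
        case 1
        then show ?thesis using *(1) unfolding derivation_def h_def
          by (smt (verit) order.strict_trans)
      next
        case 2
        then have "k - n < m" by linarith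
        then consider "A (g (k - n))" | i' j' where "i' < k - n" "j' < k - n" "R (g (k - n)) (g i') (g j')"
          using *(4) unfolding derivation_def by blast
        then show ?thesis
        proof cases
          case (2 i' j')
          with \<open>\<not> k < n\<close> \<open>k < n + m\<close> show ?thesis
            by (intro disjI2 exI[of _ "n + i'"] exI[of _ "n + j'"]) (auto simp: h_def)
        qed (use 2 in \<open>auto simp: h_def\<close>)
      next
        case 3
        then show ?thesis using * closure_step.hyps(1)
          by (intro disjI2 exI[of _ i] exI[of _ "n + j"]) (auto simp: h_def)
      qed
    qed
    moreover have "h (n + m) = c" by (simp add: h_def)
    ultimately show ?case by blast
  qed
next
  assume "\<exists>n f. derivation A R n f \<and> (\<exists>k<n. f k = x)"
  then obtain n f k where *: "derivation A R n f" "k < n" "f k = x" by blast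
  have "k < n \<Longrightarrow> closure A R (f k)" for k :: nat
  proof (induction k rule: less_induct)
    case (less k)
    with *(1) consider "A (f k)" | i j where "i < k" "j < k" "R (f k) (f i) (f j)"
      unfolding derivation_def by blast
    then show ?case
    proof cases
      case (2 i j)
      with less show ?thesis using closure_step[of R "f k" "f i" "f j" A] by simp
    qed (rule closure_base)
  qed
  with * show "closure A R x" by blast
qed

text \<open>A derivation is a coded list, and its correctness is a bounded condition on the entries
  of the list.\<close>

lemma re_closure:
  assumes A: "re A"
    and R: "re (\<lambda>p. R (pi1 p) (pi1 (pi2 p))
      (pi2 (pi2 p)))"
  shows "re (closure A R)"
proof -
  have R': "computable f \<Longrightarrow> computable g \<Longrightarrow> computable h \<Longrightarrow> re (\<lambda>x. R (f x) (g x) (h x))" for f g h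
    using re_comp[OF R, of "\<lambda>x. prod_encode (f x, prod_encode (g x, h x))"]
    by (simp add: computable_pair)
  have "re (\<lambda>x. \<exists>n w. (\<forall>k<n. A (nthc w k) \<or> (\<exists>i j. i < k \<and> j < k \<and> R (nthc w k) (nthc w i) (nthc w j)))
      \<and> (\<exists>k. k < n \<and> nthc w k = x))"
    by (intro re_intros re_comp[OF A] R' computable_intros)
  then show ?thesis
  proof (rule re_cong[rotated])
    fix x
    show "(\<exists>n w. (\<forall>k<n. A (nthc w k) \<or> (\<exists>i j. i < k \<and> j < k \<and> R (nthc w k) (nthc w i) (nthc w j)))
      \<and> (\<exists>k. k < n \<and> nthc w k = x)) \<longleftrightarrow> closure A R x" (is "?L \<longleftrightarrow> _")
    proof
      assume ?L
      then show "closure A R x" unfolding closure_iff_derivation derivation_def by blast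
    next
      assume "closure A R x"
      then obtain n f k where *: "derivation A R n f" "k < n" "f k = x"
        unfolding closure_iff_derivation by blast
      obtain w where w: "\<And>k. k < n \<Longrightarrow> nthc w k = f k" using ex_nthc by blast
      have "\<forall>k<n. A (nthc w k) \<or> (\<exists>i j. i < k \<and> j < k \<and> R (nthc w k) (nthc w i) (nthc w j))"
      proof (intro allI impI)
        fix k assume k: "k < n"
        then consider "A (f k)" | i j where "i < k" "j < k" "R (f k) (f i) (f j)"
          using *(1) unfolding derivation_def by blast
        then show "A (nthc w k) \<or> (\<exists>i j. i < k \<and> j < k \<and> R (nthc w k) (nthc w i) (nthc w j))"
        proof cases
          case (2 i j)
          then show ?thesis using k w by (intro disjI2 exI[of _ i] exI[of _ j]) auto
        qed (use k w in auto)
      qed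
      with *(2,3) w show ?L by blast
    qed
  qed
qed

section \<open>Enumeration, parametrisation and selection\<close>

abbreviation (input) "tag n x \<equiv> prod_encode (n, x)"
abbreviation (input) "trip a b c \<equiv> prod_encode (a, prod_encode (b, c))"

text \<open>Judgements: tag 0 for \<open>computes\<close>, tag 1 for positivity of all values below a bound (the
  premise of \<open>computes_Min\<close>), tag 2 for being the code of a program.\<close>

definition univ_base :: "nat \<Rightarrow> bool" where
  "univ_base z \<longleftrightarrow>
     (\<exists>x. z = tag 0 (trip (prod_encode (0, 0)) x 0)) \<or>
     (\<exists>x. z = tag 0 (trip (prod_encode (1, 0)) x (Suc x))) \<or>
     (\<exists>x. z = tag 0 (trip (prod_encode (2, 0)) x (pi1 x))) \<or>
     (\<exists>x. z = tag 0 (trip (prod_encode (3, 0)) x (pi2 x))) \<or>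
     (\<exists>f a. z = tag 1 (trip f a 0)) \<or>
     (\<exists>k<4. z = tag 2 (prod_encode (k, 0)))"

text \<open>Tag 2 is there because the base case of \<open>Prec f g\<close> does not run
  \<open>g\<close>, which still has to be a program. Tag 1 turns the unboundedly many premises of
  \<open>computes_Min\<close> into a chain of rules with two premises each.\<close>

definition univ_step :: "nat \<Rightarrow> nat \<Rightarrow> nat \<Rightarrow> bool" where
  "univ_step z p q \<longleftrightarrow>
     (\<exists>f g x a b. p = tag 0 (trip f x a) \<and> q = tag 0 (trip g x b) \<and>
        z = tag 0 (trip (tag 4 (prod_encode (f, g))) x (prod_encode (a, b)))) \<or>
     (\<exists>f g x a b. p = tag 0 (trip g x a) \<and> q = tag 0 (trip f a b) \<and>
        z = tag 0 (trip (tag 5 (prod_encode (f, g))) x b)) \<or>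
     (\<exists>f g a b. p = tag 0 (trip f a b) \<and> q = tag 2 g \<and>
        z = tag 0 (trip (tag 6 (prod_encode (f, g))) (prod_encode (a, 0)) b)) \<or>
     (\<exists>f g a n b c. p = tag 0 (trip (tag 6 (prod_encode (f, g))) (prod_encode (a, n)) b) \<and>
        q = tag 0 (trip g (trip a n b) c) \<and>
        z = tag 0 (trip (tag 6 (prod_encode (f, g))) (prod_encode (a, Suc n)) c)) \<or>
     (\<exists>f a m. p = tag 1 (trip f a m) \<and> q = tag 0 (trip f (prod_encode (a, m)) 0) \<and>
        z = tag 0 (trip (tag 7 f) a m)) \<or>
     (\<exists>f a m v. p = tag 1 (trip f a m) \<and> q = tag 0 (trip f (prod_encode (a, m)) (Suc v)) \<and>
        z = tag 1 (trip f a (Suc m))) \<or>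
     (\<exists>f g. p = tag 2 f \<and> q = tag 2 g \<and> (\<exists>k. 4 \<le> k \<and> k < 7 \<and> z = tag 2 (tag k (prod_encode (f, g))))) \<or>
     (\<exists>f. p = tag 2 f \<and> z = tag 2 (tag 7 f))"

lemma re_univ: "re (closure univ_base univ_step)"
  unfolding univ_base_def univ_step_def
  by (intro re_closure re_intros computable_intros)

definition univ_sound :: "nat \<Rightarrow> bool" where
  "univ_sound z \<longleftrightarrow>
     (\<forall>f x y. z = tag 0 (trip f x y) \<longrightarrow> (\<exists>c. recf_code c = f \<and> computes c x y)) \<and>
     (\<forall>f a m. z = tag 1 (trip f a m) \<longrightarrow>
        (\<forall>c. recf_code c = f \<longrightarrow> (\<forall>k<m. \<exists>v. computes c (prod_encode (a, k)) (Suc v)))) \<and>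
     (\<forall>f. z = tag 2 f \<longrightarrow> (\<exists>c. recf_code c = f))"

lemma univ_sound_tags [simp]:
  "univ_sound (tag 0 (trip f x y)) \<longleftrightarrow> (\<exists>c. recf_code c = f \<and> computes c x y)"
  "univ_sound (tag (Suc 0) (trip f a m)) \<longleftrightarrow>
     (\<forall>c. recf_code c = f \<longrightarrow> (\<forall>k<m. \<exists>v. computes c (prod_encode (a, k)) (Suc v)))"
  "univ_sound (tag 2 f) \<longleftrightarrow> (\<exists>c. recf_code c = f)"
  by (auto simp: univ_sound_def)

lemma univ_base_sound: "univ_base z \<Longrightarrow> univ_sound z"
proof -
  have "\<exists>c. recf_code c = prod_encode (k, 0)" if "k < 4" for k
  proof -
    from that consider "k = 0" | "k = 1" | "k = 2" | "k = 3" by linarith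
    then show ?thesis using recf_code.simps(1-4) by cases metis+
  qed
  moreover have "\<exists>c. recf_code c = prod_encode (0, 0) \<and> computes c x 0"
    "\<exists>c. recf_code c = prod_encode (Suc 0, 0) \<and> computes c x (Suc x)"
    "\<exists>c. recf_code c = prod_encode (2, 0) \<and> computes c x (pi1 x)"
    "\<exists>c. recf_code c = prod_encode (3, 0) \<and> computes c x (pi2 x)" for x
    using recf_code.simps(1-4) computes_Zero computes_Succ computes_fst_snd
    by (metis One_nat_def)+
  ultimately show "univ_base z \<Longrightarrow> univ_sound z"
    unfolding univ_base_def by auto
qed

lemma recf_codeI:
  "recf_code c = f \<Longrightarrow> recf_code d = g \<Longrightarrow> recf_code (Pairing c d) = tag 4 (prod_encode (f, g))"
  "recf_code c = f \<Longrightarrow> recf_code d = g \<Longrightarrow> recf_code (Comp c d) = tag 5 (prod_encode (f, g))"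
  "recf_code c = f \<Longrightarrow> recf_code d = g \<Longrightarrow> recf_code (Prec c d) = tag 6 (prod_encode (f, g))"
  "recf_code c = f \<Longrightarrow> recf_code (Min c) = tag 7 f"
  by simp_all

lemma univ_step_sound:
  assumes step: "univ_step z p q" and p: "univ_sound p" and q: "univ_sound q"
  shows "univ_sound z"
  using step unfolding univ_step_def
proof (elim disjE exE conjE)
  fix f g x a b
  assume *: "p = tag 0 (trip f x a)" "q = tag 0 (trip g x b)"
    "z = tag 0 (trip (tag 4 (prod_encode (f, g))) x (prod_encode (a, b)))"
  with p q obtain c d where "recf_code c = f" "computes c x a" "recf_code d = g" "computes d x b" by auto
  then show ?thesis unfolding *(3) univ_sound_tags by (meson recf_codeI computes_Pairing)
next
  fix f g x a b
  assume *: "p = tag 0 (trip g x a)" "q = tag 0 (trip f a b)"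
    "z = tag 0 (trip (tag 5 (prod_encode (f, g))) x b)"
  with p q obtain c d where "recf_code c = g" "computes c x a" "recf_code d = f" "computes d a b" by auto
  then show ?thesis unfolding *(3) univ_sound_tags by (meson recf_codeI computes_Comp)
next
  fix f g a b
  assume *: "p = tag 0 (trip f a b)" "q = tag 2 g"
    "z = tag 0 (trip (tag 6 (prod_encode (f, g))) (prod_encode (a, 0)) b)"
  with p q obtain c d where "recf_code c = f" "computes c a b" "recf_code d = g" by auto
  then show ?thesis unfolding *(3) univ_sound_tags by (meson recf_codeI computes_Prec_0)
next
  fix f g a n b c
  assume *: "p = tag 0 (trip (tag 6 (prod_encode (f, g))) (prod_encode (a, n)) b)"
    "q = tag 0 (trip g (trip a n b) c)"
    "z = tag 0 (trip (tag 6 (prod_encode (f, g))) (prod_encode (a, Suc n)) c)"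
  with p q obtain h d where h: "recf_code h = tag 6 (prod_encode (f, g))" "computes h (prod_encode (a, n)) b"
    and d: "recf_code d = g" "computes d (trip a n b) c" by auto
  \<comment> \<open>A code with tag 6 comes from \<open>Prec\<close> only, and injectivity
    identifies its second part with the program \<open>d\<close> that makes the last step.\<close>
  from h(1) obtain f' g' where "h = Prec f' g'" "recf_code f' = f" "recf_code g' = g"
    by (cases h) auto
  moreover from this d(1) inj_recf_code have "g' = d" by (metis injD)
  ultimately show ?thesis unfolding *(3) univ_sound_tags using h d(2) computes_Prec_Suc by blast
next
  fix f a m
  assume *: "p = tag 1 (trip f a m)" "q = tag 0 (trip f (prod_encode (a, m)) 0)"
    "z = tag 0 (trip (tag 7 f) a m)"
  with q obtain c where c: "recf_code c = f" "computes c (prod_encode (a, m)) 0" by auto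
  with p * have "\<forall>k<m. \<exists>v. computes c (prod_encode (a, k)) (Suc v)" by simp
  with c show ?thesis unfolding *(3) univ_sound_tags by (meson recf_codeI computes_Min)
next
  fix f a m v
  assume *: "p = tag 1 (trip f a m)" "q = tag 0 (trip f (prod_encode (a, m)) (Suc v))"
    "z = tag 1 (trip f a (Suc m))"
  with q obtain c where c: "recf_code c = f" "computes c (prod_encode (a, m)) (Suc v)" by auto
  with p * have "\<forall>k<m. \<exists>v. computes c (prod_encode (a, k)) (Suc v)" by simp
  with c show ?thesis unfolding *(3) using inj_recf_code by (auto simp: less_Suc_eq dest: injD)
next
  fix f g k
  assume *: "p = tag 2 f" "q = tag 2 g" "4 \<le> k" "k < 7" "z = tag 2 (tag k (prod_encode (f, g)))"
  with p q obtain c d where "recf_code c = f" "recf_code d = g" by auto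
  moreover from * consider "k = 4" | "k = 5" | "k = 6" by linarith
  ultimately show ?thesis unfolding *(5) univ_sound_tags by (metis recf_codeI)
next
  fix f assume *: "p = tag 2 f" "z = tag 2 (tag 7 f)"
  with p show ?thesis unfolding *(2) univ_sound_tags by (auto simp: * intro: recf_codeI)
qed

lemma univ_closure_sound: "closure univ_base univ_step z \<Longrightarrow> univ_sound z"
  by (induction rule: closure.induct) (auto intro: univ_base_sound univ_step_sound)

lemma univ_recf: "closure univ_base univ_step (tag 2 (recf_code c))"
proof (induction c)
  case (Pairing c d)
  show ?case by (rule closure_step[OF _ Pairing]) (auto simp: univ_step_def)
next
  case (Comp c d)
  show ?case by (rule closure_step[OF _ Comp]) (auto simp: univ_step_def)
next
  case (Prec c d)
  show ?case by (rule closure_step[OF _ Prec]) (auto simp: univ_step_def)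
next
  case (Min c)
  show ?case by (rule closure_step[OF _ Min Min]) (auto simp: univ_step_def)
qed (rule closure_base, auto simp: univ_base_def)+

lemma univ_computes: "computes c x y \<Longrightarrow> closure univ_base univ_step (tag 0 (trip (recf_code c) x y))"
proof (induction rule: computes.induct)
  case (computes_Pairing f x a g b)
  show ?case by (rule closure_step[OF _ computes_Pairing.IH]) (auto simp: univ_step_def)
next
  case (computes_Comp g x a f b)
  show ?case by (rule closure_step[OF _ computes_Comp.IH]) (auto simp: univ_step_def)
next
  case (computes_Prec_0 f a b g)
  show ?case
    by (rule closure_step[OF _ computes_Prec_0.IH univ_recf[of g]]) (auto simp: univ_step_def)
next
  case (computes_Prec_Suc f g a n b c)
  show ?case by (rule closure_step[OF _ computes_Prec_Suc.IH]) (auto simp: univ_step_def)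
next
  case (computes_Min f a m)
  have "k \<le> m \<Longrightarrow> closure univ_base univ_step (tag 1 (trip (recf_code f) a k))" for k
  proof (induction k)
    case 0
    show ?case by (rule closure_base) (auto simp: univ_base_def)
  next
    case (Suc k)
    then obtain v where v: "closure univ_base univ_step (tag 0 (trip (recf_code f) (prod_encode (a, k)) (Suc v)))"
      using computes_Min.IH(2)[of k] by auto
    from Suc have hc: "closure univ_base univ_step (tag 1 (trip (recf_code f) a k))" by simp
    show ?case by (rule closure_step[OF _ hc v]) (auto simp: univ_step_def)
  qed
  then have hc: "closure univ_base univ_step (tag 1 (trip (recf_code f) a m))" by simp
  show ?case by (rule closure_step[OF _ hc computes_Min.IH(1)]) (auto simp: univ_step_def)
qed (rule closure_base, auto simp: univ_base_def)+

definition runs :: "nat \<Rightarrow> nat \<Rightarrow> nat \<Rightarrow> bool" where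
  "runs i x y \<longleftrightarrow> (\<exists>c. recf_code c = i \<and> computes c x y)"

lemma runs_iff_univ: "runs i x y \<longleftrightarrow> closure univ_base univ_step (tag 0 (trip i x y))"
  unfolding runs_def using univ_computes univ_closure_sound univ_sound_tags(1) by blast

lemma runs_code: "runs (recf_code c) x y \<longleftrightarrow> computes c x y"
  unfolding runs_def using inj_recf_code by (metis injD)

lemma runs_deterministic: "runs i x y \<Longrightarrow> runs i x z \<Longrightarrow> y = z"
  unfolding runs_def using inj_recf_code computes_deterministic by (metis injD)

lemma re_runs [re_intros]:
  "computable f \<Longrightarrow> computable g \<Longrightarrow> computable h \<Longrightarrow> re (\<lambda>x. runs (f x) (g x) (h x))"
  unfolding runs_iff_univ by (rule re_comp[OF re_univ]) (intro computable_intros)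

lemma W_iff_runs: "x \<in> W i \<longleftrightarrow> (\<exists>y. runs i x y)"
  unfolding W_def runs_def by blast

lemma re_rel2:
  assumes "re (\<lambda>p. P (pi1 p) (pi2 p))" "computable f" "computable g"
  shows "re (\<lambda>x. P (f x) (g x))"
  using re_comp[OF assms(1) computable_pair[OF assms(2,3)]] by simp

lemma re_W [re_intros]: "computable f \<Longrightarrow> computable g \<Longrightarrow> re (\<lambda>x. f x \<in> W (g x))"
  by (rule re_rel2) (unfold W_iff_runs, intro re_intros computable_intros)

lemma re_computes [re_intros]:
  "computable f \<Longrightarrow> computable g \<Longrightarrow> re (\<lambda>x. computes c (f x) (g x))"
  unfolding runs_code[symmetric] by (intro re_intros computable_intros)

text \<open>The program searches for a pair of a value and a witness and returns the value. It finds
  some value in the relation, not a prescribed one; later uses of its output must allow for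
  that.\<close>

lemma selection:
  assumes "re (\<lambda>p. P (pi1 p) (pi2 p))"
  obtains c where "\<And>x y. computes c x y \<Longrightarrow> P x y" "\<And>x y. P x y \<Longrightarrow> \<exists>z. computes c x z"
proof -
  from reD[OF assms] obtain D where D: "computable (\<lambda>p. D (pi1 p) (pi2 p))"
    "\<And>p. P (pi1 p) (pi2 p) \<longleftrightarrow> (\<exists>w. D p w = (0::nat))" by blast
  have P: "P x y \<longleftrightarrow> (\<exists>w. D (prod_encode (x, y)) w = 0)" for x y
    using D(2)[of "prod_encode (x, y)"] by simp
  let ?E = "\<lambda>x w. D (prod_encode (x, pi1 w)) (pi2 w)"
  have "computable (\<lambda>p. ?E (pi1 p) (pi2 p))"
    by (intro computable_intros computable_rel2[OF D(1)])
  then obtain e where "\<And>p. computes e p (?E (pi1 p) (pi2 p))"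
    unfolding computable_def by blast
  from this[of "prod_encode (x, w)" for x w] have e: "computes e (prod_encode (x, w)) (?E x w)" for x w
    by simp
  have sound: "?E x m = 0" if "computes (Min e) x m" for x m
  proof -
    from that have "computes e (prod_encode (x, m)) 0" by (auto elim: computes_elims(8))
    from computes_deterministic[OF e this] show ?thesis .
  qed
  show ?thesis
  proof (rule that[of "Comp Fst (Min e)"])
    fix x y assume "computes (Comp Fst (Min e)) x y"
    then obtain m where "computes (Min e) x m" "computes Fst m y" by (auto elim: computes_elims(6))
    moreover from this have "y = pi1 m" using computes_deterministic computes_fst_snd by blast
    ultimately show "P x y" using sound P by blast
  next
    fix x y assume "P x y"
    then obtain w where "D (prod_encode (x, y)) w = 0" using P by blast
    then have ex: "?E x (prod_encode (y, w)) = 0" by simp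
    define m where "m = (LEAST m. ?E x m = 0)"
    have "?E x m = 0" unfolding m_def by (rule LeastI, rule ex)
    moreover have "\<exists>v. computes e (prod_encode (x, k)) (Suc v)" if "k < m" for k
      using not_less_Least[OF that[unfolded m_def]] e[of x k] by (metis not0_implies_Suc)
    ultimately have "computes (Min e) x m" using e[of x m] by (metis computes_Min)
    then show "\<exists>z. computes (Comp Fst (Min e)) x z" using computes_Comp computes_fst_snd by blast
  qed
qed

section \<open>Enumeration of predicates and the s-m-n theorem\<close>

primrec const_prog :: "nat \<Rightarrow> recf" where
  "const_prog 0 = Zero"
| "const_prog (Suc n) = Comp Succ (const_prog n)"

lemma computes_const_prog: "computes (const_prog n) x n"
  by (induction n) (auto intro: computes.intros)

lemma computable_const_prog [computable_intros]:
  assumes "computable f" shows "computable (\<lambda>x. recf_code (const_prog (f x)))"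
proof -
  have "recf_code (const_prog n) =
      rec_nat (prod_encode (0, 0)) (\<lambda>_ r. prod_encode (5, prod_encode (prod_encode (1, 0), r))) n" for n
    by (induction n) auto
  then show ?thesis by (simp only:) (intro computable_intros assms)
qed

lemma re_enumerated:
  assumes "re P" obtains i where "W i = {x. P x}"
proof -
  have "re (\<lambda>p. P (pi1 p))" by (intro re_comp[OF assms] computable_intros)
  then obtain c where "\<And>x y. computes c x y \<Longrightarrow> P x" "\<And>x. P x \<Longrightarrow> \<exists>z. computes c x z"
    by (rule selection[where P = "\<lambda>x y. P x"]) blast
  then have "W (recf_code c) = {x. P x}"
    unfolding set_eq_iff W_iff_runs runs_code by blast
  then show ?thesis by (rule that)
qed

text \<open>The parameter is built in as a constant program in front of a program for the whole
  relation, and codes of constant programs are computed by recursion.\<close>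

lemma smn:
  assumes "re (\<lambda>p. P (pi1 p) (pi2 p))"
  obtains g where "computable g" "\<And>a. W (g a) = {x. P a x}"
proof -
  have "re (\<lambda>p. P (pi1 (pi1 p)) (pi2 (pi1 p)))"
    using re_comp[OF assms computable_fst[OF computable_id]] .
  then obtain c where c:
    "\<And>p y. computes c p y \<Longrightarrow> P (pi1 p) (pi2 p)"
    "\<And>p. P (pi1 p) (pi2 p) \<Longrightarrow> \<exists>z. computes c p z"
    by (rule selection[where P = "\<lambda>p y. P (pi1 p) (pi2 p)"]) blast
  define prog where "prog a = Comp c (Pairing (const_prog a) (Pairing Fst Snd))" for a
  have prog: "computes (prog a) x y \<longleftrightarrow> computes c (prod_encode (a, x)) y" for a x y
  proof
    assume "computes (prog a) x y"
    then obtain p where p: "computes (Pairing (const_prog a) (Pairing Fst Snd)) x p" "computes c p y"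
      unfolding prog_def by (auto elim: computes_elims(6))
    moreover have "p = prod_encode (a, x)"
      using computes_deterministic[OF p(1)] computes_Pairing[OF computes_const_prog computes_id] by blast
    ultimately show "computes c (prod_encode (a, x)) y" by simp
  next
    assume "computes c (prod_encode (a, x)) y"
    then show "computes (prog a) x y" unfolding prog_def
      using computes_Comp[OF computes_Pairing[OF computes_const_prog computes_id]] by blast
  qed
  show ?thesis
  proof (rule that[of "\<lambda>a. recf_code (prog a)"])
    show "computable (\<lambda>a. recf_code (prog a))"
      unfolding prog_def recf_code.simps by (intro computable_intros)
    fix a
    have "(\<exists>y. computes c (prod_encode (a, x)) y) \<longleftrightarrow> P a x" for x
      using c[of "prod_encode (a, x)"] by auto
    then show "W (recf_code (prog a)) = {x. P a x}"
      unfolding set_eq_iff W_iff_runs runs_code prog by simp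
  qed
qed

lemma partial_recursive2_computes:
  "\<exists>f. partial_recursive2 f \<and> (\<forall>i j y. f i j = Some y \<longleftrightarrow> computes c (prod_encode (i, j)) y)"
proof -
  define f where "f i j = (if \<exists>y. computes c (prod_encode (i, j)) y
    then Some (THE y. computes c (prod_encode (i, j)) y) else None)" for i j
  have "f i j = Some y \<longleftrightarrow> computes c (prod_encode (i, j)) y" for i j y
    unfolding f_def using computes_deterministic by (auto intro: the_equality theI2)
  then show ?thesis unfolding partial_recursive2_def by blast
qed

section \<open>Equivalence structures and their first-order theories\<close>

text \<open>Pairs \<open>(n, i)\<close> with distinct \<open>n\<close> are inequivalent; if \<open>b n\<close> then \<open>{(n, i) | i \<le> n}\<close> is split
  off as a class with \<open>n + 1\<close> elements. All other classes are infinite.\<close>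

definition eqv :: "(nat \<Rightarrow> bool) \<Rightarrow> nat \<Rightarrow> nat \<Rightarrow> bool" where
  "eqv b x y \<longleftrightarrow> pi1 x = pi1 y \<and>
     (b (pi1 x) \<longrightarrow>
       (pi2 x \<le> pi1 x \<longleftrightarrow> pi2 y \<le> pi1 y))"

definition tmval :: "(nat \<Rightarrow> nat) \<Rightarrow> nat \<Rightarrow> nat" where
  "tmval e t = (if pi1 t = 0 then e (pi2 t) else 0)"

lemma prod_encode_ge: "k + y \<le> prod_encode (k, y)"
proof -
  have "n \<le> triangle n" for n by (induction n) auto
  from this[of "k + y"] show ?thesis by (simp add: prod_encode_def)
qed

lemma prod_encode_less: "0 < k \<Longrightarrow> y < prod_encode (k, y)"
  using prod_encode_ge[of k y] by linarith

lemma prod_decode_less: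
  assumes "0 < pi1 x"
  shows "pi2 x < x" "pi1 (pi2 x) < x"
    "pi2 (pi2 x) < x"
proof -
  show *: "pi2 x < x"
    using prod_encode_less[OF assms, of "pi2 x"] by simp
  have "pi1 y \<le> y" "pi2 y \<le> y" for y
    using prod_encode_ge[of "pi1 y" "pi2 y"] by simp_all
  with * show "pi1 (pi2 x) < x" "pi2 (pi2 x) < x"
    by (meson order.strict_trans1)+
qed

text \<open>Satisfaction is defined on codes, and by default for numbers that are not codes. Function
  terms denote 0, and \<open>Rel 1\<close> is the only relation symbol that is not empty.\<close>

function satc :: "nat set \<Rightarrow> (nat \<Rightarrow> bool) \<Rightarrow> (nat \<Rightarrow> nat) \<Rightarrow> nat \<Rightarrow> bool" where
  "satc D b e x =
    (if pi1 x = 1 then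
       tmval e (pi1 (pi2 x)) = tmval e (pi2 (pi2 x))
     else if pi1 x = 2 then
       \<exists>s t. pi2 x = prod_encode (1, consc s (consc t 0)) \<and> eqv b (tmval e s) (tmval e t)
     else if pi1 x = 3 then
       satc D b e (pi1 (pi2 x)) \<longrightarrow> satc D b e (pi2 (pi2 x))
     else if pi1 x = 4 then
       \<forall>a\<in>D. satc D b (case_nat a e) (pi2 x)
     else False)"
  by auto
termination
  by (relation "measure (\<lambda>(D, b, e, x). x)") (auto intro: prod_decode_less)

declare satc.simps [simp del]

lemma satc_tags [simp]:
  "satc D b e (prod_encode (0, y)) \<longleftrightarrow> False"
  "satc D b e (prod_encode (1, prod_encode (s, t))) \<longleftrightarrow> tmval e s = tmval e t"
  "satc D b e (prod_encode (2, y)) \<longleftrightarrow>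
     (\<exists>s t. y = prod_encode (1, consc s (consc t 0)) \<and> eqv b (tmval e s) (tmval e t))"
  "satc D b e (prod_encode (3, prod_encode (x, y))) \<longleftrightarrow> (satc D b e x \<longrightarrow> satc D b e y)"
  "satc D b e (prod_encode (4, x)) \<longleftrightarrow> (\<forall>a\<in>D. satc D b (case_nat a e) x)"
  "4 < k \<Longrightarrow> satc D b e (prod_encode (k, x)) \<longleftrightarrow> False"
  by (subst satc.simps; simp)+

declare satc_tags [unfolded One_nat_def, simp]

abbreviation sat :: "(nat \<Rightarrow> bool) \<Rightarrow> (nat \<Rightarrow> nat) \<Rightarrow> fm \<Rightarrow> bool" where
  "sat b e p \<equiv> satc UNIV b e (fm_code p)"

lemma code_induct [case_names Bot Eq Rel Imp Forall Junk]:
  assumes "\<And>y. P (prod_encode (0, y))"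
    and "\<And>s t. P (prod_encode (1, prod_encode (s, t)))"
    and "\<And>y. P (prod_encode (2, y))"
    and "\<And>x y. P x \<Longrightarrow> P y \<Longrightarrow> P (prod_encode (3, prod_encode (x, y)))"
    and "\<And>x. P x \<Longrightarrow> P (prod_encode (4, x))"
    and "\<And>k x. 4 < k \<Longrightarrow> P (prod_encode (k, x))"
  shows "P x"
proof (induction x rule: less_induct)
  case (less z)
  obtain k y where z: "z = prod_encode (k, y)" by (metis prod_decode_inverse surj_pair)
  obtain s t where y: "y = prod_encode (s, t)" by (metis prod_decode_inverse surj_pair)
  consider "k = 0" | "k = 1" | "k = 2" | "k = 3" | "k = 4" | "4 < k" by linarith
  then show ?case
  proof cases
    case 4
    then have "s < z" "t < z"
      using prod_decode_less[of z] by (auto simp: z y)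
    with 4 show ?thesis using assms(4) less by (auto simp: z y)
  next
    case 5
    then have "y < z" using prod_decode_less[of z] by (auto simp: z)
    with 5 show ?thesis using assms(5) less by (auto simp: z)
  qed (use assms y z in auto)
qed

subsection \<open>Back-and-forth equivalence\<close>

definition sized :: "nat set \<Rightarrow> (nat \<Rightarrow> bool) \<Rightarrow> nat \<Rightarrow> nat \<Rightarrow> bool" where
  "sized D b a s \<longleftrightarrow> finite {x\<in>D. eqv b a x} \<and> card {x\<in>D. eqv b a x} = s"

text \<open>What a player needs in order to survive \<open>N\<close> moves: a class with fewer than
  \<open>N\<close> elements is determined by its size, and there are at least \<open>N\<close>
  classes that are larger, so that a fresh one is always left.\<close>

definition rich :: "nat \<Rightarrow> nat set \<Rightarrow> (nat \<Rightarrow> bool) \<Rightarrow> bool" where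
  "rich N D b \<longleftrightarrow>
     (\<forall>a\<in>D. \<forall>c\<in>D. \<forall>s<N. sized D b a s \<longrightarrow> sized D b c s \<longrightarrow> eqv b a c) \<and>
     (\<exists>Z\<subseteq>D. finite Z \<and> card Z = N \<and> (\<forall>z\<in>Z. \<forall>s<N. \<not> sized D b z s) \<and>
        (\<forall>z\<in>Z. \<forall>w\<in>Z. eqv b z w \<longrightarrow> z = w))"

definition same_sizes :: "nat \<Rightarrow> nat set \<Rightarrow> (nat \<Rightarrow> bool) \<Rightarrow> nat set \<Rightarrow> (nat \<Rightarrow> bool) \<Rightarrow> bool" where
  "same_sizes N D b D' b' \<longleftrightarrow> (\<forall>s<N. (\<exists>a\<in>D. sized D b a s) \<longleftrightarrow> (\<exists>a\<in>D'. sized D' b' a s))"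

definition partial_iso ::
  "nat \<Rightarrow> nat set \<Rightarrow> (nat \<Rightarrow> bool) \<Rightarrow> nat set \<Rightarrow> (nat \<Rightarrow> bool) \<Rightarrow> (nat \<times> nat) set \<Rightarrow> bool" where
  "partial_iso N D b D' b' R \<longleftrightarrow> finite R \<and>
     (\<forall>a a'. (a, a') \<in> R \<longrightarrow> a \<in> D \<and> a' \<in> D' \<and> (\<forall>s<N. sized D b a s \<longleftrightarrow> sized D' b' a' s)) \<and>
     (\<forall>a a' c c'. (a, a') \<in> R \<longrightarrow> (c, c') \<in> R \<longrightarrow> (a = c \<longleftrightarrow> a' = c') \<and> (eqv b a c \<longleftrightarrow> eqv b' a' c'))"

lemma eqv_refl [simp]: "eqv b a a"
  and eqv_sym: "eqv b a c \<Longrightarrow> eqv b c a"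
  and eqv_trans: "eqv b a c \<Longrightarrow> eqv b c d \<Longrightarrow> eqv b a d"
  by (auto simp: eqv_def)

lemma eqv_class: "eqv b a c \<Longrightarrow> {x\<in>D. eqv b a x} = {x\<in>D. eqv b c x}"
  using eqv_sym eqv_trans by blast

lemma sized_eqv: "eqv b a c \<Longrightarrow> sized D b a s \<longleftrightarrow> sized D b c s"
  unfolding sized_def by (simp add: eqv_class)

lemma partial_iso_converse: "partial_iso N D b D' b' R \<Longrightarrow> partial_iso N D' b' D b (R\<inverse>)"
  unfolding partial_iso_def converse_iff finite_converse by blast

lemma same_sizes_sym: "same_sizes N D b D' b' \<Longrightarrow> same_sizes N D' b' D b"
  unfolding same_sizes_def by blast

lemma partial_iso_insert:
  assumes R: "partial_iso N D b D' b' R" and a: "a \<in> D" "a' \<in> D'"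
    and s: "\<And>s. s < N \<Longrightarrow> sized D b a s \<longleftrightarrow> sized D' b' a' s"
    and e: "\<And>c c'. (c, c') \<in> R \<Longrightarrow> (a = c \<longleftrightarrow> a' = c') \<and> (eqv b a c \<longleftrightarrow> eqv b' a' c')"
  shows "partial_iso N D b D' b' (insert (a, a') R)"
proof -
  have e': "(c, c') \<in> R \<Longrightarrow> (c = a \<longleftrightarrow> c' = a') \<and> (eqv b c a \<longleftrightarrow> eqv b' c' a')" for c c'
    using e eqv_sym by metis
  show ?thesis unfolding partial_iso_def
  proof (intro conjI allI impI)
    fix c c' assume c: "(c, c') \<in> insert (a, a') R"
    show "c \<in> D" "c' \<in> D'" using c R a unfolding partial_iso_def by blast+
    show "sized D b c r \<longleftrightarrow> sized D' b' c' r" if "r < N" for r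
      using c R s that unfolding partial_iso_def by blast
    fix d d' assume d: "(d, d') \<in> insert (a, a') R"
    show "c = d \<longleftrightarrow> c' = d'" "eqv b c d \<longleftrightarrow> eqv b' c' d'"
      using c d R e e' eqv_refl[of b a] eqv_refl[of b' a'] unfolding partial_iso_def insert_iff prod.inject
      by metis+
  qed (use R in \<open>simp add: partial_iso_def\<close>)
qed

text \<open>A new element of a class already met is answered in the corresponding class. An element
  of a new class is answered in the class of the same size if that size is below \<open>N\<close>,
  and otherwise in one of the large classes that has not been met.\<close>

lemma forth:
  assumes R: "partial_iso N D b D' b' R" and N: "card R < N"
    and rich: "rich N D b" "rich N D' b'" and sizes: "same_sizes N D b D' b'" and a: "a \<in> D"
  obtains a' where "a' \<in> D'" "partial_iso N D b D' b' (insert (a, a') R)"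
proof -
  have fin: "finite R" using R by (simp add: partial_iso_def)
  have iso: "(c, c') \<in> R \<Longrightarrow> c \<in> D \<and> c' \<in> D' \<and> (\<forall>s<N. sized D b c s \<longleftrightarrow> sized D' b' c' s)"
    and iso2: "(c, c') \<in> R \<Longrightarrow> (d, d') \<in> R \<Longrightarrow> (c = d \<longleftrightarrow> c' = d') \<and> (eqv b c d \<longleftrightarrow> eqv b' c' d')"
    for c c' d d'
    using R unfolding partial_iso_def by blast+
  consider a' where "(a, a') \<in> R"
    | c c' where "(c, c') \<in> R" "eqv b a c" "\<And>a'. (a, a') \<notin> R"
    | "\<And>c c'. (c, c') \<in> R \<Longrightarrow> \<not> eqv b a c" by blast
  then show ?thesis
  proof cases
    case (1 a')
    then show ?thesis using that[of a'] R iso by (auto simp: insert_absorb)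
  next
    case (2 c c')
    let ?C = "{x\<in>D. eqv b c x}" and ?C' = "{x\<in>D'. eqv b' c' x}"
    \<comment> \<open>If the corresponding class were used up, it would have fewer than
      \<open>N\<close> elements, so both classes would have the same size; the pairs of
      \<open>R\<close> would then exhaust the class of \<open>a\<close> too, and \<open>a\<close>
      itself would be used.\<close>
    have "\<not> ?C' \<subseteq> snd ` R"
    proof
      assume sub: "?C' \<subseteq> snd ` R"
      then have fin': "finite ?C'" using fin finite_subset by blast
      have "card ?C' \<le> card R" using sub fin by (meson card_image_le card_mono finite_imageI le_trans)
      then have "card ?C' < N" using N by simp
      then have "sized D b c (card ?C')" using iso[OF 2(1)] fin' by (auto simp: sized_def)
      then have finC: "finite ?C" and eq: "card ?C = card ?C'" by (auto simp: sized_def)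
      have "\<forall>y\<in>?C'. \<exists>x. (x, y) \<in> R" using sub by force
      then obtain g where g: "\<And>y. y \<in> ?C' \<Longrightarrow> (g y, y) \<in> R" by metis
      have "inj_on g ?C'"
      proof (rule inj_onI)
        fix x y assume "x \<in> ?C'" "y \<in> ?C'" "g x = g y"
        then show "x = y" using iso2[OF g g, of x y] by simp
      qed
      moreover have gC: "g ` ?C' \<subseteq> ?C"
      proof
        fix x assume "x \<in> g ` ?C'"
        then obtain y where "x = g y" "y \<in> ?C'" by blast
        with g have "(x, y) \<in> R" "eqv b' c' y" by auto
        then show "x \<in> ?C" using iso iso2[OF 2(1)] by blast
      qed
      ultimately have "g ` ?C' = ?C" using finC eq by (metis card_image card_subset_eq)
      moreover have "a \<in> ?C" using a 2(2) eqv_sym by blast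
      ultimately have "a \<in> g ` ?C'" by simp
      then obtain y where "a = g y" "y \<in> ?C'" by (rule imageE)
      with g 2(3) show False by blast
    qed
    then obtain a' where a': "a' \<in> D'" "eqv b' c' a'" "a' \<notin> snd ` R" by blast
    have "partial_iso N D b D' b' (insert (a, a') R)"
    proof (rule partial_iso_insert[OF R a a'(1)])
      fix s assume "s < N"
      then show "sized D b a s \<longleftrightarrow> sized D' b' a' s"
        using iso[OF 2(1)] sized_eqv[OF 2(2)] sized_eqv[OF a'(2)] by simp
    next
      fix d d' assume d: "(d, d') \<in> R"
      have "eqv b a d \<longleftrightarrow> eqv b c d" using 2(2) eqv_sym eqv_trans by blast
      moreover have "eqv b' a' d' \<longleftrightarrow> eqv b' c' d'" using a'(2) eqv_sym eqv_trans by blast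
      ultimately show "(a = d \<longleftrightarrow> a' = d') \<and> (eqv b a d \<longleftrightarrow> eqv b' a' d')"
        using iso2[OF 2(1) d] d 2(3) a'(3) by force
    qed
    with a'(1) show ?thesis by (rule that)
  next
    case 3
    obtain a' where a': "a' \<in> D'" "\<And>s. s < N \<Longrightarrow> sized D b a s \<longleftrightarrow> sized D' b' a' s"
      "\<And>c c'. (c, c') \<in> R \<Longrightarrow> \<not> eqv b' a' c'"
    proof (cases "\<exists>s<N. sized D b a s")
      case True
      then obtain s where s: "s < N" "sized D b a s" by blast
      then obtain a' where a': "a' \<in> D'" "sized D' b' a' s" using sizes a unfolding same_sizes_def by blast
      show ?thesis
      proof (rule that[OF a'(1)])
        fix r show "r < N \<Longrightarrow> sized D b a r \<longleftrightarrow> sized D' b' a' r"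
          using s a' unfolding sized_def by auto
      next
        fix c c' assume c: "(c, c') \<in> R"
        show "\<not> eqv b' a' c'"
        proof
          assume "eqv b' a' c'"
          from sized_eqv[OF this] a'(2) have "sized D' b' c' s" by simp
          then have "sized D b c s" using iso[OF c] s(1) by blast
          then have "eqv b a c" using rich(1) s a iso[OF c] unfolding rich_def by blast
          with 3 c show False by blast
        qed
      qed
    next
      case False
      from rich(2)[unfolded rich_def, THEN conjunct2] obtain Z
        where Z0: "Z \<subseteq> D' \<and> finite Z \<and> card Z = N \<and> (\<forall>z\<in>Z. \<forall>s<N. \<not> sized D' b' z s) \<and>
          (\<forall>z\<in>Z. \<forall>w\<in>Z. eqv b' z w \<longrightarrow> z = w)" by (elim exE)
      then have Z: "Z \<subseteq> D'" "finite Z" "card Z = N" "\<And>z s. z \<in> Z \<Longrightarrow> s < N \<Longrightarrow> \<not> sized D' b' z s"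
        "\<And>z w. z \<in> Z \<Longrightarrow> w \<in> Z \<Longrightarrow> eqv b' z w \<Longrightarrow> z = w"
        by simp_all
      \<comment> \<open>Pigeonhole: there are \<open>N\<close> inequivalent candidates, and each of
        the fewer than \<open>N\<close> pairs of \<open>R\<close> can rule out one at most.\<close>
      have "\<exists>z\<in>Z. \<forall>(c, c')\<in>R. \<not> eqv b' z c'"
      proof (rule ccontr)
        assume "\<not> ?thesis"
        then have "\<forall>z\<in>Z. \<exists>r. r \<in> R \<and> eqv b' z (snd r)" by force
        then obtain g where g: "\<And>z. z \<in> Z \<Longrightarrow> g z \<in> R \<and> eqv b' z (snd (g z))" by metis
        have "inj_on g Z"
        proof (rule inj_onI)
          fix z w assume zw: "z \<in> Z" "w \<in> Z" "g z = g w"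
          then have "eqv b' z (snd (g z))" "eqv b' w (snd (g z))" using g[of z] g[of w] by simp_all
          then have "eqv b' z w" using eqv_sym eqv_trans by blast
          then show "z = w" using Z(5) zw by blast
        qed
        moreover have "g ` Z \<subseteq> R" using g by blast
        ultimately have "card Z \<le> card R" using fin by (rule card_inj_on_le)
        then show False using Z(3) N by simp
      qed
      then obtain z where "z \<in> Z" "\<forall>(c, c')\<in>R. \<not> eqv b' z c'" by blast
      then show ?thesis using False Z(1,4) by (intro that[of z]) auto
    qed
    have "partial_iso N D b D' b' (insert (a, a') R)"
    proof (rule partial_iso_insert[OF R a a'(1,2)])
      fix c c' assume "(c, c') \<in> R"
      then have "\<not> eqv b a c" "\<not> eqv b' a' c'" using 3 a'(3) by blast+
      then show "(a = c \<longleftrightarrow> a' = c') \<and> (eqv b a c \<longleftrightarrow> eqv b' a' c')" by (metis eqv_refl)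
    qed
    with a'(1) show ?thesis by (rule that)
  qed
qed

text \<open>The code of a formula bounds its quantifier depth.\<close>

lemma back_and_forth:
  assumes "partial_iso N D b D' b' R" "card R + x \<le> N" "\<And>i. (e i, e' i) \<in> R" "(0, 0) \<in> R"
    and "rich N D b" "rich N D' b'" "same_sizes N D b D' b'"
  shows "satc D b e x \<longleftrightarrow> satc D' b' e' x"
  using assms(1-4)
proof (induction x arbitrary: R e e' rule: code_induct)
  case (Eq s t)
  have "(tmval e s, tmval e' s) \<in> R" "(tmval e t, tmval e' t) \<in> R"
    using Eq.prems by (auto simp: tmval_def)
  with Eq.prems(1) show ?case unfolding partial_iso_def satc_tags by blast
next
  case (Rel y)
  have "(tmval e s, tmval e' s) \<in> R" for s
    using Rel.prems by (auto simp: tmval_def)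
  with Rel.prems(1) have "eqv b (tmval e s) (tmval e t) \<longleftrightarrow> eqv b' (tmval e' s) (tmval e' t)" for s t
    unfolding partial_iso_def by blast
  then show ?case by simp
next
  case (Imp x y)
  have "x < prod_encode (3, prod_encode (x, y))" "y < prod_encode (3, prod_encode (x, y))"
    using prod_decode_less[of "prod_encode (3, prod_encode (x, y))"] by auto
  then have x: "card R + x \<le> N" and y: "card R + y \<le> N" using Imp.prems(2) by simp_all
  have "satc D b e x \<longleftrightarrow> satc D' b' e' x" by (rule Imp.IH(1)[OF Imp.prems(1) x Imp.prems(3,4)])
  moreover have "satc D b e y \<longleftrightarrow> satc D' b' e' y" by (rule Imp.IH(2)[OF Imp.prems(1) y Imp.prems(3,4)])
  ultimately show ?case by simp
next
  case (Forall x)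
  have x: "x < prod_encode (4, x)" using prod_encode_less by simp
  have fin: "finite R" using Forall.prems(1) by (simp add: partial_iso_def)
  have step: "satc D b (case_nat a e) x \<longleftrightarrow> satc D' b' (case_nat a' e') x"
    if "partial_iso N D b D' b' (insert (a, a') R)" for a a'
  proof (rule Forall.IH[OF that])
    show "card (insert (a, a') R) + x \<le> N"
      using x Forall.prems(2) card_insert_le_m1 fin by (simp add: card_insert_if)
    show "(case_nat a e i, case_nat a' e' i) \<in> insert (a, a') R" for i
      using Forall.prems(3) by (cases i) auto
  qed (use Forall.prems in auto)
  have N: "card R < N" using Forall.prems(2) x by simp
  show ?case unfolding satc_tags
  proof
    assume L: "\<forall>a\<in>D. satc D b (case_nat a e) x"
    show "\<forall>a'\<in>D'. satc D' b' (case_nat a' e') x"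
    proof
      fix a' assume "a' \<in> D'"
      \<comment> \<open>The back direction is \<open>forth\<close> for the converse
        relation.\<close>
      then obtain a where a: "a \<in> D" "partial_iso N D' b' D b (insert (a', a) (R\<inverse>))"
        using forth[OF partial_iso_converse[OF Forall.prems(1)] _ assms(6,5) same_sizes_sym[OF assms(7)]] N
        by (metis card_inverse)
      have "(insert (a', a) (R\<inverse>))\<inverse> = insert (a, a') R" by auto
      with partial_iso_converse[OF a(2)] have "partial_iso N D b D' b' (insert (a, a') R)" by simp
      from step[OF this] L a(1) show "satc D' b' (case_nat a' e') x" by blast
    qed
  next
    assume L: "\<forall>a'\<in>D'. satc D' b' (case_nat a' e') x"
    show "\<forall>a\<in>D. satc D b (case_nat a e) x"
    proof
      fix a assume "a \<in> D"
      then obtain a' where a': "a' \<in> D'" "partial_iso N D b D' b' (insert (a, a') R)"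
        using forth[OF Forall.prems(1) N assms(5-7)] by metis
      from step[OF this(2)] L this(1) show "satc D b (case_nat a e) x" by blast
    qed
  qed
qed auto

subsection \<open>Reduction to finite structures\<close>

text \<open>The width is chosen so that, when the bit of a row \<open>n < N\<close> splits off
  \<open>n + 1\<close> elements, more than \<open>N\<close> elements of the row remain: they stand
  in for the infinite class.\<close>

definition box :: "nat \<Rightarrow> nat set" where
  "box N = {x. pi1 x < N \<and> pi2 x \<le> 2 * N}"

lemma mem_box: "prod_encode (n, i) \<in> box N \<longleftrightarrow> n < N \<and> i \<le> 2 * N"
  by (simp add: box_def)

lemma box_bounded: "x \<in> box N \<Longrightarrow> x < Suc (prod_encode (N, 2 * N))"
proof -
  have mono: "a \<le> c \<Longrightarrow> d \<le> f \<Longrightarrow> prod_encode (a, d) \<le> prod_encode (c, f)" for a c d f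
  proof -
    have "m \<le> n \<Longrightarrow> triangle m \<le> triangle n" for m n
      by (induction n) (auto simp: le_Suc_eq)
    then show "a \<le> c \<Longrightarrow> d \<le> f \<Longrightarrow> prod_encode (a, d) \<le> prod_encode (c, f)"
      unfolding prod_encode_def by (simp add: add_mono)
  qed
  assume "x \<in> box N"
  then have "prod_encode (prod_decode x) \<le> prod_encode (N, 2 * N)"
    by (cases "prod_decode x") (auto simp: box_def intro!: mono)
  then show ?thesis by simp
qed

lemma eqv_prod_encode:
  "eqv b (prod_encode (n, i)) y \<longleftrightarrow> (\<exists>j. y = prod_encode (n, j) \<and> (b n \<longrightarrow> (i \<le> n \<longleftrightarrow> j \<le> n)))"
proof -
  obtain m j where "y = prod_encode (m, j)" by (metis prod_decode_inverse surj_pair)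
  then show ?thesis by (auto simp: eqv_def)
qed

lemma class_image:
  "{y\<in>D. eqv b (prod_encode (n, i)) y} =
     (\<lambda>j. prod_encode (n, j)) ` {j. prod_encode (n, j) \<in> D \<and> (b n \<longrightarrow> (i \<le> n \<longleftrightarrow> j \<le> n))}"
  by (auto simp: eqv_prod_encode)

lemma sized_prod_encode:
  "sized D b (prod_encode (n, i)) s \<longleftrightarrow>
     finite {j. prod_encode (n, j) \<in> D \<and> (b n \<longrightarrow> (i \<le> n \<longleftrightarrow> j \<le> n))} \<and>
     card {j. prod_encode (n, j) \<in> D \<and> (b n \<longrightarrow> (i \<le> n \<longleftrightarrow> j \<le> n))} = s"
proof -
  have inj: "inj_on (\<lambda>j. prod_encode (n, j)) A" for A by (auto intro: inj_onI)
  show ?thesis unfolding sized_def class_image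
    by (simp add: finite_image_iff[OF inj] card_image[OF inj])
qed

lemma sized_UNIV: "sized UNIV b (prod_encode (n, i)) s \<longleftrightarrow> b n \<and> i \<le> n \<and> s = Suc n"
proof -
  consider "b n" "i \<le> n" | "b n" "\<not> i \<le> n" | "\<not> b n" by blast
  then show ?thesis
  proof cases
    case 1
    then have "{j. prod_encode (n, j) \<in> UNIV \<and> (b n \<longrightarrow> (i \<le> n \<longleftrightarrow> j \<le> n))} = {..n}" by auto
    with 1 show ?thesis unfolding sized_prod_encode by auto
  next
    case 2
    then have "{j. prod_encode (n, j) \<in> UNIV \<and> (b n \<longrightarrow> (i \<le> n \<longleftrightarrow> j \<le> n))} = {n<..}" by auto
    with 2 show ?thesis unfolding sized_prod_encode by (simp add: infinite_Ioi)
  next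
    case 3
    then have "{j. prod_encode (n, j) \<in> UNIV \<and> (b n \<longrightarrow> (i \<le> n \<longleftrightarrow> j \<le> n))} = UNIV" by auto
    with 3 show ?thesis unfolding sized_prod_encode by simp
  qed
qed

lemma sized_box:
  assumes "n < N" "s < N"
  shows "sized (box N) b (prod_encode (n, i)) s \<longleftrightarrow> b n \<and> i \<le> n \<and> s = Suc n"
proof -
  have box: "prod_encode (n, j) \<in> box N \<longleftrightarrow> j \<le> 2 * N" for j using assms by (simp add: box_def)
  consider "b n" "i \<le> n" | "b n" "\<not> i \<le> n" | "\<not> b n" by blast
  then show ?thesis
  proof cases
    case 1
    then have "{j. prod_encode (n, j) \<in> box N \<and> (b n \<longrightarrow> (i \<le> n \<longleftrightarrow> j \<le> n))} = {..n}"
      using assms by (auto simp: box)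
    with 1 show ?thesis unfolding sized_prod_encode by auto
  next
    case 2
    then have "{j. prod_encode (n, j) \<in> box N \<and> (b n \<longrightarrow> (i \<le> n \<longleftrightarrow> j \<le> n))} = {n<..2 * N}"
      by (auto simp: box)
    with 2 assms show ?thesis unfolding sized_prod_encode by auto
  next
    case 3
    then have "{j. prod_encode (n, j) \<in> box N \<and> (b n \<longrightarrow> (i \<le> n \<longleftrightarrow> j \<le> n))} = {..2 * N}"
      by (auto simp: box)
    with 3 assms show ?thesis unfolding sized_prod_encode by auto
  qed
qed

lemma ex_prod_encode: "(\<exists>x. P x) \<longleftrightarrow> (\<exists>n i. P (prod_encode (n, i)))"
  and all_prod_encode: "(\<forall>x. P x) \<longleftrightarrow> (\<forall>n i. P (prod_encode (n, i)))"
  by (metis prod_decode_inverse surj_pair)+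

lemma rich_UNIV: "rich N UNIV b"
proof -
  \<comment> \<open>Column \<open>Suc n\<close> of row \<open>n\<close> lies in the infinite class
    of that row, whether or not bit \<open>n\<close> splits the row.\<close>
  let ?Z = "(\<lambda>n. prod_encode (n, Suc n)) ` {..<N}"
  have "card ?Z = N" by (subst card_image) (auto intro: inj_onI)
  then have "\<exists>Z\<subseteq>UNIV. finite Z \<and> card Z = N \<and> (\<forall>z\<in>Z. \<forall>s<N. \<not> sized UNIV b z s) \<and>
        (\<forall>z\<in>Z. \<forall>w\<in>Z. eqv b z w \<longrightarrow> z = w)"
    by (intro exI[of _ ?Z]) (auto simp: sized_UNIV eqv_prod_encode)
  moreover have "sized UNIV b a s \<Longrightarrow> sized UNIV b c s \<Longrightarrow> eqv b a c" for a c s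
    using prod_decode_inverse[of a, symmetric] prod_decode_inverse[of c, symmetric]
    by (cases "prod_decode a"; cases "prod_decode c") (auto simp: sized_UNIV eqv_prod_encode)
  ultimately show ?thesis unfolding rich_def by blast
qed

lemma rich_box: "rich N (box N) b"
proof -
  \<comment> \<open>The last column lies in the large part of each row, since \<open>n < N\<close>
    gives \<open>n < 2 * N\<close>.\<close>
  let ?Z = "(\<lambda>n. prod_encode (n, 2 * N)) ` {..<N}"
  have "card ?Z = N" by (subst card_image) (auto intro: inj_onI)
  then have "\<exists>Z\<subseteq>box N. finite Z \<and> card Z = N \<and> (\<forall>z\<in>Z. \<forall>s<N. \<not> sized (box N) b z s) \<and>
        (\<forall>z\<in>Z. \<forall>w\<in>Z. eqv b z w \<longrightarrow> z = w)"
    by (intro exI[of _ ?Z]) (auto simp: sized_box eqv_prod_encode mem_box)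
  moreover have "eqv b a c" if "a \<in> box N" "c \<in> box N" "s < N" "sized (box N) b a s" "sized (box N) b c s" for a c s
  proof -
    obtain n i m j where ac: "a = prod_encode (n, i)" "c = prod_encode (m, j)"
      by (metis prod_decode_inverse surj_pair)
    with that have "n < N" "m < N" by (auto simp: box_def)
    with that show ?thesis by (auto simp: ac sized_box eqv_prod_encode)
  qed
  ultimately show ?thesis unfolding rich_def by blast
qed

lemma same_sizes_box:
  assumes "\<And>n. n < N \<Longrightarrow> b n \<longleftrightarrow> b' n"
  shows "same_sizes N UNIV b (box N) b'"
  unfolding same_sizes_def
proof (intro allI impI)
  fix s assume s: "s < N"
  have "(\<exists>a\<in>UNIV. sized UNIV b a s) \<longleftrightarrow> (\<exists>n. b n \<and> s = Suc n)"
    by (subst bex_UNIV, subst ex_prod_encode) (auto simp: sized_UNIV)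
  moreover have "(\<exists>a\<in>box N. sized (box N) b' a s) \<longleftrightarrow>
      (\<exists>n i. n < N \<and> i \<le> 2 * N \<and> sized (box N) b' (prod_encode (n, i)) s)"
    unfolding Bex_def by (subst ex_prod_encode) (simp add: mem_box conj_assoc)
  moreover have "\<dots> \<longleftrightarrow> (\<exists>n<N. b' n \<and> s = Suc n)"
    using sized_box[OF _ s] by (metis le0)
  ultimately show "(\<exists>a\<in>UNIV. sized UNIV b a s) \<longleftrightarrow> (\<exists>a\<in>box N. sized (box N) b' a s)"
    using s assms by auto
qed

text \<open>This makes truth in an infinite structure a finite computation on a prefix of the
  parameter. The game starts with the pair \<open>(0, 0)\<close>, because the environment is
  constantly 0 and function terms denote 0; that pair counts as one move, hence
  \<open>x < N\<close>.\<close>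

lemma satc_box:
  assumes N: "x < N" and b: "\<And>n. n < N \<Longrightarrow> b n \<longleftrightarrow> b' n"
  shows "satc UNIV b (\<lambda>_. 0) x \<longleftrightarrow> satc (box N) b' (\<lambda>_. 0) x"
proof (rule back_and_forth[where R = "{(0, 0)}"])
  have 0: "prod_encode (0, 0) = 0" by (simp add: prod_encode_def)
  show "partial_iso N UNIV b (box N) b' {(0, 0)}"
    using N b sized_UNIV[of b 0 0] sized_box[of 0 N _ b' 0]
    by (auto simp: partial_iso_def 0 box_def prod_decode_def prod_decode_aux.simps)
  show "same_sizes N UNIV b (box N) b'" using b by (rule same_sizes_box)
qed (use N in \<open>auto intro: rich_UNIV rich_box\<close>)

subsection \<open>Definable sets of parameters\<close>

text \<open>Nothing is many-sorted here: the condition is that \<open>Rel 0\<close> is a proposition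
  letter and \<open>Rel 1\<close> is binary. Any further symbols are allowed, since the structures
  give them a trivial meaning.\<close>

definition two_sorts :: "signature \<Rightarrow> bool" where
  "two_sorts L \<longleftrightarrow> 1 < length (rels L) \<and> rels L ! 0 = 0 \<and> rels L ! 1 = 2"

lemma eqv_iff_sym: "eqv b a c \<longleftrightarrow> eqv b c a"
  using eqv_sym by blast

abbreviation Eqv :: "nat \<Rightarrow> nat \<Rightarrow> fm" where
  "Eqv i j \<equiv> Rel (Suc 0) [Var i, Var j]"

lemma sat_simps [simp]:
  "sat b e Bot \<longleftrightarrow> False"
  "sat b e (Imp p q) \<longleftrightarrow> (sat b e p \<longrightarrow> sat b e q)"
  "sat b e (Forall p) \<longleftrightarrow> (\<forall>a. sat b (case_nat a e) p)"
  "sat b e (Eq s t) \<longleftrightarrow> tmval e (tm_code s) = tmval e (tm_code t)"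
  by simp_all

lemma tmval_code [simp]: "tmval e (prod_encode (0, i)) = e i" "tmval e (prod_encode (Suc 0, y)) = 0"
  by (simp_all add: tmval_def)

lemma consc_inject: "consc a w = consc c v \<longleftrightarrow> a = c \<and> w = v"
  by (simp add: consc_def)

lemma sat_Rel:
  "sat b e (Rel r ts) \<longleftrightarrow>
     r = 1 \<and> (\<exists>s t. ts = [s, t] \<and> eqv b (tmval e (tm_code s)) (tmval e (tm_code t)))"
proof -
  have "list_encode (map tm_code ts) = consc x (consc y 0) \<longleftrightarrow> (\<exists>s t. ts = [s, t] \<and> x = tm_code s \<and> y = tm_code t)"
    for x y
  proof -
    have "consc x (consc y 0) = list_encode [x, y]" by (simp add: consc_def)
    then show ?thesis by (auto simp: list_encode_eq map_eq_Cons_conv simp del: list_encode.simps)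
  qed
  then show ?thesis by (auto simp del: list_encode.simps)
qed

lemma sat_Eqv [simp]: "sat b e (Eqv i j) \<longleftrightarrow> eqv b (e i) (e j)"
  unfolding sat_Rel by auto

declare fm_code.simps [simp del]

primrec disjs :: "fm list \<Rightarrow> fm" where
  "disjs [] = Bot"
| "disjs (p # ps) = Or p (disjs ps)"

lemma sat_disjs: "sat b e (disjs ps) \<longleftrightarrow> (\<exists>p\<in>set ps. sat b e p)"
  by (induction ps) auto

lemma sat_disjs_upt [simp]: "sat b e (disjs (map f [0..<m])) \<longleftrightarrow> (\<exists>i<m. sat b e (f i))"
  by (auto simp: sat_disjs)

lemma wff_disjs: "wff L n (disjs ps) \<longleftrightarrow> (\<forall>p\<in>set ps. wff L n p)"
  by (induction ps) auto

text \<open>In a context of \<open>m\<close> distinct members of a class: the class has exactly \<open>k\<close> more members.\<close>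

primrec more_members :: "nat \<Rightarrow> nat \<Rightarrow> fm" where
  "more_members 0 m = Forall (Imp (Eqv 0 1) (disjs (map (\<lambda>i. Eq (Var 0) (Var (Suc i))) [0..<m])))"
| "more_members (Suc k) m = Exists (And (Eqv 0 1)
     (And (Neg (disjs (map (\<lambda>i. Eq (Var 0) (Var (Suc i))) [0..<m]))) (more_members k (Suc m))))"

text \<open>Each existential quantifier moves one element of the remainder \<open>F\<close> of the
  class into the context; the final universal quantifier says that the remainder is empty.\<close>

lemma sat_more_members:
  assumes "0 < m" "\<And>i. i < m \<Longrightarrow> eqv b (e 0) (e i)"
  shows "sat b e (more_members k m) \<longleftrightarrow>
    (\<exists>F. finite F \<and> card F = k \<and> F \<inter> e ` {..<m} = {} \<and> {x. eqv b (e 0) x} = e ` {..<m} \<union> F)"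
  using assms
proof (induction k arbitrary: m e)
  case 0
  have "sat b e (more_members 0 m) \<longleftrightarrow> {x. eqv b (e 0) x} \<subseteq> e ` {..<m}"
    by (auto simp: eqv_iff_sym[of _ _ "e 0"] subset_eq image_iff)
  moreover have "e ` {..<m} \<subseteq> {x. eqv b (e 0) x}" using 0 by auto
  ultimately have "sat b e (more_members 0 m) \<longleftrightarrow> {x. eqv b (e 0) x} = e ` {..<m}" by blast
  moreover have "(\<exists>F. finite F \<and> card F = 0 \<and> F \<inter> A = {} \<and> B = A \<union> F) \<longleftrightarrow> B = A" for A B :: "nat set"
    by (metis Int_empty_left Un_empty_right card_0_eq card.empty finite.emptyI)
  ultimately show ?case by simp
next
  case (Suc k)
  have img: "case_nat a e ` {..<Suc m} = insert a (e ` {..<m})" for a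
    unfolding lessThan_Suc_eq_insert_0 image_insert image_image by simp
  have IH: "sat b (case_nat a e) (more_members k (Suc m)) \<longleftrightarrow>
     (\<exists>F. finite F \<and> card F = k \<and> F \<inter> insert a (e ` {..<m}) = {} \<and>
       {x. eqv b (e 0) x} = insert a (e ` {..<m}) \<union> F)" if a: "eqv b a (e 0)" for a
  proof -
    have "eqv b (case_nat a e 0) (case_nat a e i)" if "i < Suc m" for i
      using that Suc.prems(2) eqv_trans[OF a] by (cases i) auto
    then have "sat b (case_nat a e) (more_members k (Suc m)) \<longleftrightarrow>
     (\<exists>F. finite F \<and> card F = k \<and> F \<inter> insert a (e ` {..<m}) = {} \<and>
       {x. eqv b a x} = insert a (e ` {..<m}) \<union> F)"
      by (subst Suc.IH) (simp_all add: img)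
    then show ?thesis using eqv_class[OF a, of UNIV] by simp
  qed
  have "sat b e (more_members (Suc k) m) \<longleftrightarrow>
     (\<exists>a. eqv b a (e 0) \<and> a \<notin> e ` {..<m} \<and> sat b (case_nat a e) (more_members k (Suc m)))"
    by (auto simp: image_iff)
  also have "\<dots> \<longleftrightarrow> (\<exists>a F. eqv b a (e 0) \<and> a \<notin> e ` {..<m} \<and> finite F \<and> card F = k \<and>
       F \<inter> insert a (e ` {..<m}) = {} \<and> {x. eqv b (e 0) x} = insert a (e ` {..<m}) \<union> F)"
    by (simp add: IH cong: conj_cong)
  also have "\<dots> \<longleftrightarrow> (\<exists>F. finite F \<and> card F = Suc k \<and> F \<inter> e ` {..<m} = {} \<and>
       {x. eqv b (e 0) x} = e ` {..<m} \<union> F)" (is "?L \<longleftrightarrow> ?R")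
  proof
    assume ?L
    then obtain a F where "eqv b a (e 0)" "a \<notin> e ` {..<m}" "finite F" "card F = k"
       "F \<inter> insert a (e ` {..<m}) = {}" "{x. eqv b (e 0) x} = insert a (e ` {..<m}) \<union> F" by blast
    then show ?R by (intro exI[of _ "insert a F"]) auto
  next
    assume ?R
    then obtain F where F: "finite F" "card F = Suc k" "F \<inter> e ` {..<m} = {}"
       "{x. eqv b (e 0) x} = e ` {..<m} \<union> F" by blast
    then obtain a where a: "a \<in> F" by fastforce
    with F(4) have "eqv b (e 0) a" by blast
    with F a show ?L
      by (intro exI[of _ a] exI[of _ "F - {a}"]) (auto simp: eqv_iff_sym[of _ a])
  qed
  finally show ?case .
qed

lemma wff_more_members:
  "two_sorts L \<Longrightarrow> 0 < m \<Longrightarrow> wff L m (more_members k m)"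
  by (induction k arbitrary: m) (auto simp: two_sorts_def wff_disjs)

definition definable :: "signature \<Rightarrow> ((nat \<Rightarrow> bool) \<Rightarrow> bool) \<Rightarrow> bool" where
  "definable L P \<longleftrightarrow> (\<exists>p\<in>sentences L. \<forall>b. sat b (\<lambda>_. 0) p \<longleftrightarrow> P b)"

lemma definable_bit:
  assumes "two_sorts L" shows "definable L (\<lambda>b. b n)"
proof -
  \<comment> \<open>The outer quantifier supplies one member and \<open>n\<close> more are counted,
    which makes up the \<open>n + 1\<close> elements that bit \<open>n\<close> splits off.\<close>
  have "sat b (\<lambda>_. 0) (Exists (more_members n 1)) \<longleftrightarrow> b n" for b
  proof -
    have "sat b (\<lambda>_. 0) (Exists (more_members n 1)) \<longleftrightarrow> (\<exists>a. sized UNIV b a (Suc n))"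
    proof -
      have "sat b (case_nat a (\<lambda>_. 0)) (more_members n 1) \<longleftrightarrow> sized UNIV b a (Suc n)" for a
      proof -
        have "sat b (case_nat a (\<lambda>_. 0)) (more_members n 1) \<longleftrightarrow>
            (\<exists>F. finite F \<and> card F = n \<and> a \<notin> F \<and> {x. eqv b a x} = insert a F)"
          by (subst sat_more_members) (auto simp: lessThan_Suc)
        also have "\<dots> \<longleftrightarrow> sized UNIV b a (Suc n)"
        proof
          assume "sized UNIV b a (Suc n)"
          then show "\<exists>F. finite F \<and> card F = n \<and> a \<notin> F \<and> {x. eqv b a x} = insert a F"
            by (intro exI[of _ "{x. eqv b a x} - {a}"]) (auto simp: sized_def)
        qed (auto simp: sized_def)
        finally show ?thesis .
      qed
      then show ?thesis by simp
    qed
    also have "\<dots> \<longleftrightarrow> b n" by (subst ex_prod_encode) (auto simp: sized_UNIV)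
    finally show ?thesis .
  qed
  moreover have "Exists (more_members n 1) \<in> sentences L"
    using wff_more_members[OF assms, of 1] by (simp add: sentences_def)
  ultimately show ?thesis unfolding definable_def by blast
qed

lemma definable_False: "definable L (\<lambda>_. False)"
  unfolding definable_def by (rule bexI[of _ Bot]) (auto simp: sentences_def)

lemma definable_imp:
  assumes "definable L P" "definable L Q" shows "definable L (\<lambda>b. P b \<longrightarrow> Q b)"
proof -
  from assms obtain p q where "p \<in> sentences L" "\<forall>b. sat b (\<lambda>_. 0) p \<longleftrightarrow> P b"
    "q \<in> sentences L" "\<forall>b. sat b (\<lambda>_. 0) q \<longleftrightarrow> Q b" unfolding definable_def by blast
  then show ?thesis unfolding definable_def
    by (intro bexI[of _ "Imp p q"]) (auto simp: sentences_def)
qed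

lemma definable_not: "definable L P \<Longrightarrow> definable L (\<lambda>b. \<not> P b)"
  using definable_imp[OF _ definable_False] by simp

lemma definable_conj: "definable L P \<Longrightarrow> definable L Q \<Longrightarrow> definable L (\<lambda>b. P b \<and> Q b)"
  using definable_not[OF definable_imp[OF _ definable_not]] by simp

lemma definable_finite_ex:
  "finite S \<Longrightarrow> (\<And>z. z \<in> S \<Longrightarrow> definable L (P z)) \<Longrightarrow> definable L (\<lambda>b. \<exists>z\<in>S. P z b)"
proof (induction rule: finite_induct)
  case (insert z S)
  then have "definable L (\<lambda>b. \<not> P z b \<longrightarrow> (\<exists>z\<in>S. P z b))"
    by (intro definable_imp definable_not) auto
  moreover have "(\<lambda>b. \<exists>z\<in>insert z S. P z b) = (\<lambda>b. \<not> P z b \<longrightarrow> (\<exists>z\<in>S. P z b))" by blast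
  ultimately show ?case by simp
qed (simp add: definable_False)

text \<open>These are the basic open sets of Cantor space; with finite disjunctions all clopen sets
  become definable.\<close>

lemma definable_agree:
  assumes "two_sorts L" shows "definable L (\<lambda>b. \<forall>n<N. b n \<longleftrightarrow> v n)"
proof (induction N)
  case 0
  show ?case using definable_not[OF definable_False] by simp
next
  case (Suc N)
  have "definable L (\<lambda>b. b N \<longleftrightarrow> v N)"
    using definable_bit[OF assms, of N] definable_not[OF definable_bit[OF assms, of N]] by (cases "v N") auto
  moreover have "(\<lambda>b. \<forall>n<Suc N. b n \<longleftrightarrow> v n) = (\<lambda>b. (\<forall>n<N. b n \<longleftrightarrow> v n) \<and> (b N \<longleftrightarrow> v N))"
    by (auto simp: less_Suc_eq)
  ultimately show ?case using definable_conj[OF Suc] by simp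
qed

section \<open>Syntactic operations on codes\<close>

lemma computable_if [computable_intros]:
  assumes "computable f" "computable g" "computable h" "computable k"
  shows "computable (\<lambda>x. if f x = g x then h x else k x)"
proof -
  have *: "(if m = n then u else v) = rec_nat u (\<lambda>_ _. v) ((m - n) + (n - m))" for m n u v :: nat
  proof (cases "m = n")
    case False
    then have "0 < (m - n) + (n - m)" by auto
    then show ?thesis using False by (cases "(m - n) + (n - m)") auto
  qed simp
  show ?thesis unfolding *
    by (intro computable_intros assms computable_comp[OF assms(4)])
qed

lemma re_neq [re_intros]:
  assumes "computable f" "computable g" shows "re (\<lambda>x. f x \<noteq> g x)"
  unfolding neq_iff by (intro re_intros assms)

subsection \<open>Satisfaction in finite structures\<close>

definition bits :: "nat \<Rightarrow> nat \<Rightarrow> bool" where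
  "bits m n \<longleftrightarrow> nthc m n = 1"

abbreviation (input) "quad a b c d \<equiv> prod_encode (a, prod_encode (b, prod_encode (c, d)))"

lemma computable_tmval [computable_intros]:
  "computable f \<Longrightarrow> computable g \<Longrightarrow> computable (\<lambda>x. tmval (nthc (f x)) (g x))"
  unfolding tmval_def by (intro computable_intros)

definition two_list :: "nat \<Rightarrow> bool" where
  "two_list w \<longleftrightarrow> w \<noteq> 0 \<and> tlc w \<noteq> 0 \<and> tlc (tlc w) = 0"

lemma two_list_iff: "(\<exists>s t. w = consc s (consc t 0)) \<longleftrightarrow> two_list w"
proof -
  have nz: "w \<noteq> 0 \<longleftrightarrow> w = consc (hdc w) (tlc w)" for w
    by (cases w) (auto simp: consc_def hdc_def tlc_def)
  have cons: "tlc (consc s w) = w" "0 < consc s w" for s w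
    by (simp_all add: consc_def tlc_def)
  show ?thesis
  proof
    assume "two_list w"
    then have "w = consc (hdc w) (consc (hdc (tlc w)) 0)"
      unfolding two_list_def using nz by metis
    then show "\<exists>s t. w = consc s (consc t 0)" by blast
  qed (auto simp: two_list_def cons)
qed

text \<open>Enumerable predicates are not closed under negation, so the relation and its complement
  are both written positively, as are membership in a box and its complement.\<close>

definition eqv_yes :: "nat \<Rightarrow> nat \<Rightarrow> nat \<Rightarrow> bool" where
  "eqv_yes m x y \<longleftrightarrow> pi1 x = pi1 y \<and>
     (nthc m (pi1 x) \<noteq> 1 \<or>
      pi2 x \<le> pi1 x \<and> pi2 y \<le> pi1 x \<or>
      pi1 x < pi2 x \<and> pi1 x < pi2 y)"

definition eqv_no :: "nat \<Rightarrow> nat \<Rightarrow> nat \<Rightarrow> bool" where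
  "eqv_no m x y \<longleftrightarrow> pi1 x \<noteq> pi1 y \<or>
     nthc m (pi1 x) = 1 \<and>
     (pi2 x \<le> pi1 x \<and> pi1 x < pi2 y \<or>
      pi1 x < pi2 x \<and> pi2 y \<le> pi1 x)"

lemma eqv_yes: "eqv_yes m x y \<longleftrightarrow> eqv (bits m) x y"
  and eqv_no: "eqv_no m x y \<longleftrightarrow> \<not> eqv (bits m) x y"
  unfolding eqv_yes_def eqv_no_def eqv_def bits_def by auto

definition box_no :: "nat \<Rightarrow> nat \<Rightarrow> bool" where
  "box_no N x \<longleftrightarrow> N \<le> pi1 x \<or> 2 * N < pi2 x"

lemma box_no: "box_no N x \<longleftrightarrow> x \<notin> box N"
  unfolding box_no_def box_def by auto

lemma re_box [re_intros]:
  "computable f \<Longrightarrow> computable g \<Longrightarrow> re (\<lambda>x. f x \<in> box (g x))"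
  unfolding box_def mem_Collect_eq by (intro re_intros computable_intros)

lemma re_box_no [re_intros]:
  "computable f \<Longrightarrow> computable g \<Longrightarrow> re (\<lambda>x. box_no (g x) (f x))"
  unfolding box_no_def by (intro re_intros computable_intros)

text \<open>A judgement with tag 0 gives the truth value of a code in the structure \<open>(N, m)\<close> at an
  environment; one with tag 1 says that all elements below a bound satisfy a code.\<close>

definition sat_base :: "nat \<Rightarrow> bool" where
  "sat_base z \<longleftrightarrow>
     (\<exists>P y e. z = tag 0 (quad P (tag 0 y) e 0)) \<or>
     (\<exists>P s t e v. z = tag 0 (quad P (tag 1 (prod_encode (s, t))) e v) \<and>
        v = (if tmval (nthc e) s = tmval (nthc e) t then 1 else 0)) \<or>
     (\<exists>N m s t e v. z = tag 0 (quad (prod_encode (N, m)) (tag 2 (prod_encode (1, consc s (consc t 0)))) e v) \<and>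
        (v = 1 \<and> eqv_yes m (tmval (nthc e) s) (tmval (nthc e) t) \<or>
         v = 0 \<and> eqv_no m (tmval (nthc e) s) (tmval (nthc e) t))) \<or>
     (\<exists>P y w e. z = tag 0 (quad P (tag 2 (prod_encode (y, w))) e 0) \<and>
        (y \<noteq> 1 \<or> w = 0 \<or> tlc w = 0 \<or> tlc (tlc w) \<noteq> 0)) \<or>
     (\<exists>P k y e. 4 < k \<and> z = tag 0 (quad P (tag k y) e 0)) \<or>
     (\<exists>P x e. z = tag 1 (quad P x e 0))"

text \<open>Truth values are part of the judgement, since falsity must be derivable too for the
  premise of an implication. A universal formula is refuted by one element and confirmed by running
  through all numbers up to the bound of \<open>box_bounded\<close>.\<close>

definition sat_step :: "nat \<Rightarrow> nat \<Rightarrow> nat \<Rightarrow> bool" where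
  "sat_step z p q \<longleftrightarrow>
     (\<exists>P x y e u v w. p = tag 0 (quad P x e u) \<and> q = tag 0 (quad P y e v) \<and>
        w = (if u = 0 then 1 else v) \<and> z = tag 0 (quad P (tag 3 (prod_encode (x, y))) e w)) \<or>
     (\<exists>N m x e a. p = tag 1 (quad (prod_encode (N, m)) x e a) \<and>
        (box_no N a \<or> q = tag 0 (quad (prod_encode (N, m)) x (consc a e) 1)) \<and>
        z = tag 1 (quad (prod_encode (N, m)) x e (Suc a))) \<or>
     (\<exists>N m x e. p = tag 1 (quad (prod_encode (N, m)) x e (Suc (prod_encode (N, 2 * N)))) \<and>
        z = tag 0 (quad (prod_encode (N, m)) (tag 4 x) e 1)) \<or>
     (\<exists>N m x e a. p = tag 0 (quad (prod_encode (N, m)) x (consc a e) 0) \<and> a \<in> box N \<and>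
        z = tag 0 (quad (prod_encode (N, m)) (tag 4 x) e 0))"

lemma re_sat: "re (closure sat_base sat_step)"
  unfolding sat_base_def sat_step_def eqv_yes_def eqv_no_def
  by (intro re_closure re_intros computable_intros)

definition sat_sound :: "nat \<Rightarrow> bool" where
  "sat_sound z \<longleftrightarrow>
     (\<forall>N m x e v. z = tag 0 (quad (prod_encode (N, m)) x e v) \<longrightarrow>
        v = (if satc (box N) (bits m) (nthc e) x then 1 else 0)) \<and>
     (\<forall>N m x e a. z = tag 1 (quad (prod_encode (N, m)) x e a) \<longrightarrow>
        (\<forall>k<a. k \<in> box N \<longrightarrow> satc (box N) (bits m) (nthc (consc k e)) x))"

lemma sat_sound_tags [simp]:
  "sat_sound (tag 0 (quad (prod_encode (N, m)) x e v)) \<longleftrightarrow>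
     v = (if satc (box N) (bits m) (nthc e) x then 1 else 0)"
  "sat_sound (tag (Suc 0) (quad (prod_encode (N, m)) x e a)) \<longleftrightarrow>
     (\<forall>k<a. k \<in> box N \<longrightarrow> satc (box N) (bits m) (nthc (consc k e)) x)"
  by (auto simp: sat_sound_def)

lemma sat_sound_tag_P:
  "sat_sound (tag 0 (quad P x e v)) \<longleftrightarrow>
     v = (if satc (box (pi1 P)) (bits (pi2 P)) (nthc e) x then 1 else 0)"
  "sat_sound (tag (Suc 0) (quad P x e a)) \<longleftrightarrow>
     (\<forall>k<a. k \<in> box (pi1 P) \<longrightarrow>
        satc (box (pi1 P)) (bits (pi2 P)) (nthc (consc k e)) x)"
  using sat_sound_tags[of "pi1 P" "pi2 P"] by simp_all

lemma sat_base_sound: "sat_base z \<Longrightarrow> sat_sound z"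
proof -
  have "y \<noteq> 1 \<or> w = 0 \<or> tlc w = 0 \<or> tlc (tlc w) \<noteq> 0 \<longleftrightarrow> \<not> (y = 1 \<and> (\<exists>s t. w = consc s (consc t 0)))" for y w
    unfolding two_list_iff two_list_def by auto
  then show "sat_base z \<Longrightarrow> sat_sound z"
    unfolding sat_base_def
    by (elim disjE exE conjE) (auto simp: sat_sound_tag_P consc_inject eqv_yes eqv_no)
qed

lemma sat_step_sound: "sat_step z p q \<Longrightarrow> sat_sound p \<Longrightarrow> sat_sound q \<Longrightarrow> sat_sound z"
  unfolding sat_step_def
proof (elim disjE exE conjE)
  fix N m x e assume *: "sat_sound p" "p = tag 1 (quad (prod_encode (N, m)) x e (Suc (prod_encode (N, 2 * N))))"
    "z = tag 0 (quad (prod_encode (N, m)) (tag 4 x) e 1)"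
  then have "\<forall>k<Suc (prod_encode (N, 2 * N)). k \<in> box N \<longrightarrow> satc (box N) (bits m) (nthc (consc k e)) x" by simp
  then have "\<forall>k\<in>box N. satc (box N) (bits m) (case_nat k (nthc e)) x"
    using box_bounded unfolding nthc_consc by blast
  then show "sat_sound z" by (simp add: *(3))
next
  fix N m x e a
  assume *: "sat_sound p" "p = tag 1 (quad (prod_encode (N, m)) x e a)"
    "z = tag 1 (quad (prod_encode (N, m)) x e (Suc a))" and no: "box_no N a"
  from *(1,2) have "\<forall>k<a. k \<in> box N \<longrightarrow> satc (box N) (bits m) (nthc (consc k e)) x" by simp
  with no have "\<forall>k<Suc a. k \<in> box N \<longrightarrow> satc (box N) (bits m) (nthc (consc k e)) x"
    by (auto simp add: less_Suc_eq box_no simp del: nthc_consc)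
  then show "sat_sound z" by (simp add: *(3))
next
  fix N m x e a
  assume *: "sat_sound p" "sat_sound q" "p = tag 1 (quad (prod_encode (N, m)) x e a)"
    "z = tag 1 (quad (prod_encode (N, m)) x e (Suc a))" "q = tag 0 (quad (prod_encode (N, m)) x (consc a e) 1)"
  from *(1,3) have "\<forall>k<a. k \<in> box N \<longrightarrow> satc (box N) (bits m) (nthc (consc k e)) x" by simp
  moreover have "satc (box N) (bits m) (nthc (consc a e)) x"
    using *(2) unfolding *(5) sat_sound_tags by presburger
  ultimately have "\<forall>k<Suc a. k \<in> box N \<longrightarrow> satc (box N) (bits m) (nthc (consc k e)) x"
    by (auto simp add: less_Suc_eq)
  then show "sat_sound z" by (simp add: *(4))
next
  fix P x y e u v w
  assume "sat_sound p" "sat_sound q" "p = tag 0 (quad P x e u)" "q = tag 0 (quad P y e v)"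
    "w = (if u = 0 then 1 else v)" "z = tag 0 (quad P (tag 3 (prod_encode (x, y))) e w)"
  then show "sat_sound z" by (simp add: sat_sound_tag_P)
next
  fix N m x e a
  assume *: "sat_sound p" "p = tag 0 (quad (prod_encode (N, m)) x (consc a e) 0)" "a \<in> box N"
    "z = tag 0 (quad (prod_encode (N, m)) (tag 4 x) e 0)"
  have "\<not> satc (box N) (bits m) (nthc (consc a e)) x"
    using *(1) unfolding *(2) sat_sound_tags by presburger
  with *(3) have "\<not> satc (box N) (bits m) (nthc e) (tag 4 x)" by (auto simp: nthc_consc)
  then show "sat_sound z" unfolding *(4) sat_sound_tags by simp
qed

lemma sat_complete:
  "closure sat_base sat_step
     (tag 0 (quad (prod_encode (N, m)) x e (if satc (box N) (bits m) (nthc e) x then 1 else 0)))"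
  (is "?C (tag 0 (quad ?P x e (?v x e)))")
proof (induction x arbitrary: e rule: code_induct)
  case (Bot y)
  show ?case by (rule closure_base) (auto simp: sat_base_def)
next
  case (Eq s t)
  show ?case by (rule closure_base) (auto simp: sat_base_def)
next
  case (Rel y)
  obtain r w where y: "y = prod_encode (r, w)" by (metis prod_decode_inverse surj_pair)
  show ?case
  proof (cases "r = 1 \<and> (\<exists>s t. w = consc s (consc t 0))")
    case True
    then show ?thesis
      by (intro closure_base) (auto simp: sat_base_def y consc_inject eqv_yes eqv_no)
  next
    case False
    then have "r \<noteq> 1 \<or> w = 0 \<or> tlc w = 0 \<or> tlc (tlc w) \<noteq> 0"
      unfolding two_list_iff two_list_def by auto
    with False show ?thesis
      by (intro closure_base) (auto simp: sat_base_def y)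
  qed
next
  case (Imp x y)
  show ?case by (rule closure_step[OF _ Imp(1)[of e] Imp(2)[of e]]) (auto simp: sat_step_def)
next
  case (Forall x)
  show ?case
  proof (cases "\<forall>a\<in>box N. satc (box N) (bits m) (nthc (consc a e)) x")
    case True
    have "?C (tag 1 (quad ?P x e a))" for a
    proof (induction a)
      case 0
      show ?case by (rule closure_base) (auto simp: sat_base_def)
    next
      case (Suc a)
      show ?case
      proof (cases "a \<in> box N")
        case a: True
        then have v: "?v x (consc a e) = 1" using True by simp
        show ?thesis
          by (rule closure_step[OF _ Suc Forall[of "consc a e", unfolded v]]) (auto simp: sat_step_def)
      qed (rule closure_step[OF _ Suc Suc], auto simp: sat_step_def box_no)
    qed
    note all = this[of "Suc (prod_encode (N, 2 * N))"]
    have v: "?v (tag 4 x) e = 1" using True by (simp add: nthc_consc)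
    show ?thesis unfolding v by (rule closure_step[OF _ all all]) (auto simp: sat_step_def)
  next
    case False
    then obtain a where a: "a \<in> box N" "\<not> satc (box N) (bits m) (nthc (consc a e)) x" by blast
    then have v: "?v x (consc a e) = 0" "?v (tag 4 x) e = 0" by (auto simp: nthc_consc)
    show ?thesis unfolding v
      by (rule closure_step[OF _ Forall[of "consc a e", unfolded v] Forall[of "consc a e", unfolded v]])
        (use a in \<open>auto simp: sat_step_def\<close>)
  qed
next
  case (Junk k x)
  then show ?case by (intro closure_base) (auto simp: sat_base_def)
qed

definition finsat :: "nat \<Rightarrow> nat \<Rightarrow> nat \<Rightarrow> nat \<Rightarrow> bool" where
  "finsat N m x v \<longleftrightarrow> v = (if satc (box N) (bits m) (\<lambda>_. 0) x then 1 else 0)"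

lemma finsat_iff: "finsat N m x v \<longleftrightarrow> closure sat_base sat_step (tag 0 (quad (prod_encode (N, m)) x 0 v))"
proof
  assume "closure sat_base sat_step (tag 0 (quad (prod_encode (N, m)) x 0 v))"
  then have "sat_sound (tag 0 (quad (prod_encode (N, m)) x 0 v))"
    by (induction rule: closure.induct) (auto intro: sat_base_sound sat_step_sound)
  then show "finsat N m x v" by (simp add: finsat_def nthc_0[abs_def])
next
  assume "finsat N m x v"
  then show "closure sat_base sat_step (tag 0 (quad (prod_encode (N, m)) x 0 v))"
    using sat_complete[of N m x 0] by (simp add: finsat_def nthc_0[abs_def])
qed

text \<open>The first \<open>N\<close> bits \<open>m\<close> of a parameter decide the truth of \<open>x\<close>.\<close>

definition forced :: "nat \<Rightarrow> nat \<Rightarrow> nat \<Rightarrow> bool" where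
  "forced z x v \<longleftrightarrow> x < pi1 z \<and> finsat (pi1 z) (pi2 z) x v"

lemma re_forced [re_intros]:
  "computable f \<Longrightarrow> computable g \<Longrightarrow> computable h \<Longrightarrow> re (\<lambda>x. forced (f x) (g x) (h x))"
  unfolding forced_def finsat_iff by (intro re_intros re_comp[OF re_sat] computable_intros)

definition prefix_of :: "nat \<Rightarrow> (nat \<Rightarrow> bool) \<Rightarrow> bool" where
  "prefix_of z b \<longleftrightarrow> (\<forall>n < pi1 z. bits (pi2 z) n \<longleftrightarrow> b n)"

lemma forced_iff:
  assumes "prefix_of z b"
  shows "forced z x v \<longleftrightarrow> x < pi1 z \<and> v = (if satc UNIV b (\<lambda>_. 0) x then 1 else 0)"
  unfolding forced_def finsat_def
  using satc_box[of x "pi1 z" b "bits (pi2 z)"] assms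
  by (auto simp: prefix_of_def)

subsection \<open>The reduct to the original signature\<close>

text \<open>\<open>ext_sig\<close> adds a proposition letter \<open>Rel 0\<close> and a binary relation symbol \<open>Rel 1\<close>; \<open>star\<close> reads
  the former as truth and the latter as equality.\<close>

definition ext_sig :: "signature \<Rightarrow> signature" where
  "ext_sig L = Signature (funs L) (0 # 2 # rels L)"

primrec star :: "fm \<Rightarrow> fm" where
  "star Bot = Bot"
| "star (Eq s t) = Eq s t"
| "star (Rel r ts) = (case r of 0 \<Rightarrow> Top | Suc k \<Rightarrow> (case k of
      0 \<Rightarrow> (case ts of [s, t] \<Rightarrow> Eq s t | _ \<Rightarrow> Bot) | Suc r \<Rightarrow> Rel r ts))"
| "star (Imp p q) = Imp (star p) (star q)"
| "star (Forall p) = Forall (star p)"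

lemma wft_ext_sig [simp]: "wft (ext_sig L) n t = wft L n t"
proof (induction t)
  case (Fn f ts)
  then have "list_all (wft (ext_sig L) n) ts = list_all (wft L n) ts" by (simp add: list_all_iff)
  then show ?case by (simp add: ext_sig_def)
qed simp

lemma list_all_wft_ext_sig [simp]: "list_all (wft (ext_sig L) n) ts = list_all (wft L n) ts"
  by (simp add: list_all_iff)

lemma wff_ext_sig_Rel:
  "wff (ext_sig L) n (Rel 0 ts) \<longleftrightarrow> ts = []"
  "wff (ext_sig L) n (Rel (Suc 0) ts) \<longleftrightarrow> (\<exists>s t. ts = [s, t] \<and> wft L n s \<and> wft L n t)"
  "wff (ext_sig L) n (Rel (Suc (Suc r)) ts) \<longleftrightarrow> wff L n (Rel r ts)"
proof -
  show "wff (ext_sig L) n (Rel 0 ts) \<longleftrightarrow> ts = []" by (auto simp: ext_sig_def)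
  show "wff (ext_sig L) n (Rel (Suc (Suc r)) ts) \<longleftrightarrow> wff L n (Rel r ts)"
    using list_all_wft_ext_sig[of L n ts] by (simp add: ext_sig_def)
  have "wff (ext_sig L) n (Rel (Suc 0) ts) \<longleftrightarrow> length ts = 2 \<and> list_all (wft L n) ts"
    using list_all_wft_ext_sig[of L n ts] by (simp add: ext_sig_def)
  then show "wff (ext_sig L) n (Rel (Suc 0) ts) \<longleftrightarrow> (\<exists>s t. ts = [s, t] \<and> wft L n s \<and> wft L n t)"
    by (auto simp: numeral_2_eq_2 length_Suc_conv)
qed

lemma nat_cases3: "r = 0 \<or> r = Suc 0 \<or> (\<exists>k. r = Suc (Suc k))"
  by (metis not0_implies_Suc)

lemma wff_star: "wff (ext_sig L) n p \<Longrightarrow> wff L n (star p)"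
proof (induction p arbitrary: n)
  case (Rel r ts)
  then show ?case using nat_cases3[of r] by (auto simp: wff_ext_sig_Rel simp del: wff.simps(3))
qed auto

text \<open>The rule for \<open>Rel 0\<close> has the empty argument list and produces the code of
  \<open>Top\<close>; the rule for \<open>Rel 1\<close> demands exactly two arguments. The default
  clauses of \<open>star\<close> for malformed atoms have no counterpart here.\<close>

definition star_base :: "nat \<Rightarrow> bool" where
  "star_base z \<longleftrightarrow>
     z = prod_encode (tag 0 0, tag 0 0) \<or>
     (\<exists>y. z = prod_encode (tag 1 y, tag 1 y)) \<or>
     z = prod_encode (tag 2 (prod_encode (0, 0)), tag 3 (prod_encode (tag 0 0, tag 0 0))) \<or>
     (\<exists>s t. z = prod_encode (tag 2 (prod_encode (1, consc s (consc t 0))), tag 1 (prod_encode (s, t)))) \<or>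
     (\<exists>r w. z = prod_encode (tag 2 (prod_encode (Suc (Suc r), w)), tag 2 (prod_encode (r, w))))"

definition star_step :: "nat \<Rightarrow> nat \<Rightarrow> nat \<Rightarrow> bool" where
  "star_step z p q \<longleftrightarrow>
     (\<exists>x x' y y'. p = prod_encode (x, x') \<and> q = prod_encode (y, y') \<and>
        z = prod_encode (tag 3 (prod_encode (x, y)), tag 3 (prod_encode (x', y')))) \<or>
     (\<exists>x x'. p = prod_encode (x, x') \<and> z = prod_encode (tag 4 x, tag 4 x'))"

definition star_code :: "nat \<Rightarrow> nat \<Rightarrow> bool" where
  "star_code x y \<longleftrightarrow> closure star_base star_step (prod_encode (x, y))"

lemma re_star_code [re_intros]:
  assumes "computable f" "computable g" shows "re (\<lambda>x. star_code (f x) (g x))"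
proof -
  have "re (closure star_base star_step)"
    unfolding star_base_def star_step_def by (intro re_closure re_intros computable_intros)
  then show ?thesis unfolding star_code_def by (rule re_comp) (intro computable_intros assms)
qed

lemma star_code_complete: "wff (ext_sig L) n p \<Longrightarrow> star_code (fm_code p) (fm_code (star p))"
proof (induction p arbitrary: n)
  case Bot
  show ?case unfolding star_code_def by (rule closure_base) (auto simp: star_base_def fm_code.simps)
next
  case (Eq s t)
  show ?case unfolding star_code_def by (rule closure_base) (auto simp: star_base_def fm_code.simps)
next
  case (Rel r ts)
  from nat_cases3[of r] consider "r = 0" | "r = Suc 0" | k where "r = Suc (Suc k)" by blast
  then show ?case
  proof cases
    case 1
    with Rel have "ts = []" using wff_ext_sig_Rel(1) by blast
    with 1 show ?thesis
      unfolding star_code_def by (intro closure_base) (auto simp: star_base_def fm_code.simps)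
  next
    case 2
    with Rel obtain s t where "ts = [s, t]" using wff_ext_sig_Rel(2) by blast
    with 2 show ?thesis
      unfolding star_code_def
      by (intro closure_base) (auto simp: star_base_def fm_code.simps consc_def)
  next
    case 3
    then show ?thesis
      unfolding star_code_def by (intro closure_base) (auto simp: star_base_def fm_code.simps)
  qed
next
  case (Imp p q)
  then have "closure star_base star_step (prod_encode (fm_code p, fm_code (star p)))"
    "closure star_base star_step (prod_encode (fm_code q, fm_code (star q)))"
    unfolding star_code_def by auto
  then show ?case unfolding star_code_def
    by (rule closure_step[rotated]) (auto simp: star_step_def fm_code.simps)
next
  case (Forall p)
  then have "closure star_base star_step (prod_encode (fm_code p, fm_code (star p)))"
    unfolding star_code_def by auto
  from this this show ?case unfolding star_code_def
    by (rule closure_step[rotated]) (auto simp: star_step_def fm_code.simps)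
qed

text \<open>Numbers that are not codes can be related as well, so the first number is recognised as
  a code from the second being one. Recognising sentences of the extended signature is thereby
  reduced to the old signature.\<close>

lemma star_code_sound:
  assumes "star_code x (fm_code q)" "wff L n q"
  shows "\<exists>p. x = fm_code p \<and> star p = q \<and> wff (ext_sig L) n p"
proof -
  have "closure star_base star_step z \<Longrightarrow>
      \<forall>x q n. z = prod_encode (x, fm_code q) \<longrightarrow> wff L n q \<longrightarrow>
        (\<exists>p. x = fm_code p \<and> star p = q \<and> wff (ext_sig L) n p)" for z
  proof (induction rule: closure.induct)
    case (closure_base z)
    show ?case
    proof (intro allI impI)
      fix x q n
      assume z: "z = prod_encode (x, fm_code q)" and q: "wff L n q"
      from closure_base show "\<exists>p. x = fm_code p \<and> star p = q \<and> wff (ext_sig L) n p"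
        unfolding star_base_def
      proof (elim disjE exE)
        assume "z = prod_encode (tag 0 0, tag 0 0)"
        with z have "x = fm_code Bot" "fm_code q = fm_code Bot" by (auto simp: fm_code.simps)
        then show ?thesis using inj_fm_code by (intro exI[of _ Bot]) (auto dest: injD)
      next
        fix y assume y: "z = prod_encode (tag 1 y, tag 1 y)"
        with z obtain s t where "q = Eq s t" by (cases q) (auto simp: fm_code.simps)
        with y z q show ?thesis by (intro exI[of _ q]) auto
      next
        assume "z = prod_encode (tag 2 (prod_encode (0, 0)), tag 3 (prod_encode (tag 0 0, tag 0 0)))"
        with z have "x = fm_code (Rel 0 [])" "fm_code q = fm_code Top" by (auto simp: fm_code.simps)
        then show ?thesis using inj_fm_code
          by (intro exI[of _ "Rel 0 []"]) (auto dest: injD simp: wff_ext_sig_Rel simp del: wff.simps(3))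
      next
        fix s t assume y: "z = prod_encode (tag 2 (prod_encode (1, consc s (consc t 0))), tag 1 (prod_encode (s, t)))"
        with z obtain s' t' where "q = Eq s' t'" "s = tm_code s'" "t = tm_code t'"
          by (cases q) (auto simp: fm_code.simps)
        with y z q show ?thesis
          by (intro exI[of _ "Rel (Suc 0) [s', t']"])
            (auto simp: fm_code.simps wff_ext_sig_Rel consc_def simp del: wff.simps(3))
      next
        fix r w assume y: "z = prod_encode (tag 2 (prod_encode (Suc (Suc r), w)), tag 2 (prod_encode (r, w)))"
        with z obtain ts where "q = Rel r ts" "w = list_encode (map tm_code ts)"
          by (cases q) (auto simp: fm_code.simps)
        with y z q show ?thesis
          by (intro exI[of _ "Rel (Suc (Suc r)) ts"])
            (auto simp: fm_code.simps wff_ext_sig_Rel simp del: wff.simps(3))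
      qed
    qed
  next
    case (closure_step z p q)
    show ?case
    proof (intro allI impI)
      fix x r n
      assume z: "z = prod_encode (x, fm_code r)" and r: "wff L n r"
      from closure_step.hyps(1) show "\<exists>p. x = fm_code p \<and> star p = r \<and> wff (ext_sig L) n p"
        unfolding star_step_def
      proof (elim disjE exE conjE)
        fix a a' c c' assume *: "p = prod_encode (a, a')" "q = prod_encode (c, c')"
          "z = prod_encode (tag 3 (prod_encode (a, c)), tag 3 (prod_encode (a', c')))"
        with z obtain f g where fg: "r = Imp f g" "a' = fm_code f" "c' = fm_code g"
          by (cases r) (auto simp: fm_code.simps)
        with r closure_step.IH *(1,2) obtain f' g' where "a = fm_code f'" "star f' = f" "wff (ext_sig L) n f'"
          "c = fm_code g'" "star g' = g" "wff (ext_sig L) n g'" by fastforce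
        with fg * z show ?thesis by (intro exI[of _ "Imp f' g'"]) (auto simp: fm_code.simps)
      next
        fix a a' assume *: "p = prod_encode (a, a')" "z = prod_encode (tag 4 a, tag 4 a')"
        with z obtain f where f: "r = Forall f" "a' = fm_code f"
          by (cases r) (auto simp: fm_code.simps)
        with r closure_step.IH(1) *(1) obtain f' where "a = fm_code f'" "star f' = f"
          "wff (ext_sig L) (Suc n) f'" by fastforce
        with f * z show ?thesis by (intro exI[of _ "Forall f'"]) (auto simp: fm_code.simps)
      qed
    qed
  qed
  with assms show ?thesis unfolding star_code_def by blast
qed

text \<open>\<open>star\<close> is not injective; this is the right inverse that avoids both new
  symbols.\<close>

primrec unstar :: "fm \<Rightarrow> fm" where
  "unstar Bot = Bot"
| "unstar (Eq s t) = Eq s t"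
| "unstar (Rel r ts) = Rel (Suc (Suc r)) ts"
| "unstar (Imp p q) = Imp (unstar p) (unstar q)"
| "unstar (Forall p) = Forall (unstar p)"

lemma star_unstar [simp]: "star (unstar p) = p"
  by (induction p) auto

lemma wff_unstar: "wff L n p \<Longrightarrow> wff (ext_sig L) n (unstar p)"
proof (induction p arbitrary: n)
  case (Rel r ts)
  then show ?case by (simp only: unstar.simps wff_ext_sig_Rel)
qed auto

section \<open>Translations on codes\<close>

lemma tmval_tm_code_subst: "tmval e (tm_code (tsubst \<sigma> t)) = tmval (\<lambda>i. tmval e (tm_code (\<sigma> i))) (tm_code t)"
  by (cases t) simp_all

lemma sat_subst: "sat b e (subst \<sigma> p) \<longleftrightarrow> sat b (\<lambda>i. tmval e (tm_code (\<sigma> i))) p"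
proof (induction p arbitrary: e \<sigma>)
  case (Rel r ts)
  have "(\<exists>s t. map (tsubst \<sigma>) ts = [s, t] \<and> P s t) \<longleftrightarrow> (\<exists>s t. ts = [s, t] \<and> P (tsubst \<sigma> s) (tsubst \<sigma> t))" for P
    by (auto simp: map_eq_Cons_conv)
  then show ?case unfolding subst.simps sat_Rel by (simp only: tmval_tm_code_subst)
next
  case (Forall p)
  have "(\<lambda>i. tmval (case_nat a e) (tm_code (case_nat (Var 0) (\<lambda>x. tsubst (\<lambda>y. Var (Suc y)) (\<sigma> x)) i))) =
      case_nat a (\<lambda>i. tmval e (tm_code (\<sigma> i)))" for a
    by (rule ext) (auto split: nat.split simp: tmval_tm_code_subst)
  then show ?case using Forall by (simp del: tm_code.simps)
qed (simp_all add: tmval_tm_code_subst)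

lemma tmval_cong: "wft L n t \<Longrightarrow> (\<And>i. i < n \<Longrightarrow> e i = e' i) \<Longrightarrow> tmval e (tm_code t) = tmval e' (tm_code t)"
  by (cases t) simp_all

lemma sat_cong: "wff L n p \<Longrightarrow> (\<And>i. i < n \<Longrightarrow> e i = e' i) \<Longrightarrow> sat b e p \<longleftrightarrow> sat b e' p"
proof (induction p arbitrary: n e e')
  case (Eq s t)
  then show ?case using tmval_cong[of L n s e e'] tmval_cong[of L n t e e'] by simp
next
  case (Rel r ts)
  have "tmval e (tm_code t) = tmval e' (tm_code t)" if "t \<in> set ts" for t
    using Rel tmval_cong[of L n t e e'] that by (simp add: list_all_iff)
  then show ?case unfolding sat_Rel by (metis list.set_intros)
next
  case (Imp p q)
  from Imp.prems have "sat b e p \<longleftrightarrow> sat b e' p" by (intro Imp.IH(1)) auto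
  moreover from Imp.prems have "sat b e q \<longleftrightarrow> sat b e' q" by (intro Imp.IH(2)) auto
  ultimately show ?case by simp
next
  case (Forall p)
  have "sat b (case_nat a e) p \<longleftrightarrow> sat b (case_nat a e') p" for a
    by (rule Forall.IH) (use Forall.prems in \<open>auto split: nat.split\<close>)
  then show ?case by simp
qed simp

section \<open>Semantics of translated formulas\<close>

definition app :: "nat list \<Rightarrow> (nat \<Rightarrow> nat) \<Rightarrow> nat \<Rightarrow> nat" where
  "app zs e i = (if i < length zs then zs ! i else e (i - length zs))"

lemma app_Nil [simp]: "app [] e = e"
  by (simp add: app_def fun_eq_iff)

lemma app_Cons: "app (z # zs) e = case_nat z (app zs e)"
  by (auto simp: app_def fun_eq_iff split: nat.split)

lemma app_append: "app (xs @ ys) e = app xs (app ys e)"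
  by (induction xs) (auto simp: app_Cons)

abbreviation in_dom :: "(nat \<Rightarrow> bool) \<Rightarrow> translation \<Rightarrow> nat \<Rightarrow> bool" where
  "in_dom b I a \<equiv> sat b (case_nat a (\<lambda>_. 0)) (tr_dom I)"

lemma sat_dom:
  assumes "wff L 1 (tr_dom I)" shows "sat b e (tr_dom I) \<longleftrightarrow> in_dom b I (e 0)"
  using assms by (rule sat_cong) simp

lemma sat_ex_dom:
  assumes "wff L 1 (tr_dom I)"
  shows "sat b e (ex_dom I m p) \<longleftrightarrow>
    (\<exists>zs. length zs = m \<and> (\<forall>z\<in>set zs. in_dom b I z) \<and> sat b (app zs e) p)"
proof (induction m arbitrary: e)
  case (Suc m)
  have "sat b e (ex_dom I (Suc m) p) \<longleftrightarrow>
      (\<exists>x. in_dom b I x \<and> (\<exists>zs. length zs = m \<and> (\<forall>z\<in>set zs. in_dom b I z) \<and> sat b (app zs (case_nat x e)) p))"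
    by (simp add: Suc.IH sat_dom[OF assms, of b "case_nat _ e"])
  also have "\<dots> \<longleftrightarrow> (\<exists>zs. length zs = Suc m \<and> (\<forall>z\<in>set zs. in_dom b I z) \<and> sat b (app zs e) p)"
    (is "?L \<longleftrightarrow> ?R")
  proof
    assume ?L
    then obtain x zs where "in_dom b I x" "length zs = m" "\<forall>z\<in>set zs. in_dom b I z"
      "sat b (app zs (case_nat x e)) p" by blast
    then show ?R by (intro exI[of _ "zs @ [x]"]) (simp add: app_append app_Cons)
  next
    assume ?R
    then obtain zs x where "length zs = m" "\<forall>z\<in>set (zs @ [x]). in_dom b I z" "sat b (app (zs @ [x]) e) p"
      by (auto simp: length_Suc_conv_rev)
    then show ?L by (intro exI[of _ x]) (auto simp: app_append app_Cons)
  qed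
  finally show ?case .
qed simp

lemma sat_conjs [simp]: "sat b e (conjs ps) \<longleftrightarrow> (\<forall>p\<in>set ps. sat b e p)"
  by (induction ps) (auto simp: conjs_def)

lemma sat_at_vars: "sat b e (at_vars p xs) \<longleftrightarrow> sat b (\<lambda>i. e (xs ! i)) p"
  unfolding at_vars_def sat_subst by simp

text \<open>The unnested graph of a term: \<open>h\<close> gives the values of the variables.\<close>

primrec graph :: "(nat \<Rightarrow> bool) \<Rightarrow> translation \<Rightarrow> tm \<Rightarrow> (nat \<Rightarrow> nat) \<Rightarrow> nat \<Rightarrow> bool" where
  "graph b I (Var x) = (\<lambda>h a. sat b (app [h x, a] (\<lambda>_. 0)) (tr_eq I))"
| "graph b I (Fn f ts) = (\<lambda>h a. \<exists>zs. length zs = length ts \<and> (\<forall>z\<in>set zs. in_dom b I z) \<and>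
     (\<forall>i<length ts. (map (graph b I) ts ! i) h (zs ! i)) \<and> sat b (app (zs @ [a]) (\<lambda>_. 0)) (tr_fun I f))"

definition block :: "(nat \<Rightarrow> bool) \<Rightarrow> translation \<Rightarrow> tm list \<Rightarrow> (nat \<Rightarrow> nat) \<Rightarrow> (nat list \<Rightarrow> bool) \<Rightarrow> bool" where
  "block b I ts h P \<longleftrightarrow> (\<exists>zs. length zs = length ts \<and> (\<forall>z\<in>set zs. in_dom b I z) \<and>
     (\<forall>i<length ts. graph b I (ts ! i) h (zs ! i)) \<and> P zs)"

lemma graph_Fn: "graph b I (Fn f ts) h a \<longleftrightarrow>
    block b I ts h (\<lambda>zs. sat b (app (zs @ [a]) (\<lambda>_. 0)) (tr_fun I f))"
  unfolding block_def graph.simps by (rule ex_cong1) auto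

lemma block_cong:
  "(\<And>zs. length zs = length ts \<Longrightarrow> P zs \<longleftrightarrow> Q zs) \<Longrightarrow> block b I ts h P \<longleftrightarrow> block b I ts h Q"
  unfolding block_def by blast

lemma sat_tr_args:
  assumes "\<And>t e k y. t \<in> set ts \<Longrightarrow> sat b e (tr_val I t k y) \<longleftrightarrow> graph b I t (\<lambda>x. e (x + k)) (e y)"
    and "length zs = length ts"
  shows "sat b (app zs e) (tr_args (map (tr_val I) ts) (k + length ts)) \<longleftrightarrow>
    (\<forall>i<length ts. graph b I (ts ! i) (\<lambda>x. e (x + k)) (zs ! i))"
proof -
  have "sat b (app zs e) (tr_val I (ts ! i) (k + length ts) i) \<longleftrightarrow>
      graph b I (ts ! i) (\<lambda>x. e (x + k)) (zs ! i)" if "i < length ts" for i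
    using assms that by (simp add: app_def add.assoc)
  then show ?thesis by (auto simp: tr_args_def)
qed

lemma sat_tr_block:
  assumes "wff L' 1 (tr_dom I)"
    and "\<And>t e k y. t \<in> set ts \<Longrightarrow> sat b e (tr_val I t k y) \<longleftrightarrow> graph b I t (\<lambda>x. e (x + k)) (e y)"
  shows "sat b e (ex_dom I (length ts) (And (tr_args (map (tr_val I) ts) (k + length ts)) p)) \<longleftrightarrow>
    block b I ts (\<lambda>x. e (x + k)) (\<lambda>zs. sat b (app zs e) p)"
  unfolding sat_ex_dom[OF assms(1)] block_def
  by (rule ex_cong1) (use sat_tr_args[OF assms(2)] in auto)

lemma sat_tr_val:
  assumes "is_translation I L L'"
  shows "wft L n t \<Longrightarrow> sat b e (tr_val I t k y) \<longleftrightarrow> graph b I t (\<lambda>x. e (x + k)) (e y)"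
proof (induction t arbitrary: e k y)
  case (Var x)
  have "wff L' 2 (tr_eq I)" using assms by (simp add: is_translation_def)
  then show ?case unfolding tr_val.simps graph.simps sat_at_vars
    by (rule sat_cong) (auto simp: app_def less_2_cases_iff)
next
  case (Fn f ts)
  have IH: "t \<in> set ts \<Longrightarrow> sat b e (tr_val I t k y) \<longleftrightarrow> graph b I t (\<lambda>x. e (x + k)) (e y)" for t e k y
    using Fn by (auto simp: list_all_iff)
  have wf: "wff L' 1 (tr_dom I)" "wff L' (Suc (length ts)) (tr_fun I f)"
    using assms Fn.prems by (auto simp: is_translation_def)
  have "sat b e (tr_val I (Fn f ts) k y) \<longleftrightarrow> block b I ts (\<lambda>x. e (x + k))
      (\<lambda>zs. sat b (app zs e) (at_vars (tr_fun I f) ([0..<length ts] @ [y + length ts])))"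
    unfolding tr_val.simps Let_def by (rule sat_tr_block[OF wf(1) IH])
  also have "\<dots> \<longleftrightarrow> graph b I (Fn f ts) (\<lambda>x. e (x + k)) (e y)"
    unfolding graph_Fn sat_at_vars
  proof (rule block_cong)
    fix zs :: "nat list" assume zs: "length zs = length ts"
    show "sat b (\<lambda>i. app zs e (([0..<length ts] @ [y + length ts]) ! i)) (tr_fun I f) \<longleftrightarrow>
        sat b (app (zs @ [e y]) (\<lambda>_. 0)) (tr_fun I f)"
      using wf(2) by (rule sat_cong) (use zs in \<open>auto simp: app_def nth_append less_Suc_eq\<close>)
  qed
  finally show ?case .
qed

section \<open>Translations as operations on codes\<close>

abbreviation (input) "bot_code \<equiv> prod_encode (0, 0)"
abbreviation (input) "imp_code x y \<equiv> prod_encode (3, prod_encode (x, y))"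
abbreviation (input) "neg_code x \<equiv> imp_code x bot_code"
abbreviation (input) "and_code x y \<equiv> neg_code (imp_code x (neg_code y))"
abbreviation (input) "ex_code x \<equiv> neg_code (prod_encode (4, neg_code x))"
abbreviation (input) "eq_code x y \<equiv> prod_encode (1, prod_encode (x, y))"

abbreviation (input) "dom_of n \<equiv> pi1 n"
abbreviation (input) "eq_of n \<equiv> pi1 (pi2 n)"
abbreviation (input) "rel_of n r \<equiv> nthc (pi1 (pi2 (pi2 n))) r"
abbreviation (input) "fun_of n f \<equiv> nthc (pi2 (pi2 (pi2 n))) f"

text \<open>\<open>translate n\<close> is, up to equivalence in the structures at hand, the translation with code \<open>n\<close>.
  The quantifiers for the arguments are interleaved with the graphs of the arguments, so that the
  formulas of the translation are used without renaming their variables.\<close>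

primrec graph_block :: "nat \<Rightarrow> (nat \<Rightarrow> nat) list \<Rightarrow> nat \<Rightarrow> nat \<Rightarrow> nat" where
  "graph_block n [] k x = x"
| "graph_block n (v # vs) k x = graph_block n vs k
     (ex_code (and_code (dom_of n) (and_code (v (Suc (k + length vs))) x)))"

text \<open>Variable 0 stands for the value, and the variables of the term are shifted by
  \<open>k\<close>. For a variable, the new quantifier puts the term in place 0 and moves the value
  to place 1, as the equality formula expects. For a function symbol the argument quantifiers move
  the value to the place after the arguments, again as expected.\<close>

primrec graph_code :: "nat \<Rightarrow> tm \<Rightarrow> nat \<Rightarrow> nat" where
  "graph_code n (Var x) = (\<lambda>k. ex_code (and_code
     (eq_code (prod_encode (0, 0)) (prod_encode (0, Suc (x + k)))) (eq_of n)))"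
| "graph_code n (Fn f ts) = (\<lambda>k. graph_block n (map (graph_code n) ts) k (fun_of n f))"

primrec translate :: "nat \<Rightarrow> fm \<Rightarrow> nat" where
  "translate n Bot = bot_code"
| "translate n (Eq s t) = graph_block n (map (graph_code n) [s, t]) 0 (eq_of n)"
| "translate n (Rel r ts) = graph_block n (map (graph_code n) ts) 0 (rel_of n r)"
| "translate n (Imp p q) = imp_code (translate n p) (translate n q)"
| "translate n (Forall p) = prod_encode (4, imp_code (dom_of n) (translate n p))"

text \<open>\<open>translate\<close> is defined for all numbers, and the tree treats all of them;
  this relation serves only to find the number that belongs to a given translation.\<close>

definition codes_translation :: "nat \<Rightarrow> translation \<Rightarrow> signature \<Rightarrow> bool" where
  "codes_translation n I L \<longleftrightarrow> dom_of n = fm_code (tr_dom I) \<and> eq_of n = fm_code (tr_eq I) \<and>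
     (\<forall>r<length (rels L). rel_of n r = fm_code (tr_rel I r)) \<and>
     (\<forall>f<length (funs L). fun_of n f = fm_code (tr_fun I f))"

lemma ex_codes_translation: "\<exists>n. codes_translation n I L"
proof -
  obtain rl where "\<forall>r<length (rels L). nthc rl r = fm_code (tr_rel I r)"
    using ex_nthc[of "length (rels L)" "\<lambda>r. fm_code (tr_rel I r)"] by blast
  moreover obtain fl where "\<forall>f<length (funs L). nthc fl f = fm_code (tr_fun I f)"
    using ex_nthc[of "length (funs L)" "\<lambda>f. fm_code (tr_fun I f)"] by blast
  ultimately show ?thesis unfolding codes_translation_def
    by (intro exI[of _ "prod_encode (fm_code (tr_dom I), prod_encode (fm_code (tr_eq I), prod_encode (rl, fl)))"]) simp
qed

text \<open>The quantifier of the first argument is innermost, hence binds variable 0 in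
  \<open>x\<close>. The shift \<open>Suc (k + length ts)\<close> accounts for the quantifiers of the
  later arguments and for its own.\<close>

lemma satc_graph_block:
  assumes dom: "\<And>e. satc UNIV b e (dom_of n) \<longleftrightarrow> in_dom b I (e 0)"
    and "\<And>t e k. t \<in> set ts \<Longrightarrow> satc UNIV b e (graph_code n t k) \<longleftrightarrow> graph b I t (\<lambda>x. e (x + k)) (e 0)"
  shows "satc UNIV b e (graph_block n (map (graph_code n) ts) k x) \<longleftrightarrow>
    block b I ts (\<lambda>x. e (x + k)) (\<lambda>zs. satc UNIV b (app zs e) x)"
  using assms(2)
proof (induction ts arbitrary: x)
  case Nil
  then show ?case by (simp add: block_def)
next
  case (Cons t ts)
  let ?h = "\<lambda>x. e (x + k)"
  have shift: "case_nat z (app zs e) (y + Suc (k + length ts)) = ?h y" if "length zs = length ts" for z y zs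
    using that by (simp add: app_def)
  have "satc UNIV b e (graph_block n (map (graph_code n) (t # ts)) k x) \<longleftrightarrow>
    block b I ts ?h (\<lambda>zs. satc UNIV b (app zs e)
      (ex_code (and_code (dom_of n) (and_code (graph_code n t (Suc (k + length ts))) x))))"
    using Cons.IH Cons.prems by simp
  also have "\<dots> \<longleftrightarrow> block b I ts ?h (\<lambda>zs. \<exists>z. in_dom b I z \<and> graph b I t ?h z \<and> satc UNIV b (app (z # zs) e) x)"
    using shift by (intro block_cong) (simp add: dom Cons.prems app_Cons, blast)
  also have "\<dots> \<longleftrightarrow> block b I (t # ts) ?h (\<lambda>zs. satc UNIV b (app zs e) x)" (is "?L \<longleftrightarrow> ?R")
  proof
    assume ?L
    then obtain zs z where "length zs = length ts" "\<forall>z\<in>set zs. in_dom b I z"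
      "\<forall>i<length ts. graph b I (ts ! i) ?h (zs ! i)" "in_dom b I z" "graph b I t ?h z"
      "satc UNIV b (app (z # zs) e) x" unfolding block_def by blast
    then show ?R unfolding block_def
      by (intro exI[of _ "z # zs"]) (auto simp: nth_Cons split: nat.split)
  next
    assume ?R
    then obtain z zs where "length zs = length ts" "\<forall>z\<in>set (z # zs). in_dom b I z"
      "\<forall>i<Suc (length ts). graph b I ((t # ts) ! i) ?h ((z # zs) ! i)"
      "satc UNIV b (app (z # zs) e) x" unfolding block_def by (auto simp: length_Suc_conv)
    then show ?L unfolding block_def All_less_Suc2 by (intro exI[of _ zs]) auto
  qed
  finally show ?case .
qed

lemma satc_graph_code:
  assumes I: "is_translation I L L'" and n: "codes_translation n I L"
  shows "wft L m t \<Longrightarrow> satc UNIV b e (graph_code n t k) \<longleftrightarrow> graph b I t (\<lambda>x. e (x + k)) (e 0)"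
proof (induction t arbitrary: e k)
  case (Var x)
  have "wff L' 2 (tr_eq I)" using I by (simp add: is_translation_def)
  then have "sat b (case_nat (e (x + k)) e) (tr_eq I) \<longleftrightarrow> graph b I (Var x) (\<lambda>x. e (x + k)) (e 0)"
    unfolding graph.simps by (rule sat_cong) (auto simp: app_def less_2_cases_iff)
  then show ?case using n by (simp add: codes_translation_def)
next
  case (Fn f ts)
  have IH: "t \<in> set ts \<Longrightarrow> satc UNIV b e (graph_code n t k) \<longleftrightarrow> graph b I t (\<lambda>x. e (x + k)) (e 0)" for t e k
    using Fn by (auto simp: list_all_iff)
  have wf: "wff L' 1 (tr_dom I)" "wff L' (Suc (length ts)) (tr_fun I f)" "f < length (funs L)"
    using I Fn.prems by (auto simp: is_translation_def)
  have dom: "satc UNIV b e (dom_of n) \<longleftrightarrow> in_dom b I (e 0)" for e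
    using n sat_dom[OF wf(1)] by (simp add: codes_translation_def)
  have "satc UNIV b e (graph_code n (Fn f ts) k) \<longleftrightarrow>
      block b I ts (\<lambda>x. e (x + k)) (\<lambda>zs. sat b (app zs e) (tr_fun I f))"
    unfolding graph_code.simps
    by (subst satc_graph_block[OF dom IH], assumption+) (use n wf(3) in \<open>simp add: codes_translation_def\<close>)
  also have "\<dots> \<longleftrightarrow> graph b I (Fn f ts) (\<lambda>x. e (x + k)) (e 0)"
    unfolding graph_Fn
  proof (rule block_cong)
    fix zs :: "nat list" assume zs: "length zs = length ts"
    show "sat b (app zs e) (tr_fun I f) \<longleftrightarrow> sat b (app (zs @ [e 0]) (\<lambda>_. 0)) (tr_fun I f)"
      using wf(2) by (rule sat_cong) (use zs in \<open>auto simp: app_def nth_append less_Suc_eq\<close>)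
  qed
  finally show ?case .
qed

text \<open>The two translations differ in how they quantify over arguments, but both express the
  unnested graphs in \<open>block\<close>. Agreement in the structures suffices, because theoremhood
  under the negation of \<open>P\<close> is defined by truth in them.\<close>

lemma satc_translate:
  assumes I: "is_translation I L L'" and n: "codes_translation n I L"
  shows "wff L m p \<Longrightarrow> satc UNIV b e (translate n p) \<longleftrightarrow> sat b e (tr_fm I p)"
proof (induction p arbitrary: m e)
  have wf: "wff L' 1 (tr_dom I)" using I by (simp add: is_translation_def)
  have dom: "satc UNIV b e (dom_of n) \<longleftrightarrow> in_dom b I (e 0)" for e
    using n sat_dom[OF wf] by (simp add: codes_translation_def)
  {
    case Bot
    show ?case by (simp add: fm_code.simps)
  next
    case (Eq s t)
    have st: "u \<in> set [s, t] \<Longrightarrow> wft L m u" for u using Eq by auto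
    have "satc UNIV b e (translate n (Eq s t)) \<longleftrightarrow>
        block b I [s, t] (\<lambda>x. e (x + 0)) (\<lambda>zs. sat b (app zs e) (tr_eq I))"
      unfolding translate.simps
      by (subst satc_graph_block[OF dom satc_graph_code[OF I n st]], assumption+)
        (use n in \<open>simp add: codes_translation_def\<close>)
    also have "\<dots> \<longleftrightarrow> block b I [s, t] (\<lambda>x. e (x + 0)) (\<lambda>zs. sat b (app zs e) (at_vars (tr_eq I) [0, 1]))"
      unfolding sat_at_vars
    proof (rule block_cong)
      fix zs :: "nat list"
      have "wff L' 2 (tr_eq I)" using I by (simp add: is_translation_def)
      then show "sat b (app zs e) (tr_eq I) \<longleftrightarrow> sat b (\<lambda>i. app zs e ([0, 1] ! i)) (tr_eq I)"
        by (rule sat_cong) (auto simp: less_2_cases_iff)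
    qed
    also have "\<dots> \<longleftrightarrow> sat b e (tr_fm I (Eq s t))"
      using sat_tr_block[where ts = "[s, t]" and k = 0 and b = b and e = e and p = "at_vars (tr_eq I) [0, 1]",
          OF wf sat_tr_val[OF I st]]
      by (simp add: numeral_2_eq_2)
    finally show ?case .
  next
    case (Rel r ts)
    have ts: "u \<in> set ts \<Longrightarrow> wft L m u" for u using Rel by (auto simp: list_all_iff)
    have "satc UNIV b e (translate n (Rel r ts)) \<longleftrightarrow>
        block b I ts (\<lambda>x. e (x + 0)) (\<lambda>zs. sat b (app zs e) (tr_rel I r))"
      unfolding translate.simps
      by (subst satc_graph_block[OF dom satc_graph_code[OF I n ts]], assumption+)
        (use n Rel in \<open>simp add: codes_translation_def\<close>)
    also have "\<dots> \<longleftrightarrow> block b I ts (\<lambda>x. e (x + 0)) (\<lambda>zs. sat b (app zs e) (at_vars (tr_rel I r) [0..<length ts]))"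
      unfolding sat_at_vars
    proof (rule block_cong)
      fix zs :: "nat list"
      have "wff L' (length ts) (tr_rel I r)" using I Rel by (simp add: is_translation_def)
      then show "sat b (app zs e) (tr_rel I r) \<longleftrightarrow> sat b (\<lambda>i. app zs e ([0..<length ts] ! i)) (tr_rel I r)"
        by (rule sat_cong) auto
    qed
    also have "\<dots> \<longleftrightarrow> sat b e (tr_fm I (Rel r ts))"
      unfolding tr_fm.simps Let_def
      using sat_tr_block[where ts = ts and k = 0 and b = b and e = e and p = "at_vars (tr_rel I r) [0..<length ts]",
          OF wf sat_tr_val[OF I ts]]
      by simp
    finally show ?case .
  next
    case (Imp p q)
    then show ?case using Imp.IH(1)[of m e] Imp.IH(2)[of m e] by simp
  next
    case (Forall p)
    then show ?case using Forall.IH[of "Suc m"] dom sat_dom[OF wf] by simp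
  }
qed

text \<open>The graph of \<open>translate\<close>: tag 0 is for terms, tag 1 for blocks of
  arguments, tag 2 for formulas. In a block the third last number is \<open>k\<close> plus the
  length of the list, so that the shift of the next argument can be read off.\<close>

definition trans_base :: "nat \<Rightarrow> bool" where
  "trans_base z \<longleftrightarrow>
     (\<exists>n x k. z = tag 0 (quad n (tag 0 x) k (ex_code (and_code
        (eq_code (prod_encode (0, 0)) (prod_encode (0, Suc (x + k)))) (eq_of n))))) \<or>
     (\<exists>n k x. z = tag 1 (prod_encode (prod_encode (n, k), quad 0 k x x))) \<or>
     (\<exists>n. z = tag 2 (trip n bot_code bot_code))"

definition trans_step :: "nat \<Rightarrow> nat \<Rightarrow> nat \<Rightarrow> bool" where
  "trans_step z p q \<longleftrightarrow>
     (\<exists>n f ts k j y. p = tag 1 (prod_encode (prod_encode (n, k), quad ts j (fun_of n f) y)) \<and>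
        z = tag 0 (quad n (tag 1 (prod_encode (f, ts))) k y)) \<or>
     (\<exists>n k t ts j x v y. p = tag 0 (quad n t (Suc j) v) \<and>
        q = tag 1 (prod_encode (prod_encode (n, k), quad ts j (ex_code (and_code (dom_of n) (and_code v x))) y)) \<and>
        z = tag 1 (prod_encode (prod_encode (n, k), quad (consc t ts) (Suc j) x y))) \<or>
     (\<exists>n s t j y. p = tag 1 (prod_encode (prod_encode (n, 0), quad (consc s (consc t 0)) j (eq_of n) y)) \<and>
        z = tag 2 (trip n (tag 1 (prod_encode (s, t))) y)) \<or>
     (\<exists>n r ts j y. p = tag 1 (prod_encode (prod_encode (n, 0), quad ts j (rel_of n r) y)) \<and>
        z = tag 2 (trip n (tag 2 (prod_encode (r, ts))) y)) \<or>
     (\<exists>n x x' y y'. p = tag 2 (trip n x x') \<and> q = tag 2 (trip n y y') \<and>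
        z = tag 2 (trip n (imp_code x y) (imp_code x' y'))) \<or>
     (\<exists>n x x'. p = tag 2 (trip n x x') \<and> z = tag 2 (trip n (tag 4 x) (tag 4 (imp_code (dom_of n) x'))))"

definition trans_code :: "nat \<Rightarrow> nat \<Rightarrow> nat \<Rightarrow> bool" where
  "trans_code n x y \<longleftrightarrow> closure trans_base trans_step (tag 2 (trip n x y))"

lemma re_trans_code [re_intros]:
  assumes "computable f" "computable g" "computable h"
  shows "re (\<lambda>x. trans_code (f x) (g x) (h x))"
proof -
  have "re (closure trans_base trans_step)"
    unfolding trans_base_def trans_step_def by (intro re_closure re_intros computable_intros)
  then show ?thesis unfolding trans_code_def by (rule re_comp) (intro computable_intros assms)
qed

definition trans_sound :: "nat \<Rightarrow> bool" where
  "trans_sound z \<longleftrightarrow>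
     (\<forall>n t k y. z = tag 0 (quad n (tm_code t) k y) \<longrightarrow> y = graph_code n t k) \<and>
     (\<forall>n k ts j x y. z = tag 1 (prod_encode (prod_encode (n, k), quad (list_encode (map tm_code ts)) j x y)) \<longrightarrow>
        j = k + length ts \<and> y = graph_block n (map (graph_code n) ts) k x) \<and>
     (\<forall>n p y. z = tag 2 (trip n (fm_code p) y) \<longrightarrow> y = translate n p)"

lemma trans_sound_tags:
  "trans_sound (tag 0 (quad n x k y)) \<longleftrightarrow> (\<forall>t. x = tm_code t \<longrightarrow> y = graph_code n t k)"
  "trans_sound (tag 1 (prod_encode (prod_encode (n, k), quad w j x y))) \<longleftrightarrow>
     (\<forall>ts. w = list_encode (map tm_code ts) \<longrightarrow>
        j = k + length ts \<and> y = graph_block n (map (graph_code n) ts) k x)"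
  "trans_sound (tag 2 (trip n x y)) \<longleftrightarrow> (\<forall>p. x = fm_code p \<longrightarrow> y = translate n p)"
  by (auto simp: trans_sound_def)

lemma tm_code_tags:
  "tag 0 x = tm_code t \<longleftrightarrow> t = Var x"
  "tag 1 (prod_encode (f, w)) = tm_code t \<longleftrightarrow> (\<exists>ts. t = Fn f ts \<and> w = list_encode (map tm_code ts))"
  by (cases t; auto)+

lemma consc_list_encode:
  "consc x w = list_encode (map tm_code ts) \<longleftrightarrow>
     (\<exists>t us. ts = t # us \<and> x = tm_code t \<and> w = list_encode (map tm_code us))"
  by (cases ts) (auto simp: consc_def)

lemma fm_code_tags:
  "prod_encode (0, 0) = fm_code p \<longleftrightarrow> p = Bot"
  "tag 1 (prod_encode (x, y)) = fm_code p \<longleftrightarrow> (\<exists>s t. p = Eq s t \<and> x = tm_code s \<and> y = tm_code t)"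
  "tag 2 (prod_encode (r, w)) = fm_code p \<longleftrightarrow> (\<exists>ts. p = Rel r ts \<and> w = list_encode (map tm_code ts))"
  "tag 3 (prod_encode (x, y)) = fm_code p \<longleftrightarrow> (\<exists>q r. p = Imp q r \<and> x = fm_code q \<and> y = fm_code r)"
  "tag 4 x = fm_code p \<longleftrightarrow> (\<exists>q. p = Forall q \<and> x = fm_code q)"
  by (cases p; auto simp: fm_code.simps)+

lemma trans_base_sound: "trans_base z \<Longrightarrow> trans_sound z"
  unfolding trans_base_def
proof (elim disjE exE)
  fix n x k assume z: "z = tag 0 (quad n (tag 0 x) k (ex_code (and_code
        (eq_code (prod_encode (0, 0)) (prod_encode (0, Suc (x + k)))) (eq_of n))))"
  show ?thesis unfolding z trans_sound_tags tm_code_tags by simp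
next
  fix n k x assume z: "z = tag 1 (prod_encode (prod_encode (n, k), quad 0 k x x))"
  have "0 = list_encode (map tm_code ts) \<longleftrightarrow> ts = []" for ts by (cases ts) auto
  then show ?thesis unfolding z trans_sound_tags by simp
next
  fix n assume z: "z = tag 2 (trip n bot_code bot_code)"
  show ?thesis unfolding z trans_sound_tags fm_code_tags by simp
qed

lemma trans_step_sound: "trans_step z p q \<Longrightarrow> trans_sound p \<Longrightarrow> trans_sound q \<Longrightarrow> trans_sound z"
  unfolding trans_step_def
proof (elim disjE exE conjE)
  fix n f ts k j y
  assume p: "p = tag 1 (prod_encode (prod_encode (n, k), quad ts j (fun_of n f) y))" "trans_sound p"
    and z: "z = tag 0 (quad n (tag 1 (prod_encode (f, ts))) k y)"
  from p(2) show ?thesis unfolding z p(1) trans_sound_tags tm_code_tags by auto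
next
  fix n k t ts j x v y
  assume p: "p = tag 0 (quad n t (Suc j) v)" "trans_sound p"
    and q: "q = tag 1 (prod_encode (prod_encode (n, k), quad ts j (ex_code (and_code (dom_of n) (and_code v x))) y))"
      "trans_sound q"
    and z: "z = tag 1 (prod_encode (prod_encode (n, k), quad (consc t ts) (Suc j) x y))"
  from p(2) q(2) show ?thesis unfolding z p(1) q(1) trans_sound_tags consc_list_encode by auto
next
  fix n s t j y
  assume p: "p = tag 1 (prod_encode (prod_encode (n, 0), quad (consc s (consc t 0)) j (eq_of n) y))" "trans_sound p"
    and z: "z = tag 2 (trip n (tag 1 (prod_encode (s, t))) y)"
  show ?thesis unfolding z trans_sound_tags fm_code_tags
  proof (intro allI impI, elim exE conjE)
    fix r u v assume *: "r = Eq u v" "s = tm_code u" "t = tm_code v"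
    then have "consc s (consc t 0) = list_encode (map tm_code [u, v])" by (simp add: consc_def)
    with p(2) have "y = graph_block n (map (graph_code n) [u, v]) 0 (eq_of n)"
      unfolding p(1) trans_sound_tags by blast
    with * show "y = translate n r" by simp
  qed
next
  fix n r ts j y
  assume p: "p = tag 1 (prod_encode (prod_encode (n, 0), quad ts j (rel_of n r) y))" "trans_sound p"
    and z: "z = tag 2 (trip n (tag 2 (prod_encode (r, ts))) y)"
  from p(2) show ?thesis unfolding z p(1) trans_sound_tags fm_code_tags by auto
next
  fix n x x' y y'
  assume p: "p = tag 2 (trip n x x')" "trans_sound p" and q: "q = tag 2 (trip n y y')" "trans_sound q"
    and z: "z = tag 2 (trip n (imp_code x y) (imp_code x' y'))"
  from p(2) q(2) show ?thesis unfolding z p(1) q(1) trans_sound_tags fm_code_tags by auto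
next
  fix n x x'
  assume p: "p = tag 2 (trip n x x')" "trans_sound p"
    and z: "z = tag 2 (trip n (tag 4 x) (tag 4 (imp_code (dom_of n) x')))"
  from p(2) show ?thesis unfolding z p(1) trans_sound_tags fm_code_tags by auto
qed

lemma trans_complete_block:
  assumes "\<And>t k. t \<in> set ts \<Longrightarrow> closure trans_base trans_step (tag 0 (quad n (tm_code t) k (graph_code n t k)))"
  shows "closure trans_base trans_step (tag 1 (prod_encode (prod_encode (n, k),
    quad (list_encode (map tm_code ts)) (k + length ts) x (graph_block n (map (graph_code n) ts) k x))))"
  using assms
proof (induction ts arbitrary: x)
  case Nil
  show ?case by (rule closure_base) (auto simp: trans_base_def)
next
  case (Cons t ts)
  let ?v = "graph_code n t (Suc (k + length ts))"
  have "closure trans_base trans_step (tag 0 (quad n (tm_code t) (Suc (k + length ts)) ?v))"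
    using Cons.prems by simp
  moreover have "closure trans_base trans_step (tag 1 (prod_encode (prod_encode (n, k),
    quad (list_encode (map tm_code ts)) (k + length ts) (ex_code (and_code (dom_of n) (and_code ?v x)))
      (graph_block n (map (graph_code n) ts) k (ex_code (and_code (dom_of n) (and_code ?v x)))))))"
    using Cons by simp
  ultimately show ?case
    by (rule closure_step[rotated]) (auto simp: trans_step_def consc_def)
qed

lemma trans_complete_tm: "closure trans_base trans_step (tag 0 (quad n (tm_code t) k (graph_code n t k)))"
proof (induction t arbitrary: k)
  case (Var x)
  show ?case by (rule closure_base) (auto simp: trans_base_def)
next
  case (Fn f ts)
  note IH = trans_complete_block[where ts = ts and n = n and k = k and x = "fun_of n f", OF Fn.IH]
  show ?case by (rule closure_step[OF _ IH IH]) (auto simp: trans_step_def)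
qed

lemma trans_complete: "trans_code n (fm_code p) (translate n p)"
proof (induction p)
  case Bot
  show ?case unfolding trans_code_def by (rule closure_base) (auto simp: trans_base_def fm_code.simps)
next
  case (Eq s t)
  note IH = trans_complete_block[where ts = "[s, t]" and n = n and k = 0 and x = "eq_of n", OF trans_complete_tm]
  show ?case unfolding trans_code_def
    by (rule closure_step[OF _ IH IH]) (auto simp: trans_step_def fm_code.simps consc_def)
next
  case (Rel r ts)
  note IH = trans_complete_block[where ts = ts and n = n and k = 0 and x = "rel_of n r", OF trans_complete_tm]
  show ?case unfolding trans_code_def
    by (rule closure_step[OF _ IH IH]) (auto simp: trans_step_def fm_code.simps)
next
  case (Imp p q)
  show ?case unfolding trans_code_def
    by (rule closure_step[OF _ Imp[unfolded trans_code_def]]) (auto simp: trans_step_def fm_code.simps)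
next
  case (Forall p)
  note IH = Forall[unfolded trans_code_def]
  show ?case unfolding trans_code_def
    by (rule closure_step[OF _ IH IH]) (auto simp: trans_step_def fm_code.simps)
qed

lemma trans_code_iff: "trans_code n (fm_code p) y \<longleftrightarrow> y = translate n p"
proof
  assume "trans_code n (fm_code p) y"
  then have "trans_sound (tag 2 (trip n (fm_code p) y))" unfolding trans_code_def
    by (induction rule: closure.induct) (auto intro: trans_base_sound trans_step_sound)
  then show "y = translate n p" unfolding trans_sound_tags by blast
qed (simp add: trans_complete)

section \<open>Derived rules of the calculus\<close>

lemma wft_mono: "wft L n t \<Longrightarrow> n \<le> m \<Longrightarrow> wft L m t"
  by (induction t) (auto simp: list_all_iff)

lemma wff_mono: "wff L n p \<Longrightarrow> n \<le> m \<Longrightarrow> wff L m p"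
  by (induction p arbitrary: n m) (auto simp: list_all_iff intro: wft_mono)

lemma is_formula_simps [simp]:
  "is_formula L Bot"
  "is_formula L (Eq s t) \<longleftrightarrow> is_term L s \<and> is_term L t"
  "is_formula L (Imp p q) \<longleftrightarrow> is_formula L p \<and> is_formula L q"
  "is_formula L (Forall p) \<longleftrightarrow> is_formula L p"
proof -
  show "is_formula L (Eq s t) \<longleftrightarrow> is_term L s \<and> is_term L t"
    unfolding is_formula_def is_term_def
    by (metis wff.simps(2) wft_mono nle_le)
  show "is_formula L (Imp p q) \<longleftrightarrow> is_formula L p \<and> is_formula L q"
    unfolding is_formula_def by (metis wff.simps(4) wff_mono nle_le)
  show "is_formula L (Forall p) \<longleftrightarrow> is_formula L p"
    unfolding is_formula_def by (metis wff.simps(5) wff_mono le_SucI order_refl)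
qed (simp add: is_formula_def)

lemma is_formula_sentence: "p \<in> sentences L \<Longrightarrow> is_formula L p"
  by (auto simp: sentences_def is_formula_def)

lemma is_term_Var [simp]: "is_term L (Var x)"
  unfolding is_term_def by (rule exI[of _ "Suc x"]) simp

lemma proves_weaken: "proves L \<Gamma> p \<Longrightarrow> \<Gamma> \<subseteq> \<Delta> \<Longrightarrow> proves L \<Delta> p"
proof (induction arbitrary: \<Delta> rule: proves.induct)
  case (ImpI p \<Gamma> q)
  from ImpI.prems have "insert p \<Gamma> \<subseteq> insert p \<Delta>" by blast
  from proves.ImpI[OF ImpI.hyps(1) ImpI.IH[OF this]] show ?case .
next
  case (Raa p \<Gamma>)
  from Raa.prems have "insert (Neg p) \<Gamma> \<subseteq> insert (Neg p) \<Delta>" by blast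
  from proves.Raa[OF Raa.hyps(1) Raa.IH[OF this]] show ?case .
next
  case (AllI \<Gamma> p)
  from AllI.prems have "lift ` \<Gamma> \<subseteq> lift ` \<Delta>" by blast
  from proves.AllI[OF AllI.IH[OF this]] show ?case .
next
  case (EqSubst p \<Gamma> s t)
  then show ?case by (metis proves.EqSubst)
qed (auto intro: proves.intros)

lemma proves_finite: "proves L \<Gamma> p \<Longrightarrow> \<exists>F. finite F \<and> F \<subseteq> \<Gamma> \<and> proves L F p"
proof (induction rule: proves.induct)
  case (Assm p \<Gamma>)
  then show ?case by (intro exI[of _ "{p}"]) (auto intro: proves.Assm)
next
  case (ImpI p \<Gamma> q)
  then obtain F where "finite F" "F \<subseteq> insert p \<Gamma>" "proves L F q" by blast
  then have "finite (F - {p})" "F - {p} \<subseteq> \<Gamma>" "proves L (insert p (F - {p})) q"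
    by (auto intro: proves_weaken)
  then show ?case by (intro exI[of _ "F - {p}"] conjI proves.ImpI[OF ImpI.hyps(1)])
next
  case (ImpE \<Gamma> p q)
  then obtain F G where "finite F" "F \<subseteq> \<Gamma>" "proves L F (Imp p q)" "finite G" "G \<subseteq> \<Gamma>" "proves L G p" by blast
  then have "finite (F \<union> G)" "F \<union> G \<subseteq> \<Gamma>" "proves L (F \<union> G) (Imp p q)" "proves L (F \<union> G) p"
    by (auto intro: proves_weaken)
  then show ?case by (intro exI[of _ "F \<union> G"] conjI proves.ImpE[of L "F \<union> G" p q])
next
  case (Raa p \<Gamma>)
  then obtain F where "finite F" "F \<subseteq> insert (Neg p) \<Gamma>" "proves L F Bot" by blast
  then have "finite (F - {Neg p})" "F - {Neg p} \<subseteq> \<Gamma>" "proves L (insert (Neg p) (F - {Neg p})) Bot"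
    by (auto intro: proves_weaken)
  then show ?case by (intro exI[of _ "F - {Neg p}"] conjI proves.Raa[OF Raa.hyps(1)])
next
  case (AllI \<Gamma> p)
  then obtain F where "finite F" "F \<subseteq> lift ` \<Gamma>" "proves L F p" by blast
  then obtain G where "finite G" "G \<subseteq> \<Gamma>" "F = lift ` G" by (metis finite_subset_image)
  with \<open>proves L F p\<close> show ?case by (blast intro: proves.AllI)
next
  case (AllE t \<Gamma> p)
  then show ?case by (blast intro: proves.AllE)
next
  case (EqRefl t \<Gamma>)
  then show ?case by (blast intro: proves.EqRefl)
next
  case (EqSubst p \<Gamma> s t)
  then obtain F G where "finite F" "F \<subseteq> \<Gamma>" "proves L F (Eq s t)" "finite G" "G \<subseteq> \<Gamma>" "proves L G (inst p s)" by blast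
  then have "finite (F \<union> G)" "F \<union> G \<subseteq> \<Gamma>" "proves L (F \<union> G) (Eq s t)" "proves L (F \<union> G) (inst p s)"
    by (auto intro: proves_weaken)
  then show ?case by (intro exI[of _ "F \<union> G"] conjI proves.EqSubst[OF EqSubst.hyps(1), of "F \<union> G" s t])
qed

subsection \<open>Propositional reasoning\<close>

primrec pval :: "fm set \<Rightarrow> fm \<Rightarrow> bool" where
  "pval A Bot \<longleftrightarrow> False"
| "pval A (Eq s t) \<longleftrightarrow> Eq s t \<in> A"
| "pval A (Rel r ts) \<longleftrightarrow> Rel r ts \<in> A"
| "pval A (Imp p q) \<longleftrightarrow> (pval A p \<longrightarrow> pval A q)"
| "pval A (Forall p) \<longleftrightarrow> Forall p \<in> A"

lemma maximal_consistent:
  assumes "\<not> proves L \<Delta> Bot"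
  obtains A where "\<Delta> \<subseteq> A" "\<not> proves L A Bot"
    "\<And>q. is_formula L q \<Longrightarrow> \<not> proves L (insert q A) Bot \<Longrightarrow> q \<in> A"
proof -
  let ?S = "{A. \<Delta> \<subseteq> A \<and> \<not> proves L A Bot}"
  have "\<exists>M\<in>?S. \<forall>X\<in>?S. M \<subseteq> X \<longrightarrow> X = M"
  proof (rule subset_Zorn_nonempty)
    show "?S \<noteq> {}" using assms by blast
    fix C assume C: "C \<noteq> {}" "subset.chain ?S C"
    have "\<not> proves L (\<Union>C) Bot"
    proof
      assume "proves L (\<Union>C) Bot"
      from proves_finite[OF this] obtain F where F: "finite F" "F \<subseteq> \<Union>C" "proves L F Bot"
        by (elim exE conjE)
      obtain B where B: "B \<in> C" "F \<subseteq> B"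
        by (rule finite_subset_Union_chain[OF F(1,2) C])
      then have "proves L B Bot" using proves_weaken[OF F(3)] by blast
      moreover have "C \<subseteq> ?S" using C(2) by (simp add: subset.chain_def)
      ultimately show False using B(1) by blast
    qed
    moreover have "C \<subseteq> ?S" using C(2) by (simp add: subset.chain_def)
    then have "\<Delta> \<subseteq> \<Union>C" using C(1) by blast
    ultimately show "\<Union>C \<in> ?S" by simp
  qed
  then obtain A where "A \<in> ?S" and max: "\<forall>X\<in>?S. A \<subseteq> X \<longrightarrow> X = A" by (rule bexE)
  then have A: "\<Delta> \<subseteq> A" "\<not> proves L A Bot" by simp_all
  show ?thesis
  proof (rule that[OF A(1,2)])
    fix q assume "\<not> proves L (insert q A) Bot"
    then have "insert q A \<in> ?S" using A(1) by blast
    with max have "insert q A = A" by blast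
    then show "q \<in> A" by blast
  qed
qed

text \<open>Propositional completeness: a maximal consistent set that contains the negation of
  \<open>p\<close> is itself a valuation of the atomic and universally quantified formulas, and it
  makes all of \<Gamma> true but not \<open>p\<close>. It replaces explicit propositional
  derivations in what follows.\<close>

lemma proves_taut:
  assumes p: "is_formula L p" and \<Gamma>: "\<And>g. g \<in> \<Gamma> \<Longrightarrow> is_formula L g \<and> proves L \<Delta> g"
    and taut: "\<And>A. (\<And>g. g \<in> \<Gamma> \<Longrightarrow> pval A g) \<Longrightarrow> pval A p"
  shows "proves L \<Delta> p"
proof (rule ccontr)
  assume "\<not> proves L \<Delta> p"
  then have "\<not> proves L (insert (Neg p) \<Delta>) Bot" using proves.Raa[OF p] by (rule contrapos_nn)
  then obtain A where A: "insert (Neg p) \<Delta> \<subseteq> A" "\<not> proves L A Bot"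
    "\<And>q. is_formula L q \<Longrightarrow> \<not> proves L (insert q A) Bot \<Longrightarrow> q \<in> A"
    by (rule maximal_consistent) (rule that)
  have closed: "q \<in> A" if "is_formula L q" "proves L A q" for q
  proof (rule A(3)[OF that(1)], rule notI)
    assume "proves L (insert q A) Bot"
    from proves.ImpE[OF proves.ImpI[OF that(1) this] that(2)] A(2) show False by (rule notE[rotated])
  qed
  have val: "pval A q \<longleftrightarrow> q \<in> A" if "is_formula L q" for q
    using that
  proof (induction q)
    case Bot
    then show ?case using A(2) proves.Assm[of Bot A L] by auto
  next
    case (Imp q r)
    have "Imp q r \<in> A" if "q \<notin> A \<or> r \<in> A"
    proof -
      have "proves L A (Imp q r)"
      proof (rule proves.ImpI)
        show "proves L (insert q A) r"
        proof (cases "r \<in> A")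
          case False
          then have "proves L (insert q A) Bot" using that A(3)[of q] Imp.prems by auto
          then have "proves L (insert (Neg r) (insert q A)) Bot" by (rule proves_weaken) blast
          moreover have "is_formula L r" using Imp.prems by simp
          ultimately show ?thesis by (rule proves.Raa[rotated])
        qed (auto intro: proves.Assm)
      qed (use Imp.prems in simp)
      then show ?thesis by (rule closed[OF Imp.prems])
    qed
    moreover have "r \<in> A" if "Imp q r \<in> A" "q \<in> A"
      using closed[of r] Imp.prems proves.ImpE[OF proves.Assm[OF that(1)] proves.Assm[OF that(2)]] by simp
    ultimately show ?case using Imp by auto
  qed simp_all
  have "pval A p"
  proof (rule taut)
    fix g assume "g \<in> \<Gamma>"
    then have g: "is_formula L g" "proves L \<Delta> g" using \<Gamma> by simp_all
    from g(2) have "proves L A g" by (rule proves_weaken) (use A(1) in blast)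
    with g(1) show "pval A g" using closed val by simp
  qed
  then have "p \<in> A" using val p by blast
  moreover have "Neg p \<in> A" using A(1) by simp
  ultimately have "proves L A Bot" by (intro proves.ImpE[of L A p Bot] proves.Assm)
  with A(2) show False by (rule notE)
qed

lemma proves_taut0: "is_formula L p \<Longrightarrow> (\<And>A. pval A p) \<Longrightarrow> proves L \<Delta> p"
  by (rule proves_taut[where \<Gamma> = "{}"]) auto

lemma proves_taut1:
  "proves L \<Delta> a \<Longrightarrow> is_formula L a \<Longrightarrow> is_formula L p \<Longrightarrow> (\<And>A. pval A a \<Longrightarrow> pval A p) \<Longrightarrow> proves L \<Delta> p"
  by (rule proves_taut[where \<Gamma> = "{a}"]) auto

lemma proves_taut2:
  "proves L \<Delta> a \<Longrightarrow> proves L \<Delta> b \<Longrightarrow> is_formula L a \<Longrightarrow> is_formula L b \<Longrightarrow> is_formula L p \<Longrightarrow>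
    (\<And>A. pval A a \<Longrightarrow> pval A b \<Longrightarrow> pval A p) \<Longrightarrow> proves L \<Delta> p"
  by (rule proves_taut[where \<Gamma> = "{a, b}"]) auto

subsection \<open>Substitution\<close>

definition up :: "(nat \<Rightarrow> tm) \<Rightarrow> nat \<Rightarrow> tm" where
  "up \<sigma> = case_nat (Var 0) (\<lambda>x. tsubst (\<lambda>y. Var (Suc y)) (\<sigma> x))"

abbreviation shift :: "nat \<Rightarrow> tm \<Rightarrow> tm" where
  "shift k t \<equiv> tsubst (\<lambda>i. Var (i + k)) t"

lemma tsubst_tsubst [simp]: "tsubst \<sigma> (tsubst \<tau> t) = tsubst (\<lambda>x. tsubst \<sigma> (\<tau> x)) t"
  by (induction t) auto

lemma tsubst_Var [simp]: "tsubst Var t = t"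
  by (induction t) (auto simp: map_idI)

lemma up_comp: "(\<lambda>x. tsubst (up \<sigma>) (up \<tau> x)) = up (\<lambda>x. tsubst \<sigma> (\<tau> x))"
  by (auto simp: up_def fun_eq_iff split: nat.split)

lemma up_Var [simp]: "up Var = Var"
  by (auto simp: up_def fun_eq_iff split: nat.split)

lemma subst_Forall: "subst \<sigma> (Forall p) = Forall (subst (up \<sigma>) p)"
  by (simp add: up_def)

lemma subst_subst: "subst \<sigma> (subst \<tau> p) = subst (\<lambda>x. tsubst \<sigma> (\<tau> x)) p"
  by (induction p arbitrary: \<sigma> \<tau>) (simp_all add: subst_Forall up_comp del: subst.simps(5))

lemma subst_Var [simp]: "subst Var p = p"
  by (induction p) (auto simp: subst_Forall map_idI simp del: subst.simps(5))

text \<open>Under \<open>AllI\<close> the hypotheses are lifted; instantiating a lifted universal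
  hypothesis with \<open>Var 0\<close> recovers its body.\<close>

lemma inst_up_Var: "inst (subst (up (\<lambda>x. Var (Suc x))) p) (Var 0) = p"
proof -
  have "(\<lambda>x. tsubst (case_nat (Var 0) Var) (up (\<lambda>x. Var (Suc x)) x)) = Var"
    by (auto simp: up_def fun_eq_iff split: nat.split)
  then show ?thesis by (simp add: inst_def subst_subst)
qed

lemma proves_Forall_mono:
  assumes "proves L {} (Imp p q)" "is_formula L p"
  shows "proves L {} (Imp (Forall p) (Forall q))"
proof (rule ImpI, simp add: assms, rule AllI)
  have "proves L (lift ` {Forall p}) (inst (subst (up (\<lambda>x. Var (Suc x))) p) (Var 0))"
    by (rule AllE[OF is_term_Var], rule Assm) (simp add: lift_def subst_Forall del: subst.simps(5))
  then have "proves L (lift ` {Forall p}) p" by (simp only: inst_up_Var)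
  moreover have "proves L (lift ` {Forall p}) (Imp p q)" using assms(1) by (rule proves_weaken) simp
  ultimately show "proves L (lift ` {Forall p}) q" using ImpE by blast
qed

lemma proves_gen: "proves L {} p \<Longrightarrow> proves L {} (Forall p)"
  by (rule AllI) simp

lemma proves_Foralls: "proves L {} p \<Longrightarrow> proves L {} (Foralls n p)"
  unfolding Foralls_def by (induction n) (auto intro: proves_gen)

lemma proves_Exists_elim:
  assumes "proves L {} (Imp p (lift r))" "is_formula L p" "is_formula L r" "is_formula L (lift r)"
  shows "proves L {} (Imp (Exists p) r)"
proof (rule ImpI)
  have "proves L {Neg r} (Forall (Neg p))"
  proof (rule AllI)
    have "proves L (lift ` {Neg r}) (Imp p (lift r))" using assms(1) by (rule proves_weaken) simp
    moreover have "proves L (lift ` {Neg r}) (Neg (lift r))" by (rule Assm) (simp add: lift_def)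
    ultimately show "proves L (lift ` {Neg r}) (Neg p)"
      by (rule proves_taut2) (use assms in auto)
  qed
  then have "proves L (insert (Neg r) {Exists p}) (Forall (Neg p))" by (rule proves_weaken) simp
  moreover have "proves L (insert (Neg r) {Exists p}) (Exists p)" by (rule Assm) simp
  ultimately have "proves L (insert (Neg r) {Exists p}) Bot" by (rule ImpE[rotated])
  with assms(3) show "proves L {Exists p} r" by (rule Raa)
qed (use assms in simp)

lemma proves_Exists_intro:
  assumes "proves L \<Gamma> (inst p t)" "is_term L t" "is_formula L p" "is_formula L (inst p t)"
  shows "proves L \<Gamma> (Exists p)"
proof (rule ImpI)
  have "proves L (insert (Forall (Neg p)) \<Gamma>) (inst (Neg p) t)"
    by (rule AllE[OF assms(2)], rule Assm) simp
  moreover have "proves L (insert (Forall (Neg p)) \<Gamma>) (inst p t)" using assms(1) by (rule proves_weaken) blast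
  ultimately show "proves L (insert (Forall (Neg p)) \<Gamma>) Bot" by (auto simp: inst_def intro: ImpE)
qed (use assms in simp)

subsection \<open>Equality\<close>

lemma inst_shifted [simp]:
  "inst (Eq s' t') u = Eq (tsubst (case_nat u Var) s') (tsubst (case_nat u Var) t')"
  "inst (Rel r ts') u = Rel r (map (tsubst (case_nat u Var)) ts')"
  by (simp_all add: inst_def)

lemma is_term_shift [simp]: "is_term L t \<Longrightarrow> is_term L (shift k t)"
proof -
  have "wft L n t \<Longrightarrow> wft L (n + k) (shift k t)" for n
    by (induction t) (auto simp: list_all_iff)
  then show "is_term L t \<Longrightarrow> is_term L (shift k t)" unfolding is_term_def by blast
qed

declare is_term_shift [of _ _ 1, simplified, simp]

lemma proves_Eq_sym:
  assumes "proves L \<Gamma> (Eq s t)" "is_term L s" shows "proves L \<Gamma> (Eq t s)"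
proof -
  have "proves L \<Gamma> (inst (Eq (Var 0) (shift 1 s)) t)"
    using assms by (intro EqSubst[OF _ assms(1)]) (auto intro: EqRefl)
  then show ?thesis by simp
qed

lemma proves_Eq_trans:
  assumes "proves L \<Gamma> (Eq s t)" "proves L \<Gamma> (Eq t u)" "is_term L s" shows "proves L \<Gamma> (Eq s u)"
proof -
  have "proves L \<Gamma> (inst (Eq (shift 1 s) (Var 0)) u)"
    using assms by (intro EqSubst[OF _ assms(2)]) auto
  then show ?thesis by simp
qed

lemma is_term_Fn: "is_term L (Fn f ts) \<longleftrightarrow> f < length (funs L) \<and> length ts = funs L ! f \<and> (\<forall>t\<in>set ts. is_term L t)"
proof -
  have "\<exists>n. list_all (wft L n) ts" if "\<forall>t\<in>set ts. is_term L t"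
    using that
  proof (induction ts)
    case (Cons t ts)
    then obtain n m where "list_all (wft L n) ts" "wft L m t" by (auto simp: is_term_def)
    then have "list_all (wft L (max n m)) (t # ts)"
      using wft_mono[of L n _ "max n m"] wft_mono[of L m t "max n m"] by (auto simp: list_all_iff)
    then show ?case by blast
  qed simp
  then show ?thesis unfolding is_term_def by (auto simp: list_all_iff)
qed

lemma is_formula_Rel: "is_formula L (Rel r ts) \<longleftrightarrow> r < length (rels L) \<and> length ts = rels L ! r \<and> (\<forall>t\<in>set ts. is_term L t)"
proof -
  have "\<exists>n. list_all (wft L n) ts" if "\<forall>t\<in>set ts. is_term L t"
    using that
  proof (induction ts)
    case (Cons t ts)
    then obtain n m where "list_all (wft L n) ts" "wft L m t" by (auto simp: is_term_def)
    then have "list_all (wft L (max n m)) (t # ts)"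
      using wft_mono[of L n _ "max n m"] wft_mono[of L m t "max n m"] by (auto simp: list_all_iff)
    then show ?case by blast
  qed simp
  then show ?thesis unfolding is_formula_def is_term_def by (auto simp: list_all_iff)
qed

text \<open>\<open>EqSubst\<close> replaces one argument at a time; \<open>us\<close> collects the
  arguments that have been replaced.\<close>

lemma proves_Rel_cong:
  assumes "proves L \<Gamma> (Rel r (us @ ss))" "length ss = length ts"
    "\<And>i. i < length ss \<Longrightarrow> proves L \<Gamma> (Eq (ss ! i) (ts ! i))"
    "is_formula L (Rel r (us @ ss))" "\<forall>t\<in>set ts. is_term L t"
  shows "proves L \<Gamma> (Rel r (us @ ts))"
  using assms
proof (induction ss arbitrary: us ts)
  case (Cons s ss)
  then obtain t ts' where ts: "ts = t # ts'" by (cases ts) auto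
  have "proves L \<Gamma> (inst (Rel r (map (shift 1) us @ Var 0 # map (shift 1) ss)) t)"
  proof (rule EqSubst[of L _ \<Gamma> s])
    show "proves L \<Gamma> (Eq s t)" using Cons.prems(3)[of 0] by (simp add: ts)
  qed (use Cons.prems in \<open>auto simp: is_formula_Rel o_def\<close>)
  then have "proves L \<Gamma> (Rel r ((us @ [t]) @ ss))" by (simp add: o_def)
  then have "proves L \<Gamma> (Rel r ((us @ [t]) @ ts'))"
  proof (rule Cons.IH)
    show "proves L \<Gamma> (Eq (ss ! i) (ts' ! i))" if "i < length ss" for i
      using Cons.prems(3)[of "Suc i"] that by (simp add: ts)
  qed (use Cons.prems ts in \<open>auto simp: is_formula_Rel\<close>)
  then show ?case by (simp add: ts)
qed simp

lemma proves_Fn_cong: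
  assumes "length ss = length ts" "\<And>i. i < length ss \<Longrightarrow> proves L \<Gamma> (Eq (ss ! i) (ts ! i))"
    "is_term L (Fn f ss)" "\<forall>t\<in>set ts. is_term L t"
  shows "proves L \<Gamma> (Eq (Fn f ss) (Fn f ts))"
proof -
  have "proves L \<Gamma> (Eq u (Fn f (us @ ts)))"
    if "proves L \<Gamma> (Eq u (Fn f (us @ ss)))" "length ss = length ts"
      "\<And>i. i < length ss \<Longrightarrow> proves L \<Gamma> (Eq (ss ! i) (ts ! i))"
      "is_term L u" "is_term L (Fn f (us @ ss))" "\<forall>t\<in>set ts. is_term L t" for u us
    using that
  proof (induction ss arbitrary: us ts)
    case (Cons s ss)
    then obtain t ts' where ts: "ts = t # ts'" by (cases ts) auto
    have "proves L \<Gamma> (inst (Eq (shift 1 u) (Fn f (map (shift 1) us @ Var 0 # map (shift 1) ss))) t)"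
    proof (rule EqSubst[of L _ \<Gamma> s])
      show "proves L \<Gamma> (Eq s t)" using Cons.prems(3)[of 0] by (simp add: ts)
    qed (use Cons.prems in \<open>auto simp: is_term_Fn o_def\<close>)
    then have "proves L \<Gamma> (Eq u (Fn f ((us @ [t]) @ ss)))" by (simp add: o_def)
    then have "proves L \<Gamma> (Eq u (Fn f ((us @ [t]) @ ts')))"
    proof (rule Cons.IH)
      show "proves L \<Gamma> (Eq (ss ! i) (ts' ! i))" if "i < length ss" for i
        using Cons.prems(3)[of "Suc i"] that by (simp add: ts)
    qed (use Cons.prems ts in \<open>auto simp: is_term_Fn\<close>)
    then show ?case by (simp add: ts)
  qed simp
  from this[of "Fn f ss" "[]"] assms show ?thesis by (auto intro: EqRefl)
qed

section \<open>Soundness, and interpreting extensions along the reduct\<close>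

lemma sat_lift: "sat b (case_nat a e) (lift p) \<longleftrightarrow> sat b e p"
  unfolding lift_def sat_subst by simp

lemma sat_inst: "sat b e (inst p t) \<longleftrightarrow> sat b (case_nat (tmval e (tm_code t)) e) p"
proof -
  have "(\<lambda>i. tmval e (tm_code (case_nat t Var i))) = case_nat (tmval e (tm_code t)) e"
    by (auto simp: fun_eq_iff split: nat.split)
  then show ?thesis unfolding inst_def sat_subst by simp
qed

text \<open>That all function terms denote 0 is compatible with substitution, so the structures are
  models of the calculus for every signature \<open>L\<close>.\<close>

lemma proves_sound: "proves L \<Gamma> p \<Longrightarrow> (\<And>g. g \<in> \<Gamma> \<Longrightarrow> sat b e g) \<Longrightarrow> sat b e p"
proof (induction arbitrary: e rule: proves.induct)
  case (AllI \<Gamma> p)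
  have "sat b (case_nat a e) p" for a
    by (rule AllI.IH) (use AllI.prems sat_lift in auto)
  then show ?case by simp
next
  case (ImpI p \<Gamma> q)
  show ?case unfolding sat_simps
  proof
    assume "sat b e p"
    then show "sat b e q" by (intro ImpI.IH) (use ImpI.prems in auto)
  qed
next
  case (Raa p \<Gamma>)
  have "\<not> sat b e (Neg p) \<Longrightarrow> sat b e p" by simp
  moreover have "sat b e (Neg p) \<Longrightarrow> sat b e Bot" by (intro Raa.IH) (use Raa.prems in auto)
  ultimately show ?case by auto
next
  case (ImpE \<Gamma> p q)
  have "sat b e (Imp p q)" "sat b e p" by (intro ImpE.IH ImpE.prems; assumption)+
  then show ?case by simp
next
  case (AllE t \<Gamma> p)
  have "sat b e (Forall p)" by (intro AllE.IH AllE.prems)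
  then show ?case unfolding sat_inst by simp
next
  case (EqSubst p \<Gamma> s t)
  have "sat b e (Eq s t)" "sat b e (inst p s)" by (intro EqSubst.IH EqSubst.prems; assumption)+
  then show ?case unfolding sat_inst by simp
qed simp_all

lemma star_subst: "star (subst \<sigma> p) = subst \<sigma> (star p)"
proof (induction p arbitrary: \<sigma>)
  case (Rel r ts)
  show ?case by (cases r; cases ts) (auto split: nat.split list.split)
qed (simp_all add: subst_Forall del: subst.simps(5))

lemma is_term_ext_sig [simp]: "is_term (ext_sig L) t \<longleftrightarrow> is_term L t"
  by (simp add: is_term_def)

lemma is_formula_star: "is_formula (ext_sig L) p \<Longrightarrow> is_formula L (star p)"
  unfolding is_formula_def using wff_star by blast

text \<open>No rule of the calculus refers to a particular relation symbol, so replacing atoms by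
  formulas in a way that commutes with substitution takes derivations to derivations.\<close>

lemma proves_star: "proves (ext_sig L) \<Gamma> p \<Longrightarrow> proves L (star ` \<Gamma>) (star p)"
proof (induction rule: proves.induct)
  case (AllI \<Gamma> p)
  have "star ` lift ` \<Gamma> = lift ` star ` \<Gamma>"
    unfolding image_image by (rule image_cong) (auto simp: lift_def star_subst)
  with AllI.IH show ?case by (simp add: proves.AllI)
next
  case (AllE t \<Gamma> p)
  then show ?case using proves.AllE[of L t "star ` \<Gamma>" "star p"] by (simp add: inst_def star_subst)
next
  case (EqSubst p \<Gamma> s t)
  then show ?case using proves.EqSubst[of L "star p" "star ` \<Gamma>" s t] is_formula_star
    by (simp add: inst_def star_subst)
next
  case (ImpI p \<Gamma> q)
  then show ?case using is_formula_star by (simp add: proves.ImpI)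
next
  case (Raa p \<Gamma>)
  then show ?case using is_formula_star proves.Raa[of L "star p" "star ` \<Gamma>"] by simp
next
  case (ImpE \<Gamma> p q)
  then show ?case using proves.ImpE[of L "star ` \<Gamma>" "star p" "star q"] by simp
next
  case (EqRefl t \<Gamma>)
  then show ?case by (simp add: proves.EqRefl)
qed (simp add: proves.Assm)

subsection \<open>Provable equivalence\<close>

definition equivalent :: "signature \<Rightarrow> fm \<Rightarrow> fm \<Rightarrow> bool" where
  "equivalent L p q \<longleftrightarrow> is_formula L p \<and> is_formula L q \<and> proves L {} (Imp p q) \<and> proves L {} (Imp q p)"

lemma equivalent_refl: "is_formula L p \<Longrightarrow> equivalent L p p"
  unfolding equivalent_def by (auto intro: proves_taut0)

lemma proves_Imp_trans:
  assumes "proves L {} (Imp p q)" "proves L {} (Imp q r)" "is_formula L p" "is_formula L q" "is_formula L r"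
  shows "proves L {} (Imp p r)"
  by (rule proves_taut2[OF assms(1,2)]) (use assms in auto)

lemma equivalent_trans: "equivalent L p q \<Longrightarrow> equivalent L q r \<Longrightarrow> equivalent L p r"
  unfolding equivalent_def by (meson proves_Imp_trans)

lemma equivalent_Imp:
  assumes "equivalent L p p'" "equivalent L q q'" shows "equivalent L (Imp p q) (Imp p' q')"
proof -
  have "proves L {} (Imp (Imp p q) (Imp p' q'))"
    by (rule proves_taut2[of _ _ "Imp p' p" "Imp q q'"]) (use assms in \<open>auto simp: equivalent_def\<close>)
  moreover have "proves L {} (Imp (Imp p' q') (Imp p q))"
    by (rule proves_taut2[of _ _ "Imp p p'" "Imp q' q"]) (use assms in \<open>auto simp: equivalent_def\<close>)
  ultimately show ?thesis using assms by (simp add: equivalent_def)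
qed

lemma equivalent_Forall: "equivalent L p q \<Longrightarrow> equivalent L (Forall p) (Forall q)"
  unfolding equivalent_def by (simp add: proves_Forall_mono)

lemma equivalent_relativised: 
  assumes "is_formula L p" shows "equivalent L (Imp Top p) p"
  unfolding equivalent_def using assms by (auto intro!: proves_taut0)

lemma equivalent_And: "equivalent L p p' \<Longrightarrow> equivalent L q q' \<Longrightarrow> equivalent L (And p q) (And p' q')"
  by (intro equivalent_Imp equivalent_refl) simp_all

lemma is_formula_conjs [simp]: "is_formula L (conjs ps) \<longleftrightarrow> (\<forall>p\<in>set ps. is_formula L p)"
  by (induction ps) (auto simp: conjs_def)

lemma pval_conjs [simp]: "pval A (conjs ps) \<longleftrightarrow> (\<forall>p\<in>set ps. pval A p)"
  by (induction ps) (auto simp: conjs_def)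

lemma equivalent_conjs:
  "(\<And>i. i < m \<Longrightarrow> equivalent L (f i) (g i)) \<Longrightarrow> equivalent L (conjs (map f [0..<m])) (conjs (map g [0..<m]))"
proof -
  have *: "(\<And>x. x \<in> set xs \<Longrightarrow> equivalent L (f x) (g x)) \<Longrightarrow> equivalent L (conjs (map f xs)) (conjs (map g xs))" for xs
  proof (induction xs)
    case Nil
    show ?case by (simp add: conjs_def equivalent_refl)
  next
    case (Cons x xs)
    then have "equivalent L (And (f x) (conjs (map f xs))) (And (g x) (conjs (map g xs)))"
      by (intro equivalent_And) auto
    then show ?case by (simp add: conjs_def)
  qed
  show "(\<And>i. i < m \<Longrightarrow> equivalent L (f i) (g i)) \<Longrightarrow> ?thesis" by (rule *) simp
qed

lemma proves_conjs:
  assumes "\<And>p. p \<in> set ps \<Longrightarrow> is_formula L p \<and> proves L \<Gamma> p" shows "proves L \<Gamma> (conjs ps)"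
  by (rule proves_taut[where \<Gamma> = "set ps"]) (use assms in auto)

lemma is_term_subst: "(\<And>i. is_term L (\<sigma> i)) \<Longrightarrow> is_term L t \<Longrightarrow> is_term L (tsubst \<sigma> t)"
  by (induction t) (auto simp: is_term_Fn)

lemma is_formula_subst: "(\<And>i. is_term L (\<sigma> i)) \<Longrightarrow> is_formula L p \<Longrightarrow> is_formula L (subst \<sigma> p)"
proof (induction p arbitrary: \<sigma>)
  case (Forall p)
  have "is_term L (up \<sigma> i)" for i
    using Forall.prems(1) by (auto simp: up_def split: nat.split)
  with Forall show ?case by (simp add: subst_Forall del: subst.simps(5))
qed (auto simp: is_formula_Rel is_term_subst)

subsection \<open>One-point rule for blocks of quantifiers\<close>

text \<open>Blocks are unrelativised here: the domain formula is \<open>Top\<close>.\<close>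

lemma is_formula_ex_dom [simp]: "tr_dom I = Top \<Longrightarrow> is_formula L (ex_dom I m p) \<longleftrightarrow> is_formula L p"
  by (induction m) auto

definition upn :: "nat \<Rightarrow> (nat \<Rightarrow> tm) \<Rightarrow> nat \<Rightarrow> tm" where
  "upn m \<sigma> i = (if i < m then Var i else shift m (\<sigma> (i - m)))"

lemma upn_up: "upn m (up \<sigma>) = upn (Suc m) \<sigma>"
proof
  fix i
  consider "i < m" | "i = m" | j where "i = Suc (m + j)" by (metis less_iff_Suc_add linorder_neqE_nat)
  then show "upn m (up \<sigma>) i = upn (Suc m) \<sigma> i"
    by cases (auto simp: upn_def up_def)
qed

lemma subst_ex_dom: "tr_dom I = Top \<Longrightarrow> subst \<sigma> (ex_dom I m p) = ex_dom I m (subst (upn m \<sigma>) p)"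
proof (induction m arbitrary: \<sigma>)
  case 0
  have "upn 0 \<sigma> = \<sigma>" by (auto simp: upn_def fun_eq_iff)
  then show ?case by simp
next
  case (Suc m)
  then show ?case by (simp add: subst_Forall upn_up del: subst.simps(5))
qed

lemma equivalent_Exists: "equivalent L p q \<Longrightarrow> equivalent L (Exists p) (Exists q)"
  by (intro equivalent_Imp equivalent_Forall equivalent_refl) simp_all

lemma equivalent_ex_dom:
  "tr_dom I = Top \<Longrightarrow> equivalent L p q \<Longrightarrow> equivalent L (ex_dom I m p) (ex_dom I m q)"
proof (induction m)
  case (Suc m)
  then show ?case unfolding ex_dom.simps by (intro equivalent_Exists equivalent_And equivalent_refl) simp_all
qed simp

lemma proves_ex_dom_elim:
  assumes "tr_dom I = Top" "is_formula L p"
  shows "is_formula L r \<Longrightarrow> proves L {} (Imp p (subst (\<lambda>i. Var (i + m)) r)) \<Longrightarrow> proves L {} (Imp (ex_dom I m p) r)"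
proof (induction m arbitrary: r)
  case 0
  then show ?case by simp
next
  case (Suc m)
  have r: "is_formula L (lift r)" unfolding lift_def using Suc.prems(1) by (rule is_formula_subst[rotated]) simp
  have "subst (\<lambda>i. Var (i + m)) (lift r) = subst (\<lambda>i. Var (i + Suc m)) r"
    by (simp add: lift_def subst_subst)
  with Suc.IH[OF r] Suc.prems(2) have "proves L {} (Imp (ex_dom I m p) (lift r))" by simp
  then have "proves L {} (Imp (And Top (ex_dom I m p)) (lift r))"
    by (rule proves_taut1) (use assms r in auto)
  then show ?case unfolding ex_dom.simps assms(1)
    by (rule proves_Exists_elim) (use assms r Suc.prems in auto)
qed

definition args_subst :: "tm list \<Rightarrow> nat \<Rightarrow> tm" where
  "args_subst ts i = (if i < length ts then ts ! i else Var (i - length ts))"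

lemma is_term_args_subst: "\<forall>t\<in>set ts. is_term L t \<Longrightarrow> is_term L (args_subst ts i)"
  by (simp add: args_subst_def)

lemma proves_ex_dom_intro:
  assumes "tr_dom I = Top"
  shows "\<forall>t\<in>set ts. is_term L t \<Longrightarrow> is_formula L p \<Longrightarrow> proves L \<Gamma> (subst (args_subst ts) p) \<Longrightarrow>
    proves L \<Gamma> (ex_dom I (length ts) p)"
proof (induction ts arbitrary: p rule: rev_induct)
  case Nil
  have "args_subst [] = Var" by (auto simp: args_subst_def fun_eq_iff)
  with Nil show ?case by simp
next
  case (snoc t ts)
  let ?m = "length ts"
  let ?q = "subst (upn ?m (case_nat t Var)) p"
  have terms: "is_term L (upn ?m (case_nat t Var) i)" "is_term L (case_nat t Var i)" for i
    using snoc.prems(1) by (auto simp: upn_def split: nat.split)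
  have q: "is_formula L ?q" using terms(1) snoc.prems(2) by (rule is_formula_subst)
  have inst: "inst (And Top (ex_dom I ?m p)) t = And Top (ex_dom I ?m ?q)"
    using subst_ex_dom[OF assms] by (simp add: inst_def)
  have "(\<lambda>i. tsubst (args_subst ts) (upn ?m (case_nat t Var) i)) = args_subst (ts @ [t])"
  proof
    fix i
    have *: "tsubst (args_subst ts) (shift ?m u) = u" for u
      by (simp add: args_subst_def)
    consider "i < ?m" | "i = ?m" | j where "i = Suc (?m + j)" by (metis less_iff_Suc_add linorder_neqE_nat)
    then show "tsubst (args_subst ts) (upn ?m (case_nat t Var) i) = args_subst (ts @ [t]) i"
      by cases (auto simp: upn_def args_subst_def nth_append)
  qed
  then have "subst (args_subst ts) ?q = subst (args_subst (ts @ [t])) p" by (simp add: subst_subst)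
  with snoc.prems q have "proves L \<Gamma> (ex_dom I ?m ?q)" by (intro snoc.IH) auto
  then have "proves L \<Gamma> (inst (And Top (ex_dom I ?m p)) t)" unfolding inst
    by (rule proves_taut1) (use assms q in auto)
  then have "proves L \<Gamma> (Exists (And Top (ex_dom I ?m p)))"
    by (rule proves_Exists_intro) (use snoc.prems assms q inst in auto)
  then show ?case by (simp add: assms)
qed

text \<open>The terms themselves witness the block in one direction; in the other, the equations
  allow the variables to be replaced in \<open>q\<close>. That replacement is left to the hypothesis
  \<open>cong\<close>, since \<open>q\<close> is an equation in some uses and a relational atom in
  others.\<close>

lemma one_point:
  assumes I: "tr_dom I = Top" and ts: "\<forall>t\<in>set ts. is_term L t" and q: "is_formula L q"
    and E: "\<And>i. i < length ts \<Longrightarrow> equivalent L (E i) (Eq (shift (length ts) (ts ! i)) (Var i))"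
    and cong: "\<And>\<Gamma>. proves L \<Gamma> q \<Longrightarrow>
      (\<And>i. i < length ts \<Longrightarrow> proves L \<Gamma> (Eq (Var i) (shift (length ts) (ts ! i)))) \<Longrightarrow>
      proves L \<Gamma> (subst (\<lambda>i. Var (i + length ts)) (subst (args_subst ts) q))"
  shows "equivalent L (ex_dom I (length ts) (And (conjs (map E [0..<length ts])) q)) (subst (args_subst ts) q)"
proof -
  let ?m = "length ts"
  let ?eqs = "conjs (map (\<lambda>i. Eq (shift ?m (ts ! i)) (Var i)) [0..<?m])"
  have terms: "is_term L (ts ! i)" if "i < ?m" for i using ts that by simp
  have eqs: "is_formula L ?eqs" using terms by auto
  have sq: "is_formula L (subst (args_subst ts) q)"
    by (rule is_formula_subst[OF is_term_args_subst[OF ts] q])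
  have "equivalent L (And (conjs (map E [0..<?m])) q) (And ?eqs q)"
    using equivalent_conjs[of ?m L E, OF E] q by (intro equivalent_And equivalent_refl)
  then have "equivalent L (ex_dom I ?m (And (conjs (map E [0..<?m])) q)) (ex_dom I ?m (And ?eqs q))"
    by (rule equivalent_ex_dom[OF I])
  moreover have "equivalent L (ex_dom I ?m (And ?eqs q)) (subst (args_subst ts) q)"
    unfolding equivalent_def
  proof (intro conjI)
    show "is_formula L (ex_dom I ?m (And ?eqs q))" using I eqs q by simp
    show "is_formula L (subst (args_subst ts) q)" by (rule sq)
    show "proves L {} (Imp (ex_dom I ?m (And ?eqs q)) (subst (args_subst ts) q))"
    proof (rule proves_ex_dom_elim[OF I _ sq], use eqs q in simp, rule ImpI, use eqs q in simp)
      let ?G = "{And ?eqs q}"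
      have G: "proves L ?G (And ?eqs q)" by (rule Assm) simp
      have form: "is_formula L (And ?eqs q)" using eqs q by simp
      show "proves L ?G (subst (\<lambda>i. Var (i + ?m)) (subst (args_subst ts) q))"
      proof (rule cong)
        show "proves L ?G q" by (rule proves_taut1[OF G form q]) simp
        fix i assume i: "i < ?m"
        have "proves L ?G (Eq (shift ?m (ts ! i)) (Var i))"
          by (rule proves_taut1[OF G form]) (use i terms in auto)
        then show "proves L ?G (Eq (Var i) (shift ?m (ts ! i)))"
          by (rule proves_Eq_sym) (use terms i in auto)
      qed
    qed
    show "proves L {} (Imp (subst (args_subst ts) q) (ex_dom I ?m (And ?eqs q)))"
    proof (rule ImpI[OF sq], rule proves_ex_dom_intro[OF I ts])
      let ?G = "{subst (args_subst ts) q}"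
      show "is_formula L (And ?eqs q)" using eqs q by simp
      have cs: "subst \<sigma> (conjs ps) = conjs (map (subst \<sigma>) ps)" for \<sigma> ps
        by (induction ps) (auto simp: conjs_def)
      have "subst (args_subst ts) ?eqs = conjs (map (\<lambda>i. Eq (ts ! i) (ts ! i)) [0..<?m])"
        unfolding cs by (rule arg_cong[of _ _ conjs]) (auto simp: args_subst_def)
      moreover have "proves L ?G (conjs (map (\<lambda>i. Eq (ts ! i) (ts ! i)) [0..<?m]))"
        by (rule proves_conjs) (use terms in \<open>auto intro: EqRefl\<close>)
      ultimately have 1: "proves L ?G (subst (args_subst ts) ?eqs)" by simp
      have 2: "proves L ?G (subst (args_subst ts) q)" by (rule Assm) simp
      show "proves L ?G (subst (args_subst ts) (And ?eqs q))" unfolding subst.simps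
        by (rule proves_taut2[OF 1 2])
          (use sq is_formula_subst[OF is_term_args_subst[OF ts] eqs] in auto)
    qed
  qed
  ultimately show ?thesis by (rule equivalent_trans)
qed

subsection \<open>The interpretation along the reduct\<close>

text \<open>The identity on the old symbols, with a function symbol given by its graph; the
  proposition letter becomes true and the binary symbol becomes equality.\<close>

definition star_translation :: "signature \<Rightarrow> translation" where
  "star_translation L = Translation Top (Eq (Var 0) (Var 1))
     (\<lambda>r. case r of 0 \<Rightarrow> Top | Suc k \<Rightarrow> (case k of
        0 \<Rightarrow> Eq (Var 0) (Var 1) | Suc r \<Rightarrow> Rel r (map Var [0..<rels L ! r])))
     (\<lambda>f. Eq (Fn f (map Var [0..<funs L ! f])) (Var (funs L ! f)))"

lemma star_translation_simps [simp]:
  "tr_dom (star_translation L) = Top"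
  "tr_eq (star_translation L) = Eq (Var 0) (Var 1)"
  "tr_rel (star_translation L) 0 = Top"
  "tr_rel (star_translation L) (Suc 0) = Eq (Var 0) (Var 1)"
  "tr_rel (star_translation L) (Suc (Suc r)) = Rel r (map Var [0..<rels L ! r])"
  "tr_fun (star_translation L) f = Eq (Fn f (map Var [0..<funs L ! f])) (Var (funs L ! f))"
  by (simp_all add: star_translation_def)

lemma map_args_subst: "map (\<lambda>i. args_subst ts i) [0..<length ts] = ts"
  by (rule nth_equalityI) (auto simp: args_subst_def)

lemma tr_args_map: "tr_args (map f ts) k = conjs (map (\<lambda>i. f (ts ! i) k i) [0..<length ts])"
  unfolding tr_args_def by (intro arg_cong[of _ _ conjs] map_cong) simp_all

lemma equivalent_tr_val:
  "is_term L t \<Longrightarrow> equivalent L (tr_val (star_translation L) t k y) (Eq (shift k t) (Var y))"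
proof (induction t arbitrary: k y)
  case (Var x)
  then show ?case by (simp add: at_vars_def equivalent_refl)
next
  case (Fn f ts)
  let ?I = "star_translation L" and ?m = "length ts" and ?ts = "map (shift k) ts"
  let ?q = "Eq (Fn f (map Var [0..<?m])) (Var (y + ?m))"
  have ts: "\<forall>t\<in>set ts. is_term L t" "f < length (funs L)" "?m = funs L ! f" using Fn.prems by (auto simp: is_term_Fn)
  have q: "is_formula L ?q" using ts by (auto simp: is_term_Fn)
  have "equivalent L (ex_dom ?I (length ?ts)
      (And (conjs (map (\<lambda>i. tr_val ?I (ts ! i) (k + ?m) i) [0..<length ?ts])) ?q)) (subst (args_subst ?ts) ?q)"
  proof (rule one_point)
    show "equivalent L (tr_val ?I (ts ! i) (k + ?m) i) (Eq (shift (length ?ts) (?ts ! i)) (Var i))"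
      if "i < length ?ts" for i
      using Fn.IH[of "ts ! i" "k + ?m" i] that ts by (simp add: add.assoc)
  next
    fix \<Gamma> assume q': "proves L \<Gamma> ?q"
      and eqs: "\<And>i. i < length ?ts \<Longrightarrow> proves L \<Gamma> (Eq (Var i) (shift (length ?ts) (?ts ! i)))"
    have "proves L \<Gamma> (Eq (Fn f (map Var [0..<?m])) (Fn f (map (shift (length ?ts)) ?ts)))"
      by (rule proves_Fn_cong) (use eqs q ts in \<open>auto simp: is_term_subst\<close>)
    then have "proves L \<Gamma> (Eq (Fn f (map (shift (length ?ts)) ?ts)) (Fn f (map Var [0..<?m])))"
      by (rule proves_Eq_sym) (use q in simp)
    then have "proves L \<Gamma> (Eq (Fn f (map (shift (length ?ts)) ?ts)) (Var (y + ?m)))"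
      by (rule proves_Eq_trans[OF _ q']) (use ts in \<open>auto simp: is_term_Fn is_term_subst\<close>)
    moreover have "map (\<lambda>i. shift ?m (args_subst ?ts i)) [0..<?m] = map (shift ?m) ?ts"
      by (rule nth_equalityI) (auto simp: args_subst_def)
    ultimately show "proves L \<Gamma> (subst (\<lambda>i. Var (i + length ?ts)) (subst (args_subst ?ts) ?q))"
      by (simp add: o_def args_subst_def[of _ "y + ?m"])
  qed (use ts q in auto)
  moreover have "subst (args_subst ?ts) ?q = Eq (shift k (Fn f ts)) (Var y)"
    using map_args_subst[of ?ts] by (simp add: o_def args_subst_def[of _ "y + ?m"])
  moreover have "at_vars (tr_fun ?I f) ([0..<?m] @ [y + ?m]) = ?q"
    using ts(3) by (simp add: at_vars_def nth_append cong: map_cong)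
  ultimately show ?case by (simp add: Let_def tr_args_map)
qed

lemma equivalent_block:
  assumes ts: "\<forall>t\<in>set ts. is_term L t" and q: "is_formula L q"
    and cong: "\<And>\<Gamma>. proves L \<Gamma> q \<Longrightarrow>
      (\<And>i. i < length ts \<Longrightarrow> proves L \<Gamma> (Eq (Var i) (shift (length ts) (ts ! i)))) \<Longrightarrow>
      proves L \<Gamma> (subst (\<lambda>i. Var (i + length ts)) (subst (args_subst ts) q))"
  shows "equivalent L (ex_dom (star_translation L) (length ts)
    (And (tr_args (map (tr_val (star_translation L)) ts) (length ts)) q)) (subst (args_subst ts) q)"
proof -
  let ?I = "star_translation L" and ?m = "length ts"
  have "equivalent L (ex_dom ?I ?m (And (conjs (map (\<lambda>i. tr_val ?I (ts ! i) ?m i) [0..<?m])) q))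
      (subst (args_subst ts) q)"
    by (rule one_point) (use ts q cong equivalent_tr_val in auto)
  then show ?thesis by (simp add: tr_args_map)
qed

lemma equivalent_block_Eq:
  assumes "is_term L s" "is_term L t"
  shows "equivalent L (ex_dom (star_translation L) 2
    (And (tr_args (map (tr_val (star_translation L)) [s, t]) 2) (Eq (Var 0) (Var 1)))) (Eq s t)"
proof -
  have "equivalent L (ex_dom (star_translation L) (length [s, t])
    (And (tr_args (map (tr_val (star_translation L)) [s, t]) (length [s, t])) (Eq (Var 0) (Var 1))))
    (subst (args_subst [s, t]) (Eq (Var 0) (Var 1)))"
  proof (rule equivalent_block)
    fix \<Gamma> assume q: "proves L \<Gamma> (Eq (Var 0) (Var 1))"
      and eqs: "\<And>i. i < length [s, t] \<Longrightarrow> proves L \<Gamma> (Eq (Var i) (shift (length [s, t]) ([s, t] ! i)))"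
    have "proves L \<Gamma> (Eq (shift 2 s) (Var 0))"
      using eqs[of 0] by (intro proves_Eq_sym[of L \<Gamma> "Var 0"]) (auto simp: numeral_2_eq_2)
    then have "proves L \<Gamma> (Eq (shift 2 s) (Var 1))"
      by (rule proves_Eq_trans[OF _ q]) (rule is_term_shift[OF assms(1)])
    moreover have "proves L \<Gamma> (Eq (Var 1) (shift 2 t))"
      using eqs[of 1] by (simp add: numeral_2_eq_2)
    ultimately have "proves L \<Gamma> (Eq (shift 2 s) (shift 2 t))"
      by (rule proves_Eq_trans) (rule is_term_shift[OF assms(1)])
    then show "proves L \<Gamma> (subst (\<lambda>i. Var (i + length [s, t])) (subst (args_subst [s, t]) (Eq (Var 0) (Var 1))))"
      by (simp add: args_subst_def numeral_2_eq_2)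
  qed (use assms in auto)
  then show ?thesis by (simp add: args_subst_def numeral_2_eq_2)
qed

text \<open>\<open>tr_fm\<close> unnests terms and relativises quantifiers to \<open>Top\<close>,
  while \<open>star\<close> does neither; the one-point rule undoes the unnesting, so the results
  agree up to provable equivalence.\<close>

lemma equivalent_star:
  "is_formula (ext_sig L) p \<Longrightarrow> equivalent L (tr_fm (star_translation L) p) (star p)"
proof (induction p)
  case Bot
  then show ?case by (simp add: equivalent_refl)
next
  case (Eq s t)
  have "at_vars (Eq (Var 0) (Var 1)) [0, 1] = Eq (Var 0) (Var 1)" by (simp add: at_vars_def)
  then show ?case using equivalent_block_Eq[of L s t] Eq by simp
next
  case (Rel r ts)
  from nat_cases3[of r] consider "r = 0" | "r = Suc 0" | k where "r = Suc (Suc k)" by blast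
  then show ?case
  proof cases
    case 1
    with Rel have "ts = []" unfolding is_formula_def using wff_ext_sig_Rel(1) by blast
    with 1 show ?thesis
      by (auto simp: at_vars_def tr_args_def equivalent_def conjs_def intro!: proves_taut0)
  next
    case 2
    with Rel obtain s t where ts: "ts = [s, t]" "is_term L s" "is_term L t"
      unfolding is_formula_def is_term_def using wff_ext_sig_Rel(2) by blast
    have "at_vars (Eq (Var 0) (Var 1)) [0..<2] = Eq (Var 0) (Var 1)" by (simp add: at_vars_def)
    then show ?thesis using equivalent_block_Eq[OF ts(2,3)] by (simp add: 2 ts(1) numeral_2_eq_2)
  next
    case 3
    with Rel have form: "is_formula L (Rel k ts)"
      unfolding is_formula_def using wff_ext_sig_Rel(3) by blast
    then have ts: "\<forall>t\<in>set ts. is_term L t" "k < length (rels L)" "length ts = rels L ! k"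
      by (auto simp: is_formula_Rel)
    let ?q = "Rel k (map Var [0..<length ts])"
    have "equivalent L (ex_dom (star_translation L) (length ts)
      (And (tr_args (map (tr_val (star_translation L)) ts) (length ts)) ?q)) (subst (args_subst ts) ?q)"
    proof (rule equivalent_block)
      fix \<Gamma> assume q: "proves L \<Gamma> ?q"
        and eqs: "\<And>i. i < length ts \<Longrightarrow> proves L \<Gamma> (Eq (Var i) (shift (length ts) (ts ! i)))"
      have "proves L \<Gamma> (Rel k ([] @ map (shift (length ts)) ts))"
        by (rule proves_Rel_cong[where ss = "map Var [0..<length ts]"])
          (use q eqs ts in \<open>auto simp: is_formula_Rel is_term_subst\<close>)
      moreover have "map (\<lambda>i. shift (length ts) (args_subst ts i)) [0..<length ts] = map (shift (length ts)) ts"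
        by (rule nth_equalityI) (auto simp: args_subst_def)
      ultimately show "proves L \<Gamma> (subst (\<lambda>i. Var (i + length ts)) (subst (args_subst ts) ?q))"
        by (simp add: o_def)
    qed (use ts in \<open>auto simp: is_formula_Rel\<close>)
    moreover have "subst (args_subst ts) ?q = Rel k ts" using map_args_subst[of ts] by (simp add: o_def)
    moreover have "at_vars (tr_rel (star_translation L) r) [0..<length ts] = ?q"
      using 3 ts(3) by (simp add: at_vars_def cong: map_cong)
    ultimately show ?thesis by (simp add: 3 Let_def)
  qed
next
  case (Imp p q)
  then show ?case by (simp add: equivalent_Imp)
next
  case (Forall p)
  then have IH: "equivalent L (tr_fm (star_translation L) p) (star p)" by simp
  then have "is_formula L (tr_fm (star_translation L) p)" by (simp add: equivalent_def)
  from equivalent_trans[OF equivalent_relativised[OF this] IH] show ?case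
    by (simp add: equivalent_Forall)
qed

subsection \<open>Well-formedness of translated sentences\<close>

lemma wft_subst: "wft L n t \<Longrightarrow> (\<And>i. i < n \<Longrightarrow> wft L m (\<sigma> i)) \<Longrightarrow> wft L m (tsubst \<sigma> t)"
  by (induction t) (auto simp: list_all_iff)

lemma wff_subst: "wff L n p \<Longrightarrow> (\<And>i. i < n \<Longrightarrow> wft L m (\<sigma> i)) \<Longrightarrow> wff L m (subst \<sigma> p)"
proof (induction p arbitrary: n m \<sigma>)
  case (Forall p)
  have "wft L (Suc m) (up \<sigma> i)" if "i < Suc n" for i
    using that Forall.prems(2) by (auto simp: up_def intro!: wft_subst[of L m] split: nat.split)
  with Forall show ?case by (auto simp: subst_Forall simp del: subst.simps(5))
qed (auto simp: list_all_iff intro: wft_subst)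

lemma wff_at_vars: "wff L n p \<Longrightarrow> n \<le> length xs \<Longrightarrow> \<forall>x\<in>set xs. x < m \<Longrightarrow> wff L m (at_vars p xs)"
  unfolding at_vars_def by (erule wff_subst) auto

lemma wff_conjs: "wff L n (conjs ps) \<longleftrightarrow> (\<forall>p\<in>set ps. wff L n p)"
  by (induction ps) (auto simp: conjs_def)

lemma wff_ex_dom:
  assumes "wff L 1 (tr_dom I)" shows "wff L (n + m) p \<Longrightarrow> wff L n (ex_dom I m p)"
proof (induction m arbitrary: n)
  case (Suc m)
  then show ?case using wff_mono[OF assms, of "Suc n"] by simp
qed simp

lemma wff_all_dom:
  assumes "wff L 1 (tr_dom I)" shows "wff L (n + m) p \<Longrightarrow> wff L n (all_dom I m p)"
proof (induction m arbitrary: n)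
  case (Suc m)
  then show ?case using wff_mono[OF assms, of "Suc n"] by simp
qed simp

lemma wff_tr_val:
  assumes "is_translation I L' L"
  shows "wft L' n t \<Longrightarrow> n + k \<le> N \<Longrightarrow> y < N \<Longrightarrow> wff L N (tr_val I t k y)"
proof (induction t arbitrary: k N y)
  case (Var x)
  have "wff L 2 (tr_eq I)" using assms by (simp add: is_translation_def)
  with Var show ?case by (auto intro!: wff_at_vars)
next
  case (Fn f ts)
  have "wff L (Suc (length ts)) (tr_fun I f)" "wff L 1 (tr_dom I)"
    using assms Fn.prems by (auto simp: is_translation_def)
  moreover from this(1) have "wff L (N + length ts) (at_vars (tr_fun I f) ([0..<length ts] @ [y + length ts]))"
    using Fn.prems by (auto intro!: wff_at_vars)
  moreover have "wff L (N + length ts) (tr_val I (ts ! i) (k + length ts) i)" if "i < length ts" for i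
    using Fn.IH[of "ts ! i" "k + length ts" "N + length ts" i] Fn.prems that by (auto simp: list_all_iff)
  ultimately show ?case by (auto simp: Let_def tr_args_def wff_conjs intro!: wff_ex_dom)
qed

lemma wff_tr_block:
  assumes "is_translation I L' L" "\<forall>t\<in>set ts. wft L' n t" "wff L (n + length ts) q"
  shows "wff L n (ex_dom I (length ts) (And (tr_args (map (tr_val I) ts) (length ts)) q))"
proof -
  have "wff L (n + length ts) (tr_val I (ts ! i) (length ts) i)" if "i < length ts" for i
    using wff_tr_val[OF assms(1), of n "ts ! i" "length ts" "n + length ts" i] assms that by simp
  moreover have "wff L 1 (tr_dom I)" using assms by (auto simp: is_translation_def)
  ultimately show ?thesis using assms(3) by (auto simp: tr_args_def wff_conjs intro!: wff_ex_dom)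
qed

lemma wff_tr_fm:
  assumes "is_translation I L' L"
  shows "wff L' n p \<Longrightarrow> wff L n (tr_fm I p)"
proof (induction p arbitrary: n)
  case (Eq s t)
  have "wff L 2 (tr_eq I)" using assms by (simp add: is_translation_def)
  then have "wff L (n + length [s, t]) (at_vars (tr_eq I) [0, 1])" by (auto intro!: wff_at_vars)
  from wff_tr_block[OF assms _ this] Eq show ?case by (simp add: numeral_2_eq_2)
next
  case (Rel r ts)
  have "wff L (length ts) (tr_rel I r)" using assms Rel by (simp add: is_translation_def)
  then have "wff L (n + length ts) (at_vars (tr_rel I r) [0..<length ts])" by (auto intro!: wff_at_vars)
  from wff_tr_block[OF assms _ this] Rel show ?case by (simp add: list_all_iff Let_def)
next
  case (Forall p)
  have "wff L 1 (tr_dom I)" using assms by (simp add: is_translation_def)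
  from wff_mono[OF this, of "Suc n"] Forall show ?case by simp
qed auto

lemma is_translation_star: "is_translation (star_translation L) (ext_sig L) L"
proof -
  have "wff L ((0 # 2 # rels L) ! r) (tr_rel (star_translation L) r)" if "r < length (rels L) + 2" for r
    using nat_cases3[of r] that by (auto simp: list_all_iff)
  then show ?thesis by (auto simp: is_translation_def ext_sig_def list_all_iff)
qed

lemma fun_total_star:
  assumes "f < length (funs L)"
  shows "proves L {} (fun_total (star_translation L) f (funs L ! f))"
    "wff L 0 (fun_total (star_translation L) f (funs L ! f))"
proof -
  let ?I = "star_translation L" and ?k = "funs L ! f"
  have at: "at_vars (tr_fun ?I f) ([1..<Suc ?k] @ [0]) = Eq (Fn f (map Var [1..<Suc ?k])) (Var 0)"
    by (auto simp: at_vars_def nth_append intro!: nth_equalityI)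
  have "map (args_subst [Fn f (map Var [0..<?k])]) [1..<Suc ?k] = map Var [0..<?k]"
    by (rule nth_equalityI) (auto simp: args_subst_def simp del: upt_Suc)
  then have "subst (args_subst [Fn f (map Var [0..<?k])]) (Eq (Fn f (map Var [1..<Suc ?k])) (Var 0)) =
      Eq (Fn f (map Var [0..<?k])) (Fn f (map Var [0..<?k]))"
    by (simp add: o_def args_subst_def[of _ 0] del: upt_Suc)
  \<comment> \<open>The term that applies the function symbol to its arguments is the witness for
    totality.\<close>
  then have "proves L {} (ex_dom ?I (length [Fn f (map Var [0..<?k])]) (Eq (Fn f (map Var [1..<Suc ?k])) (Var 0)))"
    using assms by (intro proves_ex_dom_intro) (auto simp: is_term_Fn intro!: EqRefl simp del: upt_Suc)
  then have ex: "proves L {} (ex_dom ?I 1 (at_vars (tr_fun ?I f) ([1..<Suc ?k] @ [0])))"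
    unfolding at by simp
  have form: "is_formula L (ex_dom ?I 1 (at_vars (tr_fun ?I f) ([1..<Suc ?k] @ [0])))"
    unfolding at using assms by (simp add: is_term_Fn del: upt_Suc)
  have "proves L {} (all_dom ?I m p) \<and> is_formula L (all_dom ?I m p)" if "proves L {} p" "is_formula L p" for m p
    using that
  proof (induction m)
    case (Suc m)
    then have "proves L {} (Imp Top (all_dom ?I m p))" by (auto intro: proves_taut1)
    with Suc show ?case by (simp add: proves_gen)
  qed simp
  from this[OF ex form] show "proves L {} (fun_total ?I f ?k)" unfolding fun_total_def by blast
  have "wff L (?k + 1) (at_vars (tr_fun ?I f) ([1..<Suc ?k] @ [0]))"
    unfolding at using assms by (auto simp: list_all_iff simp del: upt_Suc)
  then have "wff L (0 + ?k) (ex_dom ?I 1 (at_vars (tr_fun ?I f) ([1..<Suc ?k] @ [0])))"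
    by (intro wff_ex_dom) simp_all
  then show "wff L 0 (fun_total ?I f ?k)" unfolding fun_total_def by (intro wff_all_dom) simp_all
qed

lemma wff_Foralls: "wff L m (Foralls n p) \<longleftrightarrow> wff L (m + n) p"
proof -
  have "wff L m ((Forall ^^ n) p) \<longleftrightarrow> wff L (m + n) p"
    by (induction n arbitrary: m) auto
  then show ?thesis unfolding Foralls_def .
qed

lemma wff_eqs: "wff L n (eqs k) \<longleftrightarrow> (\<forall>i<k. k + i < n)"
  by (auto simp: eqs_def wff_conjs)

lemma proves_eqs:
  assumes "i < k" shows "proves L {eqs k} (Eq (Var i) (Var (k + i)))"
proof -
  have "proves L {eqs k} (eqs k)" by (rule Assm) simp
  then show ?thesis by (rule proves_taut1) (use assms in \<open>auto simp: eqs_def\<close>)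
qed

lemma eq_axioms_provable:
  assumes "p \<in> eq_axioms L" shows "proves L {} p \<and> p \<in> sentences L"
proof -
  have eqs: "is_formula L (eqs k)" for k by (simp add: eqs_def)
  have refl: "proves L {} (Eq (Var 0) (Var 0))" by (rule EqRefl) simp
  have sym: "proves L {} (Imp (Eq (Var 0) (Var 1)) (Eq (Var 1) (Var 0)))"
    by (rule ImpI) (auto intro: proves_Eq_sym Assm)
  have trans: "proves L {} (Imp (Eq (Var 0) (Var 1)) (Imp (Eq (Var 1) (Var 2)) (Eq (Var 0) (Var 2))))"
    by (rule ImpI, simp, rule ImpI, simp, rule proves_Eq_trans[of _ _ _ "Var 1"]) (auto intro: Assm)
  have Fn: "proves L {} (Imp (eqs k) (Eq (Fn f (map Var [0..<k])) (Fn f (map Var [k..<2 * k]))))"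
    if "f < length (funs L)" "k = funs L ! f" for f k
    by (rule ImpI[OF eqs], rule proves_Fn_cong) (use that in \<open>auto simp: is_term_Fn proves_eqs\<close>)
  have Rel: "proves L {} (Imp (eqs k) (Imp (Rel r (map Var [0..<k])) (Rel r (map Var [k..<2 * k]))))"
    if "r < length (rels L)" "k = rels L ! r" for r k
  proof (rule ImpI[OF eqs], rule ImpI)
    show form: "is_formula L (Rel r (map Var [0..<k]))" using that by (auto simp: is_formula_Rel)
    have "proves L {Rel r (map Var [0..<k]), eqs k} (Rel r ([] @ map Var [k..<2 * k]))"
    proof (rule proves_Rel_cong[where ss = "map Var [0..<k]"])
      show "proves L {Rel r (map Var [0..<k]), eqs k} (Eq (map Var [0..<k] ! i) (map Var [k..<2 * k] ! i))"
        if "i < length (map Var [0..<k])" for i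
        using that proves_weaken[OF proves_eqs[of i k L]] by simp
    qed (use form in \<open>auto intro: Assm\<close>)
    then show "proves L {Rel r (map Var [0..<k]), eqs k} (Rel r (map Var [k..<2 * k]))" by simp
  qed
  from assms show ?thesis
    unfolding eq_axioms_def sentences_def
    by (elim UnE insertE emptyE CollectE exE conjE)
      (auto simp: wff_Foralls wff_eqs list_all_iff intro!: proves_Foralls refl sym trans Fn Rel
         sym[unfolded One_nat_def] trans[unfolded One_nat_def])
qed

lemma is_theoryD: "is_theory T \<Longrightarrow> p \<in> sentences (lang T) \<Longrightarrow> proves (lang T) (thms T) p \<Longrightarrow> p \<in> thms T"
  unfolding is_theory_def by blast

lemma is_theory_sentences: "is_theory T \<Longrightarrow> p \<in> thms T \<Longrightarrow> p \<in> sentences (lang T)"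
  unfolding is_theory_def by blast

lemma interpretable_star:
  assumes T: "is_theory T" "lang T = ext_sig (lang U)" and U: "is_theory U"
    and sub: "\<And>p. p \<in> thms T \<Longrightarrow> star p \<in> thms U"
  shows "T \<unlhd> U"
proof -
  let ?I = "star_translation (lang U)"
  have ax: "p \<in> thms T" if "p \<in> eq_axioms (lang T)" for p
    using eq_axioms_provable[OF that] is_theoryD[OF T(1)] proves_weaken by blast
  have tr: "tr_fm ?I p \<in> thms U" if "p \<in> thms T" for p
  proof (rule is_theoryD[OF U])
    have p: "p \<in> sentences (ext_sig (lang U))" using that is_theory_sentences[OF T(1)] T(2) by simp
    then show "tr_fm ?I p \<in> sentences (lang U)"
      using wff_tr_fm[OF is_translation_star] by (simp add: sentences_def)
    have eq: "equivalent (lang U) (tr_fm ?I p) (star p)"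
      by (rule equivalent_star) (use p in \<open>rule is_formula_sentence\<close>)
    have "proves (lang U) (thms U) (Imp (star p) (tr_fm ?I p))"
      by (rule proves_weaken[of _ "{}"]) (use eq in \<open>auto simp: equivalent_def\<close>)
    then show "proves (lang U) (thms U) (tr_fm ?I p)" by (rule ImpE) (rule Assm, rule sub, rule that)
  qed
  have "fun_total ?I f (funs (lang T) ! f) \<in> thms U" if "f < length (funs (lang T))" for f
  proof -
    have f: "f < length (funs (lang U))" and eq: "funs (lang T) = funs (lang U)"
      using that T(2) by (simp_all add: ext_sig_def)
    show ?thesis unfolding eq
      by (rule is_theoryD[OF U])
        (use fun_total_star[OF f] proves_weaken in \<open>auto simp: sentences_def\<close>)
  qed
  then have "interpretation_of ?I T U"
    unfolding interpretation_of_def using is_translation_star T(2) tr ax by auto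
  then show ?thesis unfolding interpretable_def by blast
qed

section \<open>The tree of parameters\<close>

text \<open>Conditions \<open>z\<close> are pairs of a length and a code of bits. The condition \<open>node u n s z\<close> belongs to
  the binary string \<open>s\<close> of length \<open>n\<close>, whose head is its last bit; it decides the formulas that are
  needed to refute the translation with code \<open>m\<close>, for each \<open>m < n\<close>.\<close>

definition extends :: "nat \<Rightarrow> nat \<Rightarrow> bool" where
  "extends z z' \<longleftrightarrow> pi1 z \<le> pi1 z' \<and>
     (\<forall>n < pi1 z. nthc (pi2 z') n = nthc (pi2 z) n)"

text \<open>The new condition has the coding bit \<open>c\<close> at the first free place, and its
  remaining new bits form the block: it makes the translation \<open>n\<close> of some theorem
  \<open>x\<close> false in every structure whose parameter extends it.\<close>

definition refuting :: "nat \<Rightarrow> nat \<Rightarrow> nat \<Rightarrow> nat \<Rightarrow> nat \<Rightarrow> bool" where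
  "refuting u n z c z' \<longleftrightarrow> extends z z' \<and> pi1 z < pi1 z' \<and>
     nthc (pi2 z') (pi1 z) = c \<and>
     (\<exists>x y. x \<in> W u \<and> trans_code n x y \<and> forced z' y 0)"

lemma re_refuting:
  "computable f \<Longrightarrow> computable g \<Longrightarrow> computable h \<Longrightarrow> computable k \<Longrightarrow> computable l \<Longrightarrow>
    re (\<lambda>x. refuting (f x) (g x) (h x) (k x) (l x))"
proof -
  have "re (\<lambda>p. refuting (pi1 (pi1 p)) (pi1 (pi2 (pi1 p)))
     (pi1 (pi2 (pi2 (pi1 p))))
     (pi2 (pi2 (pi2 (pi1 p)))) (pi2 p))"
    unfolding refuting_def extends_def by (intro re_intros computable_intros)
  from re_comp[OF this, of "\<lambda>x. prod_encode (quad (f x) (g x) (h x) (k x), l x)"]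
  show "computable f \<Longrightarrow> computable g \<Longrightarrow> computable h \<Longrightarrow> computable k \<Longrightarrow> computable l \<Longrightarrow> ?thesis"
    by (simp add: computable_pair)
qed

section \<open>The tree of conditions\<close>

definition chooses :: "recf \<Rightarrow> bool" where
  "chooses c \<longleftrightarrow> (\<forall>u n z v z'. computes c (quad u n z v) z' \<longrightarrow> refuting u n z v z') \<and>
     (\<forall>u n z v. (\<exists>z'. refuting u n z v z') \<longrightarrow> (\<exists>z'. computes c (quad u n z v) z'))"

lemma ex_chooses: "\<exists>c. chooses c"
proof -
  have "re (\<lambda>p. refuting (pi1 (pi1 p)) (pi1 (pi2 (pi1 p)))
     (pi1 (pi2 (pi2 (pi1 p))))
     (pi2 (pi2 (pi2 (pi1 p)))) (pi2 p))"
    by (intro re_refuting computable_intros)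
  from selection[where P = "\<lambda>p. refuting (pi1 p) (pi1 (pi2 p))
     (pi1 (pi2 (pi2 p)))
     (pi2 (pi2 (pi2 p)))", OF this]
  obtain c where c: "\<And>p z'. computes c p z' \<Longrightarrow> refuting (pi1 p) (pi1 (pi2 p))
     (pi1 (pi2 (pi2 p)))
     (pi2 (pi2 (pi2 p))) z'"
   "\<And>p z'. refuting (pi1 p) (pi1 (pi2 p))
     (pi1 (pi2 (pi2 p)))
     (pi2 (pi2 (pi2 p))) z' \<Longrightarrow> \<exists>z. computes c p z"
    by metis
  have "chooses c" unfolding chooses_def
    using c[of "quad u n z v" for u n z v] by (simp, blast)
  then show ?thesis by blast
qed

text \<open>One program serves all \<open>u\<close>, with \<open>u\<close> as part of its input; the
  uniformity of the whole construction rests on this.\<close>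

definition choice_prog :: recf where
  "choice_prog = (SOME c. chooses c)"

lemma chooses_choice_prog: "chooses choice_prog"
  unfolding choice_prog_def by (rule someI_ex, rule ex_chooses)

definition node_step :: "nat \<Rightarrow> nat \<Rightarrow> nat \<Rightarrow> bool" where
  "node_step w p q \<longleftrightarrow> (\<exists>u n s z v z'. p = quad u n s z \<and> v < 2 \<and>
     computes choice_prog (quad u n z v) z' \<and> w = quad u (Suc n) (consc v s) z')"

definition node :: "nat \<Rightarrow> nat \<Rightarrow> nat \<Rightarrow> nat \<Rightarrow> bool" where
  "node u n s z \<longleftrightarrow> closure (\<lambda>w. \<exists>u. w = quad u 0 0 (prod_encode (0, 0))) node_step (quad u n s z)"

lemma re_node:
  assumes "computable f" "computable g" "computable h" "computable k"
  shows "re (\<lambda>x. node (f x) (g x) (h x) (k x))"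
proof -
  have "re (closure (\<lambda>w. \<exists>u. w = quad u 0 0 (prod_encode (0, 0))) node_step)"
    unfolding node_step_def by (intro re_closure re_intros computable_intros)
  then show ?thesis unfolding node_def by (rule re_comp) (intro computable_intros assms)
qed

lemma node_0: "node u 0 s z \<longleftrightarrow> s = 0 \<and> z = prod_encode (0, 0)"
proof
  assume "node u 0 s z"
  then show "s = 0 \<and> z = prod_encode (0, 0)"
    unfolding node_def by (cases rule: closure.cases) (auto simp: node_step_def)
qed (auto simp: node_def intro: closure_base)

lemma node_Suc: "node u (Suc n) s' z' \<longleftrightarrow>
    (\<exists>v s z. v < 2 \<and> s' = consc v s \<and> node u n s z \<and> computes choice_prog (quad u n z v) z')"
proof
  assume "node u (Suc n) s' z'"
  then show "\<exists>v s z. v < 2 \<and> s' = consc v s \<and> node u n s z \<and> computes choice_prog (quad u n z v) z'"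
    unfolding node_def by (cases rule: closure.cases) (auto simp: node_step_def)
next
  assume "\<exists>v s z. v < 2 \<and> s' = consc v s \<and> node u n s z \<and> computes choice_prog (quad u n z v) z'"
  then obtain v s z where *: "v < 2" "s' = consc v s" "node u n s z" "computes choice_prog (quad u n z v) z'" by blast
  show "node u (Suc n) s' z'" unfolding node_def
    by (rule closure_step[OF _ *(3)[unfolded node_def] *(3)[unfolded node_def]])
      (use * in \<open>auto simp: node_step_def\<close>)
qed

lemma node_unique: "node u n s z \<Longrightarrow> node u n s z' \<Longrightarrow> z = z'"
proof (induction n arbitrary: s z z')
  case 0
  then show ?case by (simp add: node_0)
next
  case (Suc n)
  from Suc.prems(1) obtain v r y where 1: "s = consc v r" "node u n r y" "computes choice_prog (quad u n y v) z"
    unfolding node_Suc by blast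
  from Suc.prems(2) 1(1) obtain y' where 2: "node u n r y'" "computes choice_prog (quad u n y' v) z'"
    unfolding node_Suc by (auto simp: consc_inject)
  from Suc.IH[OF 1(2) 2(1)] 1(3) 2(2) show ?case using computes_deterministic by blast
qed

abbreviation bitval :: "bool \<Rightarrow> nat" where "bitval v \<equiv> (if v then 1 else 0)"

section \<open>Paths through the tree and their parameters\<close>

primrec path :: "(nat \<Rightarrow> bool) \<Rightarrow> nat \<Rightarrow> nat" where
  "path c 0 = 0"
| "path c (Suc n) = consc (bitval (c n)) (path c n)"

lemma nthc_path: "j < n \<Longrightarrow> nthc (path c n) (n - 1 - j) = bitval (c j)"
proof (induction n)
  case (Suc n)
  show ?case
  proof (cases "j = n")
    case False
    with Suc.prems have "j < n" "Suc n - 1 - j = Suc (n - 1 - j)" by auto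
    with Suc.IH show ?thesis by simp
  qed simp
qed simp

lemma path_cong: "(\<And>j. j < n \<Longrightarrow> c j = d j) \<Longrightarrow> path c n = path d n"
  by (induction n) auto

lemma path_inject: "path c n = path d n \<Longrightarrow> j < n \<Longrightarrow> c j = d j"
proof -
  assume *: "path c n = path d n" "j < n"
  then have "bitval (c j) = bitval (d j)" using nthc_path[of j n c] nthc_path[of j n d] by simp
  then show "c j = d j" by (simp split: if_splits)
qed

lemma finite_paths: "finite (range (\<lambda>c. path c n))"
proof (induction n)
  case (Suc n)
  have "range (\<lambda>c. path c (Suc n)) \<subseteq> (\<Union>v\<in>{0, 1}. consc v ` range (\<lambda>c. path c n))"
    by auto
  moreover have "finite (\<Union>v\<in>{0, 1}. consc v ` range (\<lambda>c. path c n))" using Suc by simp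
  ultimately show ?case by (rule finite_subset)
qed simp

text \<open>All conditions are covered, not only those of the tree, so the notion can be established
  before the tree is known to be total.\<close>

definition perfect :: "nat \<Rightarrow> bool" where
  "perfect u \<longleftrightarrow> (\<forall>n z v. v < 2 \<longrightarrow> (\<exists>z'. refuting u n z v z'))"

definition cond :: "nat \<Rightarrow> (nat \<Rightarrow> bool) \<Rightarrow> nat \<Rightarrow> nat" where
  "cond u c n = (THE z. node u n (path c n) z)"

lemma node_cond:
  assumes "perfect u" shows "node u n (path c n) (cond u c n)"
proof -
  have "\<exists>z. node u n (path c n) z"
  proof (induction n)
    case 0
    show ?case by (auto simp: node_0)
  next
    case (Suc n)
    then obtain z where z: "node u n (path c n) z" by blast
    have v: "bitval (c n) < 2" by simp
    from assms v obtain z' where "refuting u n z (bitval (c n)) z'" unfolding perfect_def by blast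
    then obtain z' where "computes choice_prog (quad u n z (bitval (c n))) z'"
      using chooses_choice_prog unfolding chooses_def by blast
    with z v have "node u (Suc n) (path c (Suc n)) z'" unfolding node_Suc path.simps by blast
    then show ?case by blast
  qed
  then show ?thesis unfolding cond_def using node_unique by (metis theI)
qed

lemma node_iff_cond: "perfect u \<Longrightarrow> node u n (path c n) z \<longleftrightarrow> z = cond u c n"
  using node_cond node_unique by blast

lemma refuting_cond:
  assumes "perfect u" shows "refuting u n (cond u c n) (bitval (c n)) (cond u c (Suc n))"
proof -
  from node_cond[OF assms, of "Suc n" c] obtain z
    where "node u n (path c n) z" and z: "computes choice_prog (quad u n z (bitval (c n))) (cond u c (Suc n))"
    unfolding node_Suc path.simps by (auto simp: consc_inject)
  then have "z = cond u c n" using node_iff_cond[OF assms] by simp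
  with z show ?thesis using chooses_choice_prog unfolding chooses_def by simp
qed

lemma extends_refl: "extends z z"
  and extends_trans: "extends z z' \<Longrightarrow> extends z' z'' \<Longrightarrow> extends z z''"
  by (auto simp: extends_def)

lemma extends_cond:
  assumes "perfect u" "n \<le> m" shows "extends (cond u c n) (cond u c m)"
  using assms(2)
proof (induction m rule: dec_induct)
  case (step m)
  then show ?case using refuting_cond[OF assms(1), of m c] extends_trans unfolding refuting_def by blast
qed (rule extends_refl)

lemma length_cond: 
  assumes "perfect u" shows "n \<le> pi1 (cond u c n)"
proof (induction n)
  case (Suc n)
  then show ?case using refuting_cond[OF assms, of n c] unfolding refuting_def by linarith
qed simp

text \<open>This is \<open>\<Phi>(c)\<close>. A condition of level \<open>n\<close> has length at
  least \<open>n\<close>, so level \<open>Suc k\<close> is certain to contain place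
  \<open>k\<close>.\<close>

definition param :: "nat \<Rightarrow> (nat \<Rightarrow> bool) \<Rightarrow> nat \<Rightarrow> bool" where
  "param u c k \<longleftrightarrow> bits (pi2 (cond u c (Suc k))) k"

lemma prefix_of_param:
  assumes "perfect u" shows "prefix_of (cond u c n) (param u c)"
  unfolding prefix_of_def
proof (intro allI impI)
  fix k assume k: "k < pi1 (cond u c n)"
  have k': "k < pi1 (cond u c (Suc k))" using length_cond[OF assms, of "Suc k" c] by simp
  consider "n \<le> Suc k" | "Suc k \<le> n" by linarith
  then show "bits (pi2 (cond u c n)) k \<longleftrightarrow> param u c k"
    by cases (use k k' extends_cond[OF assms, of n "Suc k" c] extends_cond[OF assms, of "Suc k" n c] in
      \<open>auto simp: extends_def param_def bits_def\<close>)
qed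

lemma param_coding:
  assumes "perfect u" shows "param u c (pi1 (cond u c n)) \<longleftrightarrow> c n"
proof -
  let ?k = "pi1 (cond u c n)"
  have "?k < pi1 (cond u c (Suc n))" "nthc (pi2 (cond u c (Suc n))) ?k = bitval (c n)"
    using refuting_cond[OF assms, of n c] unfolding refuting_def by auto
  moreover from this have "bits (pi2 (cond u c (Suc n))) ?k \<longleftrightarrow> param u c ?k"
    using prefix_of_param[OF assms, of c "Suc n"] unfolding prefix_of_def by blast
  ultimately show ?thesis by (simp add: bits_def split: if_splits)
qed

abbreviation holds :: "nat \<Rightarrow> (nat \<Rightarrow> bool) \<Rightarrow> nat \<Rightarrow> bool" where
  "holds u c x \<equiv> satc UNIV (param u c) (\<lambda>_. 0) x"

lemma forced_cond:
  assumes "perfect u"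
  shows "forced (cond u c n) x v \<longleftrightarrow> x < pi1 (cond u c n) \<and> v = bitval (holds u c x)"
  using forced_iff[OF prefix_of_param[OF assms]] .

subsection \<open>Formulas for the bits of a path\<close>

text \<open>Distinct strings have incompatible conditions: as long as two strings agree, their next
  coding bits have the same place, and the parameter determines the bit there.\<close>

lemma path_eq_of_prefix:
  assumes "perfect u" "prefix_of (cond u d n) (param u c)" shows "path c n = path d n"
proof -
  have "j \<le> n \<Longrightarrow> path c j = path d j" for j
  proof (induction j)
    case (Suc j)
    then have eq: "path c j = path d j" by simp
    then have "cond u c j = cond u d j" by (simp add: cond_def)
    then have c: "param u c (pi1 (cond u d j)) \<longleftrightarrow> c j"
      using param_coding[OF assms(1), of c j] by simp
    have "pi1 (cond u d j) < pi1 (cond u d (Suc j))"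
      using refuting_cond[OF assms(1), of j d] unfolding refuting_def by simp
    also have "\<dots> \<le> pi1 (cond u d n)"
      using extends_cond[OF assms(1) Suc.prems, of d] unfolding extends_def by simp
    finally have "param u c (pi1 (cond u d j)) \<longleftrightarrow> param u d (pi1 (cond u d j))"
      using assms(2) prefix_of_param[OF assms(1), of d n] unfolding prefix_of_def by blast
    with c have "c j = d j" using param_coding[OF assms(1), of d j] by simp
    with eq show ?case by simp
  qed simp
  then show ?thesis by simp
qed

text \<open>Bit \<open>k\<close> of \<open>c\<close> is true exactly if the parameter extends one of
  the finitely many conditions of level \<open>Suc k\<close> whose string has that bit, so a clopen
  set of parameters defines it.\<close>

lemma ex_bit_formula:
  assumes "perfect u" "two_sorts L"
  shows "\<exists>p\<in>sentences L. \<forall>c. holds u c (fm_code p) \<longleftrightarrow> c k"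
proof -
  let ?S = "{cond u d (Suc k) | d. d k}"
  have "?S \<subseteq> (\<lambda>s. THE z. node u (Suc k) s z) ` range (\<lambda>c. path c (Suc k))"
    unfolding cond_def by blast
  then have "finite ?S" using finite_paths finite_subset finite_imageI by blast
  then have "definable L (\<lambda>b. \<exists>z\<in>?S. prefix_of z b)"
  proof (rule definable_finite_ex)
    fix z
    have "definable L (\<lambda>b. \<forall>n<pi1 z. b n \<longleftrightarrow> bits (pi2 z) n)"
      by (rule definable_agree[OF assms(2)])
    moreover have "(\<lambda>b. \<forall>n<pi1 z. b n \<longleftrightarrow> bits (pi2 z) n) = prefix_of z"
      by (auto simp: prefix_of_def fun_eq_iff)
    ultimately show "definable L (prefix_of z)" by simp
  qed
  then obtain p where p: "p \<in> sentences L" "\<forall>b. sat b (\<lambda>_. 0) p \<longleftrightarrow> (\<exists>z\<in>?S. prefix_of z b)"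
    unfolding definable_def by blast
  have "(\<exists>z\<in>?S. prefix_of z (param u c)) \<longleftrightarrow> c k" for c
  proof
    assume "\<exists>z\<in>?S. prefix_of z (param u c)"
    then obtain d where d: "d k" "prefix_of (cond u d (Suc k)) (param u c)" by blast
    from path_inject[OF path_eq_of_prefix[OF assms(1) d(2)], of k] d(1) show "c k" by simp
  next
    assume "c k"
    then show "\<exists>z\<in>?S. prefix_of z (param u c)" using prefix_of_param[OF assms(1)] by blast
  qed
  with p(2) have "holds u c (fm_code p) \<longleftrightarrow> c k" for c by blast
  with p(1) show ?thesis by blast
qed

subsection \<open>Bars\<close>

text \<open>\<open>c\<close> separates the effectively inseparable sets of programs with output 0 and 1 on their
  own code, up to the second component of the input, which is free for parameters.\<close>

definition separating :: "(nat \<Rightarrow> bool) \<Rightarrow> bool" where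
  "separating c \<longleftrightarrow> (\<forall>j. (runs (pi1 j) j 0 \<longrightarrow> c j) \<and> (runs (pi1 j) j 1 \<longrightarrow> \<not> c j))"

definition killed :: "nat \<Rightarrow> nat \<Rightarrow> bool" where
  "killed n s \<longleftrightarrow> (\<exists>j. j < n \<and>
     (nthc s (n - 1 - j) = 0 \<and> runs (pi1 j) j 0 \<or>
      nthc s (n - 1 - j) = 1 \<and> runs (pi1 j) j 1))"

lemma killed_path: "killed n (path c n) \<longleftrightarrow> (\<exists>j<n. \<not> c j \<and> runs (pi1 j) j 0 \<or>
    c j \<and> runs (pi1 j) j 1)"
proof -
  have "(nthc (path c n) (n - 1 - j) = 0 \<longleftrightarrow> \<not> c j) \<and> (nthc (path c n) (n - 1 - j) = 1 \<longleftrightarrow> c j)" if "j < n" for j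
    unfolding nthc_path[OF that] by simp
  then show ?thesis unfolding killed_def by blast
qed

text \<open>The smallest separation. It shows that there are models in which \<open>P\<close> fails,
  and it fills up finite strings to separating paths.\<close>

lemma separating_least: "separating (\<lambda>j. runs (pi1 j) j 0)"
  unfolding separating_def using runs_deterministic by (metis zero_neq_one)

text \<open>Mode 0 of \<open>barred\<close> expresses truth for all separating paths, mode \<open>Suc k\<close> equivalence with bit
  \<open>k\<close> for all paths.\<close>

definition leaf :: "nat \<Rightarrow> bool" where
  "leaf w \<longleftrightarrow> (\<exists>u m x n s z. w = prod_encode (trip u m x, prod_encode (n, s)) \<and> node u n s z \<and>
     (m = 0 \<and> (forced z x 1 \<or> killed n s) \<or>
      (\<exists>k. m = Suc k \<and> k < n \<and> forced z x (nthc s (n - 1 - k)))))"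

definition children :: "nat \<Rightarrow> nat \<Rightarrow> nat \<Rightarrow> bool" where
  "children w p q \<longleftrightarrow> (\<exists>a n s. w = prod_encode (a, prod_encode (n, s)) \<and>
     p = prod_encode (a, prod_encode (Suc n, consc 0 s)) \<and> q = prod_encode (a, prod_encode (Suc n, consc 1 s)))"

text \<open>A derivation is a finite subtree all of whose leaves are settled, and the computations
  that kill strings belong to its witnesses. So truth along all separating paths, a universal
  statement over a closed set, becomes enumerable.\<close>

definition barred :: "nat \<Rightarrow> nat \<Rightarrow> nat \<Rightarrow> nat \<Rightarrow> nat \<Rightarrow> bool" where
  "barred u m x n s \<longleftrightarrow> closure leaf children (prod_encode (trip u m x, prod_encode (n, s)))"

lemma re_barred:
  assumes "computable f" "computable g" "computable h"
  shows "re (\<lambda>x. barred (f x) (g x) (h x) 0 0)"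
proof -
  have "re (closure leaf children)"
    unfolding leaf_def children_def killed_def by (intro re_closure re_node re_intros computable_intros)
  then show ?thesis unfolding barred_def by (rule re_comp) (intro computable_intros assms)
qed

lemma barred_leaf: "leaf (prod_encode (trip u m x, prod_encode (n, s))) \<Longrightarrow> barred u m x n s"
  unfolding barred_def by (rule closure_base)

lemma barred_children:
  assumes "barred u m x (Suc n) (consc 0 s)" "barred u m x (Suc n) (consc 1 s)" shows "barred u m x n s"
  unfolding barred_def
  by (rule closure_step[OF _ assms[unfolded barred_def]]) (auto simp: children_def)

lemma barred_induct:
  assumes "barred u m x n s"
    and "\<And>n s. leaf (prod_encode (trip u m x, prod_encode (n, s))) \<Longrightarrow> P n s"
    and "\<And>n s. P (Suc n) (consc 0 s) \<Longrightarrow> P (Suc n) (consc 1 s) \<Longrightarrow> P n s"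
  shows "P n s"
proof -
  have "closure leaf children w \<Longrightarrow> \<forall>n s. w = prod_encode (trip u m x, prod_encode (n, s)) \<longrightarrow> P n s" for w
    by (induction rule: closure.induct) (auto simp: children_def intro: assms(2) assms(3))
  with assms(1) show ?thesis unfolding barred_def by blast
qed

lemma barred_path:
  assumes "barred u m x 0 0"
    and "\<And>n. leaf (prod_encode (trip u m x, prod_encode (n, path c n))) \<Longrightarrow> Q"
  shows Q
proof -
  have "\<forall>k. path c n = s \<longrightarrow> Q" if "barred u m x n s" for n s
    using that
  proof (rule barred_induct)
    fix n s assume "\<forall>k. path c (Suc n) = consc 0 s \<longrightarrow> Q" "\<forall>k. path c (Suc n) = consc 1 s \<longrightarrow> Q"
    then show "\<forall>k. path c n = s \<longrightarrow> Q" by (cases "c n") auto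
  qed (use assms(2) in blast)
  from this[OF assms(1)] show Q by simp
qed

text \<open>Downward induction on the level; changing \<open>c\<close> at place \<open>n\<close>
  gives the two children of a string of length \<open>n\<close>.\<close>

lemma barredI:
  assumes "\<And>c. barred u m x N (path c N)" shows "barred u m x 0 0"
proof -
  have "n \<le> N \<Longrightarrow> \<forall>c. barred u m x n (path c n)" for n
  proof (induction n rule: inc_induct)
    case base
    show ?case using assms by blast
  next
    case (step n)
    show ?case
    proof
      fix c
      have "path (c(n := v)) n = path c n" for v by (rule path_cong) simp
      then have "path (c(n := False)) (Suc n) = consc 0 (path c n)" "path (c(n := True)) (Suc n) = consc 1 (path c n)"
        by simp_all
      then show "barred u m x n (path c n)"
        using step.IH barred_children[of u m x n "path c n"] by metis
    qed
  qed
  from this[of 0] show ?thesis by simp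
qed

text \<open>Level \<open>Suc x\<close> is always a bar: its conditions are longer than
  \<open>x\<close> and so decide \<open>x\<close>, and a string there that has not been killed lies
  on a separating path, along which \<open>x\<close> is true by assumption.\<close>

lemma barred_0:
  assumes u: "perfect u"
  shows "barred u 0 x 0 0 \<longleftrightarrow> (\<forall>c. separating c \<longrightarrow> holds u c x)"
proof
  assume bar: "barred u 0 x 0 0"
  show "\<forall>c. separating c \<longrightarrow> holds u c x"
  proof (intro allI impI)
    fix c assume c: "separating c"
    from bar show "holds u c x"
    proof (rule barred_path)
      fix n assume "leaf (prod_encode (trip u 0 x, prod_encode (n, path c n)))"
      then have "forced (cond u c n) x 1 \<or> killed n (path c n)"
        unfolding leaf_def using node_iff_cond[OF u] by auto
      moreover have "\<not> killed n (path c n)" using c unfolding killed_path separating_def by blast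
      ultimately show "holds u c x" unfolding forced_cond[OF u] by (auto split: if_splits)
    qed
  qed
next
  assume all: "\<forall>c. separating c \<longrightarrow> holds u c x"
  show "barred u 0 x 0 0"
  proof (rule barredI)
    fix c
    let ?N = "Suc x"
    have "forced (cond u c ?N) x 1 \<or> killed ?N (path c ?N)"
    proof (rule disjCI)
      assume nk: "\<not> killed ?N (path c ?N)"
      \<comment> \<open>The string is kept and continued by the least separation; as it has not been
        killed, the result is separating.\<close>
      define d where "d j = (if j < ?N then c j else runs (pi1 j) j 0)" for j
      have "separating d"
        unfolding separating_def
      proof (intro allI conjI impI)
        fix j
        show "runs (pi1 j) j 0 \<Longrightarrow> d j"
          using nk unfolding killed_path d_def by auto
        show "runs (pi1 j) j 1 \<Longrightarrow> \<not> d j"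
          using nk runs_deterministic[of "pi1 j" j 1 0] unfolding killed_path d_def by auto
      qed
      with all have h: "holds u d x" by blast
      have "path d ?N = path c ?N" by (rule path_cong) (simp add: d_def)
      then have "cond u c ?N = cond u d ?N" by (simp add: cond_def)
      moreover have "x < pi1 (cond u d ?N)" using length_cond[OF u, of ?N d] by simp
      ultimately show "forced (cond u c ?N) x 1" using h by (simp add: forced_cond[OF u])
    qed
    then show "barred u 0 x ?N (path c ?N)"
      by (intro barred_leaf) (use node_cond[OF u, of ?N c] in \<open>unfold leaf_def, blast\<close>)
  qed
qed

lemma barred_Suc:
  assumes u: "perfect u"
  shows "barred u (Suc k) x 0 0 \<longleftrightarrow> (\<forall>c. holds u c x \<longleftrightarrow> c k)"
proof
  assume bar: "barred u (Suc k) x 0 0"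
  show "\<forall>c. holds u c x \<longleftrightarrow> c k"
  proof
    fix c
    from bar show "holds u c x \<longleftrightarrow> c k"
    proof (rule barred_path)
      fix n assume "leaf (prod_encode (trip u (Suc k) x, prod_encode (n, path c n)))"
      then have "k < n" "forced (cond u c n) x (nthc (path c n) (n - 1 - k))"
        unfolding leaf_def using node_iff_cond[OF u] by auto
      then have "bitval (holds u c x) = bitval (c k)" unfolding forced_cond[OF u] using nthc_path[of k n c] by simp
      then show "holds u c x \<longleftrightarrow> c k" by (simp split: if_splits)
    qed
  qed
next
  assume all: "\<forall>c. holds u c x \<longleftrightarrow> c k"
  show "barred u (Suc k) x 0 0"
  proof (rule barredI)
    fix c
    \<comment> \<open>At this level the condition decides \<open>x\<close> and the string contains
      bit \<open>k\<close>.\<close>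
    let ?N = "Suc (x + k)"
    have "x < pi1 (cond u c ?N)" using length_cond[OF u, of ?N c] by simp
    then have "forced (cond u c ?N) x (nthc (path c ?N) (?N - 1 - k))"
      using all nthc_path[of k ?N c] by (simp add: forced_cond[OF u])
    moreover have "k < ?N" by simp
    ultimately show "barred u (Suc k) x ?N (path c ?N)"
      by (intro barred_leaf) (use node_cond[OF u, of ?N c] in \<open>unfold leaf_def, blast\<close>)
  qed
qed

section \<open>Every tEI theory yields a perfect tree\<close>

text \<open>Codes of sentences are recognised through the index of the theory itself:
  \<open>Imp p p\<close> is a theorem exactly if \<open>p\<close> is a sentence. So no procedure
  depending on the signature has to be given.\<close>

lemma codes_of_sentences:
  assumes "is_theory U" "re_index u (thms U)"
  shows "imp_code x x \<in> W u \<longleftrightarrow> (\<exists>p\<in>sentences (lang U). x = fm_code p)"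
proof
  assume "imp_code x x \<in> W u"
  then obtain q where q: "q \<in> thms U" "imp_code x x = fm_code q"
    using assms(2) unfolding re_index_def by auto
  then obtain p where p: "q = Imp p p" "x = fm_code p"
    using fm_code_tags(4)[of x x q] inj_fm_code by (auto dest: injD)
  then have "p \<in> sentences (lang U)"
    using q(1) is_theory_sentences[OF assms(1), of q] by (simp add: sentences_def)
  with p(2) show "\<exists>p\<in>sentences (lang U). x = fm_code p" by blast
next
  assume "\<exists>p\<in>sentences (lang U). x = fm_code p"
  then obtain p where p: "p \<in> sentences (lang U)" "x = fm_code p" by blast
  have "Imp p p \<in> thms U"
    by (rule is_theoryD[OF assms(1)], use p in \<open>simp add: sentences_def\<close>, rule proves_taut0)
      (use is_formula_sentence[OF p(1)] in auto)
  then show "imp_code x x \<in> W u"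
    using assms(2) p(2) unfolding re_index_def by (auto simp: fm_code.simps intro!: image_eqI[of _ _ "Imp p p"])
qed

lemma thms_taut:
  assumes "is_theory U" "p \<in> sentences (lang U)" "\<And>A. pval A p"
  shows "p \<in> thms U"
  by (rule is_theoryD[OF assms(1,2)], rule proves_taut0) (use assms is_formula_sentence in auto)

lemma thms_Imp:
  assumes "is_theory U" "p \<in> sentences (lang U)" "q \<in> sentences (lang U)" "proves (lang U) {p} q"
  shows "Imp p q \<in> thms U"
proof (rule is_theoryD[OF assms(1)])
  show "Imp p q \<in> sentences (lang U)" using assms by (simp add: sentences_def)
  show "proves (lang U) (thms U) (Imp p q)"
    by (rule proves.ImpI, rule is_formula_sentence[OF assms(2)], rule proves_weaken[OF assms(4)]) simp
qed

text \<open>If no condition refutes the translation \<open>n\<close>, then it gives a complete decidable extension of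
  the theory, since it commutes with implication and falsity.\<close>

lemma tEI_perfect:
  assumes U: "tEI U" and u: "re_index u (thms U)"
  shows "perfect u"
  unfolding perfect_def
proof (intro allI impI, rule ccontr)
  fix n z v
  assume v: "v < (2::nat)" and none: "\<nexists>z'. refuting u n z v z'"
  have th: "is_theory U" using U unfolding tEI_def by blast
  let ?L = "lang U" and ?N = "pi1 z"
  \<comment> \<open>The bits of \<open>z\<close>, then the coding bit \<open>v\<close>, then zeros
    by default: an extension of \<open>z\<close> whose structure can be computed.\<close>
  define m where "m = list_encode (map (nthc (pi2 z)) [0..<?N] @ [v])"
  have m: "nthc m k = (if k < ?N then nthc (pi2 z) k else if k = ?N then v else 0)" for k
    by (auto simp: m_def nthc_list_encode nth_append)
  let ?tr = "\<lambda>p. satc UNIV (bits m) (\<lambda>_. 0) (translate n p)"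
  have sat_thms: "?tr p" if p: "p \<in> thms U" for p
  proof (rule ccontr)
    assume "\<not> ?tr p"
    \<comment> \<open>The prefix is longer than \<open>z\<close> and longer than the code of the
      translated sentence, so it decides that sentence.\<close>
    let ?z = "prod_encode (Suc (?N + translate n p), m)"
    have "prefix_of ?z (bits m)" by (simp add: prefix_of_def)
    with \<open>\<not> ?tr p\<close> have "forced ?z (translate n p) 0" by (simp add: forced_iff)
    moreover have "fm_code p \<in> W u" using u p unfolding re_index_def by blast
    ultimately have "refuting u n z v ?z"
      unfolding refuting_def extends_def using trans_complete[of n p] by (auto simp: m)
    with none show False by blast
  qed
  define X where "X = {p \<in> sentences ?L. ?tr p}"
  define Y where "Y = {p \<in> sentences ?L. \<not> ?tr p}"
  \<comment> \<open>Each translated sentence is decided by a sufficiently long prefix of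
    \<open>m\<close>, so true sentences (\<open>v = 1\<close>) and false ones (\<open>v = 0\<close>)
    are both enumerable.\<close>
  define R where "R v x \<longleftrightarrow> imp_code x x \<in> W u \<and> (\<exists>y z'. trans_code n x y \<and>
    (\<forall>k<pi1 z'. nthc (pi2 z') k = nthc m k) \<and> forced z' y v)" for v x
  have R: "R v x \<longleftrightarrow> (\<exists>p\<in>sentences ?L. x = fm_code p \<and> v = (if ?tr p then 1 else 0))" for v x
  proof
    assume "R v x"
    then obtain p y z' where p: "p \<in> sentences ?L" "x = fm_code p" and y: "trans_code n x y" "forced z' y v"
      and z': "\<forall>k<pi1 z'. nthc (pi2 z') k = nthc m k"
      unfolding R_def codes_of_sentences[OF th u] by blast
    have "prefix_of z' (bits m)" using z' by (simp add: prefix_of_def bits_def)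
    from forced_iff[OF this] y have "v = (if satc UNIV (bits m) (\<lambda>_. 0) y then 1 else 0)" by blast
    moreover have "y = translate n p" using y(1) p(2) trans_code_iff by blast
    ultimately show "\<exists>p\<in>sentences ?L. x = fm_code p \<and> v = (if ?tr p then 1 else 0)" using p by blast
  next
    assume "\<exists>p\<in>sentences ?L. x = fm_code p \<and> v = (if ?tr p then 1 else 0)"
    then obtain p where p: "p \<in> sentences ?L" "x = fm_code p" "v = (if ?tr p then 1 else 0)" by blast
    let ?z = "prod_encode (Suc (translate n p), m)"
    have "prefix_of ?z (bits m)" by (simp add: prefix_of_def)
    with p(3) have "forced ?z (translate n p) v" by (simp add: forced_iff)
    then show "R v x" unfolding R_def codes_of_sentences[OF th u]
      using p(1,2) trans_complete[of n p] by (intro conjI bexI exI[of _ "translate n p"] exI[of _ ?z]) auto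
  qed
  have "re (R v)" for v
    unfolding R_def by (intro re_intros computable_intros)
  then obtain i j where "W i = {x. R 1 x}" "W j = {x. R 0 x}" by (metis re_enumerated)
  then have idx: "re_index i X" "re_index j Y"
    unfolding re_index_def X_def Y_def R by (auto split: if_splits)
  have "is_filter ?L X" unfolding is_filter_def
  proof (intro conjI ballI impI)
    fix p q assume p: "p \<in> X" and q: "q \<in> sentences ?L" "proves ?L {p} q"
    then have "?tr (Imp p q)" using sat_thms thms_Imp[OF th] unfolding X_def by blast
    with p q(1) show "q \<in> X" by (simp add: X_def)
  qed (auto simp: X_def sentences_def)
  moreover have "is_ideal ?L Y" unfolding is_ideal_def
  proof (intro conjI ballI impI)
    fix p q assume p: "p \<in> Y" and q: "q \<in> sentences ?L" "proves ?L {q} p"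
    then have "?tr (Imp q p)" using sat_thms thms_Imp[OF th] unfolding Y_def by blast
    with p q(1) show "q \<in> Y" by (simp add: Y_def)
  qed (auto simp: Y_def sentences_def)
  moreover have "thms U \<subseteq> X" using sat_thms is_theory_sentences[OF th] by (auto simp: X_def)
  moreover have "refuted U \<subseteq> Y"
  proof
    fix p assume "p \<in> refuted U"
    then have "p \<in> sentences ?L" "?tr (Neg p)" unfolding refuted_def using sat_thms by blast+
    then show "p \<in> Y" by (simp add: Y_def)
  qed
  moreover have "X \<inter> Y = {}" by (auto simp: X_def Y_def)
  \<comment> \<open>\<open>X\<close> and \<open>Y\<close> together exhaust the sentences, so no
    sentence can be returned outside them.\<close>
  ultimately have "\<exists>p\<in>sentences ?L. p \<notin> X \<union> Y" using U idx unfolding tEI_def by metis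
  then show False by (auto simp: X_def Y_def)
qed

section \<open>The weaker theory\<close>

text \<open>An intersection of two theories. The first conjunct is the case that \<open>P\<close>
  holds, where \<open>star\<close> also reads the binary symbol as equality; the second is the case
  that \<open>P\<close> fails, since \<open>P\<close> is false in all the structures.\<close>

definition weaker :: "nat \<Rightarrow> fo_theory \<Rightarrow> fo_theory" where
  "weaker u U = Theory (ext_sig (lang U))
     {p \<in> sentences (ext_sig (lang U)). star p \<in> thms U \<and> (\<forall>c. separating c \<longrightarrow> holds u c (fm_code p))}"

lemma lang_weaker [simp]: "lang (weaker u U) = ext_sig (lang U)"
  by (simp add: weaker_def)

lemma mem_weaker: "p \<in> thms (weaker u U) \<longleftrightarrow> p \<in> sentences (ext_sig (lang U)) \<and> star p \<in> thms U \<and>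
    (\<forall>c. separating c \<longrightarrow> holds u c (fm_code p))"
  by (simp add: weaker_def)

lemma star_sentence: "p \<in> sentences (ext_sig L) \<Longrightarrow> star p \<in> sentences L"
  unfolding sentences_def using wff_star by blast

lemma is_theory_weaker:
  assumes U: "is_theory U" shows "is_theory (weaker u U)"
proof -
  let ?T = "weaker u U"
  have "p \<in> thms ?T" if p: "p \<in> sentences (ext_sig (lang U))" "proves (ext_sig (lang U)) (thms ?T) p" for p
    unfolding mem_weaker
  proof (intro conjI allI impI)
    have "proves (lang U) (thms U) (star p)"
      by (rule proves_weaken[OF proves_star[OF p(2)]]) (auto simp: mem_weaker)
    then show "star p \<in> thms U" using is_theoryD[OF U star_sentence[OF p(1)]] by blast
    fix c assume "separating c"
    then show "holds u c (fm_code p)"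
      by (intro proves_sound[OF p(2)]) (auto simp: mem_weaker)
  qed (rule p)
  moreover have "p \<in> thms ?T \<Longrightarrow> p \<in> sentences (ext_sig (lang U))" for p by (simp add: mem_weaker)
  ultimately show ?thesis unfolding is_theory_def lang_weaker by (auto intro: Assm)
qed

definition weaker_pred :: "nat \<Rightarrow> nat \<Rightarrow> bool" where
  "weaker_pred u x \<longleftrightarrow> (\<exists>y. star_code x y \<and> y \<in> W u) \<and> barred u 0 x 0 0"

lemma re_weaker_pred: "re (\<lambda>p. weaker_pred (pi1 p) (pi2 p))"
  unfolding weaker_pred_def by (intro re_intros re_barred computable_intros)

lemma weaker_pred_iff:
  assumes "is_theory U" "re_index u (thms U)" "perfect u"
  shows "weaker_pred u x \<longleftrightarrow> x \<in> fm_code ` thms (weaker u U)"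
proof
  assume x: "weaker_pred u x"
  then obtain q where q: "star_code x (fm_code q)" "q \<in> thms U"
    using assms(2) unfolding weaker_pred_def re_index_def by auto
  then have "wff (lang U) 0 q" using is_theory_sentences[OF assms(1)] by (auto simp: sentences_def)
  from star_code_sound[OF q(1) this] obtain p
    where "x = fm_code p" "star p = q" "wff (ext_sig (lang U)) 0 p" by blast
  with x q(2) have "p \<in> thms (weaker u U)"
    unfolding mem_weaker weaker_pred_def barred_0[OF assms(3)] by (simp add: sentences_def)
  with \<open>x = fm_code p\<close> show "x \<in> fm_code ` thms (weaker u U)" by blast
next
  assume "x \<in> fm_code ` thms (weaker u U)"
  then obtain p where p: "x = fm_code p" "p \<in> thms (weaker u U)" by blast
  then have "wff (ext_sig (lang U)) 0 p" by (simp add: mem_weaker sentences_def)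
  then have "star_code x (fm_code (star p))" using star_code_complete p(1) by blast
  moreover have "fm_code (star p) \<in> W u" using p(2) assms(2) unfolding mem_weaker re_index_def by blast
  ultimately show "weaker_pred u x"
    using p unfolding weaker_pred_def barred_0[OF assms(3)] mem_weaker by blast
qed

text \<open>A single separating path suffices. A translation has a code \<open>n\<close>, and at
  level \<open>Suc n\<close> the path makes the translation of some theorem of \<open>U\<close>
  false, whereas theorems of the new theory are true along the path.\<close>

lemma weaker_not_interpreting:
  assumes U: "is_theory U" and u: "re_index u (thms U)" "perfect u"
  shows "\<not> U \<unlhd> weaker u U"
proof
  assume "U \<unlhd> weaker u U"
  then obtain I where I: "is_translation I (lang U) (ext_sig (lang U))"
    "\<And>p. p \<in> thms U \<Longrightarrow> tr_fm I p \<in> thms (weaker u U)"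
    unfolding interpretable_def interpretation_of_def by auto
  obtain n where n: "codes_translation n I (lang U)" using ex_codes_translation by blast
  define c where "c j = runs (pi1 j) j 0" for j
  have c: "separating c" unfolding c_def by (rule separating_least)
  from refuting_cond[OF u(2), of n c] obtain x y where
    xy: "x \<in> W u" "trans_code n x y" "forced (cond u c (Suc n)) y 0"
    unfolding refuting_def by blast
  then obtain p where p: "x = fm_code p" "p \<in> thms U" using u(1) unfolding re_index_def by blast
  have "y = translate n p" using xy(2) p(1) trans_code_iff by blast
  moreover have "\<not> holds u c y" using xy(3) unfolding forced_cond[OF u(2)] by (auto split: if_splits)
  moreover have "wff (lang U) 0 p" using p(2) is_theory_sentences[OF U] by (auto simp: sentences_def)
  ultimately have "\<not> holds u c (fm_code (tr_fm I p))" using satc_translate[OF I(1) n] by blast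
  with I(2)[OF p(2)] c show False unfolding mem_weaker by blast
qed

section \<open>The weaker theory is tEI\<close>

text \<open>The filter that is generated by \<open>X\<close> and the negations of \<open>Y\<close>.\<close>

definition generated :: "signature \<Rightarrow> fm set \<Rightarrow> fm set \<Rightarrow> fm set" where
  "generated L X Y = {p \<in> sentences L. \<exists>y\<in>Y. Or y p \<in> X}"

lemma filter_taut:
  assumes X: "is_filter L X" and "a \<in> X" "b \<in> X" "p \<in> sentences L"
    and "\<And>A. pval A a \<Longrightarrow> pval A b \<Longrightarrow> pval A p"
  shows "p \<in> X"
proof -
  have "And a b \<in> X" and ab: "a \<in> sentences L" "b \<in> sentences L" using assms unfolding is_filter_def by blast+
  moreover have "proves L {And a b} p"
    by (rule proves_taut1[of _ _ "And a b"], rule Assm)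
      (use ab assms(4,5) is_formula_sentence in auto)
  ultimately show ?thesis using X assms(4) unfolding is_filter_def by blast
qed

text \<open>Two members come with two elements of the ideal, and their disjunction serves for
  both.\<close>

lemma generated_taut:
  assumes X: "is_filter L X" and Y: "is_ideal L Y"
    and "a \<in> generated L X Y" "b \<in> generated L X Y" "p \<in> sentences L"
    and "\<And>A. pval A a \<Longrightarrow> pval A b \<Longrightarrow> pval A p"
  shows "p \<in> generated L X Y"
proof -
  from assms(3,4) obtain y z where yz: "y \<in> Y" "Or y a \<in> X" "z \<in> Y" "Or z b \<in> X"
    unfolding generated_def by blast
  have "Or y z \<in> Y" using Y yz unfolding is_ideal_def by blast
  moreover have "Or (Or y z) p \<in> X"
  proof (rule filter_taut[OF X yz(2,4)])
    show "Or (Or y z) p \<in> sentences L"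
      using Y yz assms(5) unfolding is_ideal_def sentences_def by auto
    show "pval A (Or y a) \<Longrightarrow> pval A (Or z b) \<Longrightarrow> pval A (Or (Or y z) p)" for A
      using assms(6)[of A] by auto
  qed
  ultimately show ?thesis using assms(5) unfolding generated_def by blast
qed

text \<open>Deriving falsity would put some \<open>y\<close> of the ideal into the filter.
  Conversely, a sentence such that neither it nor its negation is generated lies outside
  \<open>X\<close> and \<open>Y\<close>, which is how independence will be shown.\<close>

lemma generated_consistent:
  assumes X: "is_filter L X" and Y: "is_ideal L Y" and "X \<inter> Y = {}" shows "Bot \<notin> generated L X Y"
proof
  assume "Bot \<in> generated L X Y"
  then obtain y where y: "y \<in> Y" "Or y Bot \<in> X" unfolding generated_def by blast
  have "y \<in> X" by (rule filter_taut[OF X y(2,2)]) (use Y y in \<open>auto simp: is_ideal_def\<close>)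
  with y assms(3) show False by blast
qed

lemma generated_contains:
  assumes X: "is_filter L X" and Y: "is_ideal L Y" "Y \<noteq> {}"
  shows "p \<in> X \<Longrightarrow> p \<in> generated L X Y"
    and "q \<in> Y \<Longrightarrow> X \<noteq> {} \<Longrightarrow> Neg q \<in> generated L X Y"
proof -
  obtain y where y: "y \<in> Y" using Y by blast
  have ys: "y \<in> sentences L" using y Y unfolding is_ideal_def by blast
  assume p: "p \<in> X"
  have ps: "p \<in> sentences L" using p X unfolding is_filter_def by blast
  have "Or y p \<in> X" by (rule filter_taut[OF X p p]) (use ys ps in \<open>auto simp: sentences_def\<close>)
  with y ps show "p \<in> generated L X Y" unfolding generated_def by blast
next
  assume q: "q \<in> Y" "X \<noteq> {}"
  then obtain p where p: "p \<in> X" by blast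
  have qs: "q \<in> sentences L" using q Y unfolding is_ideal_def by blast
  have "Or q (Neg q) \<in> X" by (rule filter_taut[OF X p p]) (use qs in \<open>auto simp: sentences_def\<close>)
  with q qs show "Neg q \<in> generated L X Y" unfolding generated_def by (auto simp: sentences_def)
qed

abbreviation (input) "P_fm \<equiv> Rel 0 []"
abbreviation (input) "P_code \<equiv> prod_encode (2, prod_encode (0, 0))"

lemma P_fm_sentence: "P_fm \<in> sentences (ext_sig L)"
  unfolding sentences_def mem_Collect_eq wff_ext_sig_Rel by (rule refl)

lemma sat_P: "\<not> sat b e P_fm"
  by (simp add: sat_Rel)

definition generated_code :: "nat \<Rightarrow> nat \<Rightarrow> bool" where
  "generated_code a z \<longleftrightarrow> (\<exists>y. y \<in> W (pi2 a) \<and> imp_code (neg_code y) z \<in> W (pi1 a))"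

lemma re_generated_code [re_intros]:
  "computable f \<Longrightarrow> computable g \<Longrightarrow> re (\<lambda>x. generated_code (f x) (g x))"
  by (rule re_rel2) (unfold generated_code_def, intro re_intros computable_intros)

lemma generated_code_iff:
  assumes "re_index i X" "re_index j Y" "is_filter L X"
  shows "generated_code (prod_encode (i, j)) (fm_code p) \<longleftrightarrow> p \<in> generated L X Y"
proof -
  have "imp_code (neg_code (fm_code y)) (fm_code p) = fm_code (Or y p)" for y by (simp add: fm_code.simps)
  moreover have "fm_code q \<in> fm_code ` X \<longleftrightarrow> q \<in> X" for q by (simp add: inj_image_mem_iff[OF inj_fm_code])
  moreover have "p \<in> sentences L" if "Or y p \<in> X" for y
    using that assms(3) unfolding is_filter_def sentences_def by auto
  ultimately show ?thesis
    using assms(1,2) unfolding generated_code_def re_index_def generated_def by auto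
qed

lemma thms_taut1:
  assumes "is_theory U" "q \<in> thms U" "p \<in> sentences (lang U)" "\<And>A. pval A q \<Longrightarrow> pval A p"
  shows "p \<in> thms U"
  by (rule is_theoryD[OF assms(1,3)], rule proves_taut1[of _ _ q], rule Assm)
    (use assms is_formula_sentence is_theory_sentences in auto)

lemma weaker_P:
  assumes "is_theory U" "p \<in> sentences (ext_sig (lang U))" "star p \<in> thms U"
  shows "Imp P_fm p \<in> thms (weaker u U)"
  unfolding mem_weaker
proof (intro conjI allI impI)
  show s: "Imp P_fm p \<in> sentences (ext_sig (lang U))"
    using P_fm_sentence assms(2) by (auto simp: sentences_def simp del: wff.simps(3))
  show "star (Imp P_fm p) \<in> thms U"
    by (rule thms_taut1[OF assms(1,3) star_sentence[OF s]]) simp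
qed (simp add: sat_P)

lemma weaker_not_P:
  assumes "is_theory U" "p \<in> sentences (ext_sig (lang U))" "\<And>c. separating c \<Longrightarrow> holds u c (fm_code p)"
  shows "Imp (Neg P_fm) p \<in> thms (weaker u U)"
  unfolding mem_weaker
proof (intro conjI allI impI)
  show s: "Imp (Neg P_fm) p \<in> sentences (ext_sig (lang U))"
    using P_fm_sentence assms(2) by (auto simp: sentences_def simp del: wff.simps(3))
  show "star (Imp (Neg P_fm) p) \<in> thms U"
    by (rule thms_taut[OF assms(1) star_sentence[OF s]]) simp
qed (use assms(3) in simp)

lemma consistent_weaker: "consistent U \<Longrightarrow> consistent (weaker u U)"
  unfolding consistent_def mem_weaker by simp

text \<open>What is derivable under \<open>P\<close>, carried over to the language of
  \<open>U\<close>. Ranging over all preimages under \<open>star\<close> gives an existential form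
  that can be enumerated.\<close>

definition star_filter :: "signature \<Rightarrow> fm set \<Rightarrow> fm set" where
  "star_filter L G = {star p | p. p \<in> sentences (ext_sig L) \<and> Imp P_fm p \<in> G}"

definition star_ideal :: "signature \<Rightarrow> fm set \<Rightarrow> fm set" where
  "star_ideal L G = {star p | p. p \<in> sentences (ext_sig L) \<and> Imp P_fm (Neg p) \<in> G}"

locale separation =
  fixes U :: fo_theory and u :: nat and X Y :: "fm set"
  assumes theory_U: "is_theory U"
    and filter_X: "is_filter (ext_sig (lang U)) X" and ideal_Y: "is_ideal (ext_sig (lang U)) Y"
    and thms_X: "thms (weaker u U) \<subseteq> X" and refuted_Y: "refuted (weaker u U) \<subseteq> Y"
    and disjoint: "X \<inter> Y = {}"
begin

abbreviation "L' \<equiv> ext_sig (lang U)"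
abbreviation "G \<equiv> generated L' X Y"

lemma Y_nonempty: "Y \<noteq> {}"
proof -
  have "Top \<in> thms (weaker u U)"
    by (rule thms_taut[OF is_theory_weaker[OF theory_U]]) (simp_all add: sentences_def)
  then have "Bot \<in> refuted (weaker u U)" unfolding refuted_def by (simp add: sentences_def)
  then show ?thesis using refuted_Y by blast
qed

lemma thms_G: "p \<in> thms (weaker u U) \<Longrightarrow> p \<in> G"
  using generated_contains(1)[OF filter_X ideal_Y Y_nonempty] thms_X by blast

lemma X_G: "p \<in> X \<Longrightarrow> p \<in> G"
  by (rule generated_contains(1)[OF filter_X ideal_Y Y_nonempty])

lemma Y_G: "p \<in> Y \<Longrightarrow> Neg p \<in> G"
proof (rule generated_contains(2)[OF filter_X ideal_Y Y_nonempty])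
  have "Top \<in> thms (weaker u U)"
    by (rule thms_taut[OF is_theory_weaker[OF theory_U]]) (simp_all add: sentences_def)
  then show "X \<noteq> {}" using thms_X by blast
qed

lemmas G_taut = generated_taut[OF filter_X ideal_Y]
lemmas Bot_G = generated_consistent[OF filter_X ideal_Y disjoint]

lemma G_sentences: "p \<in> G \<Longrightarrow> p \<in> sentences L'"
  by (simp add: generated_def)

lemma sentences_Imp [simp]: "Imp p q \<in> sentences L \<longleftrightarrow> p \<in> sentences L \<and> q \<in> sentences L"
  and sentences_Bot [simp]: "Bot \<in> sentences L"
  by (auto simp: sentences_def)

lemmas P_sentence [simp] = P_fm_sentence

lemma G_P_Imp:
  assumes "p \<in> sentences L'" "q \<in> sentences L'" "Imp (star p) (star q) \<in> thms U"
  shows "Imp P_fm (Imp p q) \<in> G"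
  by (rule thms_G, rule weaker_P[OF theory_U]) (use assms in simp_all)

lemma unstar_sentence: "q \<in> sentences (lang U) \<Longrightarrow> unstar q \<in> sentences L'"
  unfolding sentences_def using wff_unstar by blast

lemma not_both: "P_fm \<in> G \<Longrightarrow> Neg P_fm \<notin> G"
  using G_taut[of P_fm "Neg P_fm" Bot] Bot_G by auto

text \<open>If \<open>P\<close> is not refuted, its consequences form an admissible input for the
  procedure of \<open>U\<close>. Below \<open>P\<close> a sentence may be exchanged for another one
  whose image follows from its own in \<open>U\<close>, so the choice of preimages does not
  matter.\<close>

lemma star_separation:
  assumes P: "Neg P_fm \<notin> G"
  shows "is_filter (lang U) (star_filter (lang U) G)" "is_ideal (lang U) (star_ideal (lang U) G)"
    "thms U \<subseteq> star_filter (lang U) G" "refuted U \<subseteq> star_ideal (lang U) G"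
    "star_filter (lang U) G \<inter> star_ideal (lang U) G = {}"
proof -
  \<comment> \<open>\<open>p\<close> would yield \<open>q\<close> under \<open>P\<close>, and
    together with the refutation of \<open>q\<close> this would refute \<open>P\<close>.\<close>
  have contra: False if "Imp P_fm p \<in> G" "Imp P_fm (Neg q) \<in> G" "Imp (star p) (star q) \<in> thms U" for p q
  proof -
    have pq: "p \<in> sentences L'" "q \<in> sentences L'" using that(1,2) G_sentences by fastforce+
    from G_taut[OF that(1) G_P_Imp[OF pq that(3)], of "Imp P_fm q"] pq have "Imp P_fm q \<in> G" by simp
    from G_taut[OF this that(2), of "Neg P_fm"] P show False by simp
  qed
  have refl: "Imp q q \<in> thms U" if "q \<in> sentences (lang U)" for q
    by (rule thms_taut[OF theory_U]) (use that in simp_all)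
  show "star_filter (lang U) G \<inter> star_ideal (lang U) G = {}"
  proof (rule ccontr)
    assume "\<not> ?thesis"
    then obtain p q where pq: "p \<in> sentences L'" "Imp P_fm p \<in> G" "Imp P_fm (Neg q) \<in> G" "star p = star q"
      unfolding star_filter_def star_ideal_def by fastforce
    then show False using contra[OF pq(2,3)] refl star_sentence by metis
  qed
  show "is_filter (lang U) (star_filter (lang U) G)" unfolding is_filter_def
  proof (intro conjI ballI impI)
    show "star_filter (lang U) G \<subseteq> sentences (lang U)"
      unfolding star_filter_def using star_sentence by blast
    fix a assume a: "a \<in> star_filter (lang U) G"
    then obtain p where p: "a = star p" "p \<in> sentences L'" "Imp P_fm p \<in> G" unfolding star_filter_def by blast
    show "b \<in> star_filter (lang U) G" if b: "b \<in> sentences (lang U)" "proves (lang U) {a} b" for b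
    proof -
      have "Imp (star p) (star (unstar b)) \<in> thms U"
        using thms_Imp[OF theory_U _ b] star_sentence[OF p(2)] p(1) by simp
      from G_P_Imp[OF p(2) unstar_sentence[OF b(1)] this]
      have "Imp P_fm (unstar b) \<in> G"
        by (rule G_taut[OF p(3)]) (use unstar_sentence[OF b(1)] in simp_all)
      then show ?thesis unfolding star_filter_def using unstar_sentence[OF b(1)]
        by (intro CollectI exI[of _ "unstar b"]) simp
    qed
    fix b assume "b \<in> star_filter (lang U) G"
    then obtain q where q: "b = star q" "q \<in> sentences L'" "Imp P_fm q \<in> G" unfolding star_filter_def by blast
    have "Imp P_fm (And p q) \<in> G" by (rule G_taut[OF p(3) q(3)]) (use p q in simp_all)
    then show "And a b \<in> star_filter (lang U) G" unfolding star_filter_def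
      using p q by (intro CollectI exI[of _ "And p q"]) simp
  next
    show "Bot \<notin> star_filter (lang U) G"
    proof
      assume "Bot \<in> star_filter (lang U) G"
      then obtain p where p: "star p = Bot" "Imp P_fm p \<in> G" unfolding star_filter_def by force
      have "Imp P_fm (Neg Bot) \<in> G" by (rule G_taut[OF p(2,2)]) simp_all
      from contra[OF p(2) this] refl[of Bot] p(1) show False by simp
    qed
  qed
  show "is_ideal (lang U) (star_ideal (lang U) G)" unfolding is_ideal_def
  proof (intro conjI ballI impI)
    show "star_ideal (lang U) G \<subseteq> sentences (lang U)"
      unfolding star_ideal_def using star_sentence by blast
    fix a assume a: "a \<in> star_ideal (lang U) G"
    then obtain p where p: "a = star p" "p \<in> sentences L'" "Imp P_fm (Neg p) \<in> G" unfolding star_ideal_def by blast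
    show "b \<in> star_ideal (lang U) G" if b: "b \<in> sentences (lang U)" "proves (lang U) {b} a" for b
    proof -
      have "Imp (star (unstar b)) (star p) \<in> thms U"
        using thms_Imp[OF theory_U b(1) _ b(2)] star_sentence[OF p(2)] p(1) by simp
      from G_P_Imp[OF unstar_sentence[OF b(1)] p(2) this]
      have "Imp P_fm (Neg (unstar b)) \<in> G"
        by (rule G_taut[OF p(3)]) (use unstar_sentence[OF b(1)] in auto)
      then show ?thesis unfolding star_ideal_def using unstar_sentence[OF b(1)]
        by (intro CollectI exI[of _ "unstar b"]) simp
    qed
    fix b assume "b \<in> star_ideal (lang U) G"
    then obtain q where q: "b = star q" "q \<in> sentences L'" "Imp P_fm (Neg q) \<in> G" unfolding star_ideal_def by blast
    have "Imp P_fm (Neg (Or p q)) \<in> G" by (rule G_taut[OF p(3) q(3)]) (use p q in simp_all)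
    then show "Or a b \<in> star_ideal (lang U) G" unfolding star_ideal_def
      using p q by (intro CollectI exI[of _ "Or p q"]) simp
  next
    show "Top \<notin> star_ideal (lang U) G"
    proof
      assume "Top \<in> star_ideal (lang U) G"
      then obtain p where p: "star p = Top" "Imp P_fm (Neg p) \<in> G" unfolding star_ideal_def by force
      have "Imp P_fm Top \<in> G" by (rule G_taut[OF p(2,2)]) simp_all
      from contra[OF this p(2)] refl[of Top] p(1) show False by simp
    qed
  qed
  have in_G: "Imp P_fm (unstar p) \<in> G" if "p \<in> thms U" for p
    by (rule thms_G, rule weaker_P[OF theory_U unstar_sentence])
      (use that is_theory_sentences[OF theory_U] in simp_all)
  show "thms U \<subseteq> star_filter (lang U) G"
  proof
    fix p assume "p \<in> thms U"
    with in_G[of p] unstar_sentence[of p] is_theory_sentences[OF theory_U] show "p \<in> star_filter (lang U) G"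
      unfolding star_filter_def by (intro CollectI exI[of _ "unstar p"]) simp
  qed
  show "refuted U \<subseteq> star_ideal (lang U) G"
  proof
    fix p assume "p \<in> refuted U"
    then have "p \<in> sentences (lang U)" "Neg p \<in> thms U" by (auto simp: refuted_def)
    with in_G[of "Neg p"] unstar_sentence[of p] show "p \<in> star_ideal (lang U) G"
      unfolding star_ideal_def by (intro CollectI exI[of _ "unstar p"]) simp
  qed
qed

end

lemma two_sorts_ext_sig: "two_sorts (ext_sig L)"
  by (simp add: two_sorts_def ext_sig_def)

text \<open>The bit formula of the input \<open>(d, (i, j))\<close> is used, where the program \<open>d\<close> answers 1 if the
  theory generated by the filter \<open>i\<close> and the ideal \<open>j\<close> proves it when \<open>P\<close> fails, and 0 if that theory
  refutes it then. Either answer would make that theory inconsistent with the negation of \<open>P\<close>.\<close>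

lemma tEI_weaker:
  assumes U: "tEI U" and u: "re_index u (thms U)"
  shows "tEI (weaker u U)" 
proof -
  let ?T = "weaker u U" and ?L' = "ext_sig (lang U)"
  have th: "is_theory U" and cons: "consistent U" using U unfolding tEI_def by blast+
  have perf: "perfect u" by (rule tEI_perfect[OF U u])
  have thT: "is_theory ?T" by (rule is_theory_weaker[OF th])
  obtain f where f: "partial_recursive2 f"
    "\<And>i j X Y. is_filter (lang U) X \<Longrightarrow> re_index i X \<Longrightarrow> is_ideal (lang U) Y \<Longrightarrow> re_index j Y \<Longrightarrow>
       thms U \<subseteq> X \<Longrightarrow> refuted U \<subseteq> Y \<Longrightarrow> X \<inter> Y = {} \<Longrightarrow>
       \<exists>p\<in>sentences (lang U). f i j = Some (fm_code p) \<and> p \<notin> X \<union> Y"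
    using U unfolding tEI_def by (elim conjE exE) blast
  obtain cU where cU: "\<And>i j y. f i j = Some y \<longleftrightarrow> computes cU (prod_encode (i, j)) y"
    using f(1) unfolding partial_recursive2_def by blast
  have "re (\<lambda>x. weaker_pred u x)"
    by (rule re_rel2[OF re_weaker_pred]) (intro computable_intros)+
  then obtain t where t: "W t = {x. weaker_pred u x}" by (rule re_enumerated)
  then have idx: "re_index t (thms ?T)"
    unfolding re_index_def using weaker_pred_iff[OF th u perf] by blast
  define XP where "XP a q \<longleftrightarrow> imp_code q q \<in> W u \<and> (\<exists>x. star_code x q \<and> generated_code a (imp_code P_code x))" for a q
  define YP where "YP a q \<longleftrightarrow> imp_code q q \<in> W u \<and> (\<exists>x. star_code x q \<and> generated_code a (imp_code P_code (neg_code x)))" for a q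
  have "re (\<lambda>p. XP (pi1 p) (pi2 p))" unfolding XP_def by (intro re_intros computable_intros)
  then obtain g where g: "computable g" "\<And>a. W (g a) = {x. XP a x}" by (rule smn) blast
  have "re (\<lambda>p. YP (pi1 p) (pi2 p))" unfolding YP_def by (intro re_intros computable_intros)
  then obtain h where h: "computable h" "\<And>a. W (h a) = {x. YP a x}" by (rule smn) blast
  \<comment> \<open>The second conjunct recognises sentences of the extended signature through the
    index \<open>t\<close> of the new theory.\<close>
  define bitf where "bitf n C \<longleftrightarrow> barred u (Suc n) C 0 0 \<and> imp_code C C \<in> W t" for n C
  have re_bitf: "computable k \<Longrightarrow> computable l \<Longrightarrow> re (\<lambda>x. bitf (k x) (l x))" for k l
    unfolding bitf_def by (intro re_intros re_barred computable_intros)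
  have bitf: "bitf n C \<longleftrightarrow> (\<exists>p\<in>sentences ?L'. C = fm_code p \<and> (\<forall>c. holds u c C \<longleftrightarrow> c n))" for n C
    unfolding bitf_def barred_Suc[OF perf] codes_of_sentences[OF thT idx] by auto
  \<comment> \<open>Index of the bit and input of the program are the same number \<open>n\<close>,
    whose second component carries the filter and ideal. Self-reference comes about by putting the
    code of the program into the first component.\<close>
  define D :: "nat \<Rightarrow> nat \<Rightarrow> bool" where "D n v \<longleftrightarrow> (\<exists>C. bitf n C \<and>
    (v = 1 \<and> generated_code (pi2 n) (imp_code (neg_code P_code) C) \<or>
     v = 0 \<and> generated_code (pi2 n) (imp_code (neg_code P_code) (neg_code C))))" for n v
  have "re (\<lambda>p. D (pi1 p) (pi2 p))"
    unfolding D_def by (intro re_intros re_bitf computable_intros)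
  then obtain d where d: "\<And>n v. computes d n v \<Longrightarrow> D n v" "\<And>n v. D n v \<Longrightarrow> \<exists>w. computes d n w"
    by (rule selection) blast
  \<comment> \<open>The half for \<open>P\<close> is a preimage of the output of the procedure of
    \<open>U\<close>, or \<open>Bot\<close> as a filler once \<open>P\<close> is found to be
    refuted. If both alternatives apply, either is good.\<close>
  define F where "F a y \<longleftrightarrow> (\<exists>x C. bitf (prod_encode (recf_code d, a)) C \<and>
    ((\<exists>q. computes cU (prod_encode (g a, h a)) q \<and> star_code x q \<and> imp_code q q \<in> W u) \<or>
      generated_code a (neg_code P_code) \<and> x = bot_code) \<and>
    y = and_code (imp_code P_code x) (imp_code (neg_code P_code) C))" for a y
  have "re (\<lambda>p. F (pi1 p) (pi2 p))"
    unfolding F_def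
    by (intro re_intros re_bitf computable_intros computable_comp[OF g(1)] computable_comp[OF h(1)])
  then obtain cF where cF: "\<And>a y. computes cF a y \<Longrightarrow> F a y" "\<And>a y. F a y \<Longrightarrow> \<exists>w. computes cF a w"
    by (rule selection) blast
  obtain fT where fT: "partial_recursive2 fT" "\<And>i j y. fT i j = Some y \<longleftrightarrow> computes cF (prod_encode (i, j)) y"
    using partial_recursive2_computes[of cF] by blast
  have "\<exists>p\<in>sentences (lang ?T). fT i j = Some (fm_code p) \<and> p \<notin> X \<union> Y"
    if X: "is_filter (lang ?T) X" "re_index i X" and Y: "is_ideal (lang ?T) Y" "re_index j Y"
      and sub: "thms ?T \<subseteq> X" "refuted ?T \<subseteq> Y" and dis: "X \<inter> Y = {}" for i j X Y
  proof -
    interpret separation U u X Y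
      using th X Y sub dis by unfold_locales simp_all
    let ?a = "prod_encode (i, j)"
    let ?n = "prod_encode (recf_code d, ?a)"
    have gen: "generated_code ?a (fm_code p) \<longleftrightarrow> p \<in> G" for p
      by (rule generated_code_iff[OF X(2) Y(2)]) (use X(1) in simp)
    have star_codes: "imp_code q q \<in> W u \<and> star_code x q \<longleftrightarrow>
        (\<exists>p\<in>sentences ?L'. x = fm_code p \<and> q = fm_code (star p))" for x q
    proof
      assume *: "imp_code q q \<in> W u \<and> star_code x q"
      then obtain r where r: "r \<in> sentences (lang U)" "q = fm_code r"
        unfolding codes_of_sentences[OF th u] by blast
      with * star_code_sound[of x r "lang U" 0] show "\<exists>p\<in>sentences ?L'. x = fm_code p \<and> q = fm_code (star p)"
        by (auto simp: sentences_def)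
    next
      assume "\<exists>p\<in>sentences ?L'. x = fm_code p \<and> q = fm_code (star p)"
      then show "imp_code q q \<in> W u \<and> star_code x q"
        unfolding codes_of_sentences[OF th u] using star_sentence star_code_complete
        by (fastforce simp: sentences_def)
    qed
    have codes: "imp_code P_code (fm_code p) = fm_code (Imp P_fm p)"
      "imp_code (neg_code P_code) (fm_code p) = fm_code (Imp (Neg P_fm) p)"
      "neg_code (fm_code p) = fm_code (Neg p)" "neg_code P_code = fm_code (Neg P_fm)" "bot_code = fm_code Bot" for p
      by (simp_all add: fm_code.simps)
    have "XP ?a q \<longleftrightarrow> q \<in> fm_code ` star_filter (lang U) G" for q
    proof -
      have "XP ?a q \<longleftrightarrow> (\<exists>x. (imp_code q q \<in> W u \<and> star_code x q) \<and> generated_code ?a (imp_code P_code x))"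
        unfolding XP_def by blast
      also have "\<dots> \<longleftrightarrow> (\<exists>p\<in>sentences ?L'. q = fm_code (star p) \<and> Imp P_fm p \<in> G)"
        unfolding star_codes using gen codes(1) by auto
      finally show ?thesis unfolding star_filter_def by blast
    qed
    then have gX: "re_index (g ?a) (star_filter (lang U) G)" unfolding re_index_def g(2) by blast
    have "YP ?a q \<longleftrightarrow> q \<in> fm_code ` star_ideal (lang U) G" for q
    proof -
      have "YP ?a q \<longleftrightarrow> (\<exists>x. (imp_code q q \<in> W u \<and> star_code x q) \<and> generated_code ?a (imp_code P_code (neg_code x)))"
        unfolding YP_def by blast
      also have "\<dots> \<longleftrightarrow> (\<exists>p\<in>sentences ?L'. q = fm_code (star p) \<and> Imp P_fm (Neg p) \<in> G)"
        unfolding star_codes using gen codes(1,3) by auto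
      finally show ?thesis unfolding star_ideal_def by blast
    qed
    then have hY: "re_index (h ?a) (star_ideal (lang U) G)" unfolding re_index_def h(2) by blast
    have U_out: "\<exists>p\<in>sentences (lang U). f (g ?a) (h ?a) = Some (fm_code p) \<and>
        p \<notin> star_filter (lang U) G \<union> star_ideal (lang U) G" if "Neg P_fm \<notin> G"
      using f(2)[OF star_separation(1)[OF that] gX star_separation(2)[OF that] hY star_separation(3-5)[OF that]] .
    \<comment> \<open>The program may have found another formula \<open>C'\<close> for the bit, and
      another answer, than the ones at hand; its own choice is the one that leads to the
      contradiction under the negation of \<open>P\<close>.\<close>
    have decided: "P_fm \<in> G" if C: "C \<in> sentences ?L'" "bitf ?n (fm_code C)"
      and or: "Imp (Neg P_fm) C \<in> G \<or> Imp (Neg P_fm) (Neg C) \<in> G" for C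
    proof -
      have "D ?n 1 \<or> D ?n 0" unfolding D_def using C(2) or gen codes(2,3) by auto
      then obtain v where v: "computes d ?n v" using d(2) by blast
      from d(1)[OF v] obtain C' where C': "C' \<in> sentences ?L'" "\<And>c. holds u c (fm_code C') \<longleftrightarrow> c ?n"
        and v': "v = 1 \<and> Imp (Neg P_fm) C' \<in> G \<or> v = 0 \<and> Imp (Neg P_fm) (Neg C') \<in> G"
        unfolding D_def bitf using gen codes(2,3) by auto
      \<comment> \<open>The answer puts the number into one of the two inseparable sets, and each
        separation then gives the bit the value opposite to what the answer reports.\<close>
      have sep: "separating c \<Longrightarrow> (v = 0 \<longrightarrow> c ?n) \<and> (v = 1 \<longrightarrow> \<not> c ?n)" for c
        using v unfolding separating_def runs_code[symmetric] by (metis fst_conv prod_encode_inverse)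
      have "Imp (Neg P_fm) (Neg C') \<in> G" if "v = 1"
        by (rule thms_G, rule weaker_not_P[OF th]) (use that C' sep in auto)
      moreover have "Imp (Neg P_fm) C' \<in> G" if "v = 0"
        by (rule thms_G, rule weaker_not_P[OF th]) (use that C' sep in auto)
      ultimately have "Imp (Neg P_fm) C' \<in> G" "Imp (Neg P_fm) (Neg C') \<in> G" using v' by auto
      then show ?thesis by (rule G_taut) auto
    qed
    obtain C where C: "C \<in> sentences ?L'" "\<forall>c. holds u c (fm_code C) \<longleftrightarrow> c ?n"
      using ex_bit_formula[OF perf two_sorts_ext_sig] by blast
    have "\<exists>y. F ?a y"
    proof (cases "Neg P_fm \<in> G")
      case True
      then have "generated_code ?a (neg_code P_code)" unfolding codes(4) gen .
      then show ?thesis unfolding F_def bitf using C by blast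
    next
      case False
      then obtain p where p: "p \<in> sentences (lang U)" "f (g ?a) (h ?a) = Some (fm_code p)" using U_out by blast
      then have "computes cU (prod_encode (g ?a, h ?a)) (fm_code p)" using cU by blast
      moreover have "imp_code (fm_code p) (fm_code p) \<in> W u \<and> star_code (fm_code (unstar p)) (fm_code p)"
        unfolding star_codes using unstar_sentence[OF p(1)] by (intro bexI[of _ "unstar p"]) simp_all
      ultimately show ?thesis unfolding F_def bitf using C by blast
    qed
    then obtain y where y: "computes cF ?a y" using cF(2) by blast
    from cF(1)[OF y] obtain x w where w: "bitf ?n w"
      and x: "(\<exists>q. computes cU (prod_encode (g ?a, h ?a)) q \<and> star_code x q \<and> imp_code q q \<in> W u) \<or>
        generated_code ?a (neg_code P_code) \<and> x = bot_code"
      and y': "y = and_code (imp_code P_code x) (imp_code (neg_code P_code) w)"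
      unfolding F_def by (elim exE conjE)
    from w obtain C where "C \<in> sentences ?L'" and wC: "w = fm_code C" unfolding bitf by (elim bexE conjE)
    with w have C: "C \<in> sentences ?L'" "bitf ?n (fm_code C)" by simp_all
    note yeq = y'[unfolded wC]
    obtain r where r: "r \<in> sentences ?L'" "x = fm_code r"
      and r': "computes cU (prod_encode (g ?a, h ?a)) (fm_code (star r)) \<or> Neg P_fm \<in> G"
    proof -
      from x show ?thesis
      proof (elim disjE exE conjE)
        fix q assume q: "computes cU (prod_encode (g ?a, h ?a)) q" "star_code x q" "imp_code q q \<in> W u"
        with star_codes[of q x] q(1) show ?thesis using that by blast
      next
        assume "generated_code ?a (neg_code P_code)" "x = bot_code"
        then show ?thesis using that[of Bot] gen codes(4,5) by simp
      qed
    qed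
    let ?o = "And (Imp P_fm r) (Imp (Neg P_fm) C)"
    have o: "?o \<in> sentences ?L'" using r(1) C(1) by simp
    \<comment> \<open>Being derivable, the glued sentence would settle the bit formula under the
      negation of \<open>P\<close>, so \<open>P\<close> would be derivable. Hence \<open>P\<close>
      is not refuted, \<open>r\<close> stems from the procedure of \<open>U\<close>, and deriving
      \<open>r\<close> under \<open>P\<close> contradicts its independence.\<close>
    have not_G: "?o \<notin> G"
    proof
      assume oG: "?o \<in> G"
      have "Imp (Neg P_fm) C \<in> G" by (rule G_taut[OF oG oG]) (use C in auto)
      then have "Neg P_fm \<notin> G" using decided[OF C] not_both by blast
      moreover from this r' have "f (g ?a) (h ?a) = Some (fm_code (star r))" using cU by blast
      ultimately have "star r \<notin> star_filter (lang U) G" using U_out inj_fm_code by (auto dest: injD)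
      moreover have "Imp P_fm r \<in> G" by (rule G_taut[OF oG oG]) (use r in auto)
      ultimately show False using r(1) unfolding star_filter_def by blast
    qed
    have not_Neg_G: "Neg ?o \<notin> G"
    proof
      assume oG: "Neg ?o \<in> G"
      \<comment> \<open>If \<open>P\<close> fails, the first half of the glued sentence is true, so
        refuting the whole refutes \<open>C\<close>.\<close>
      have "Imp (Neg P_fm) (Neg C) \<in> G" by (rule G_taut[OF oG oG]) (use C in auto)
      then have "Neg P_fm \<notin> G" using decided[OF C] not_both by blast
      moreover from this r' have "f (g ?a) (h ?a) = Some (fm_code (star r))" using cU by blast
      ultimately have "star r \<notin> star_ideal (lang U) G" using U_out inj_fm_code by (auto dest: injD)
      moreover have "Imp P_fm (Neg r) \<in> G" by (rule G_taut[OF oG oG]) (use r in auto)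
      ultimately show False using r(1) unfolding star_ideal_def by blast
    qed
    have "fm_code ?o = y" unfolding yeq r(2) by (simp add: fm_code.simps)
    with y have "fT i j = Some (fm_code ?o)" using fT(2) by simp
    then show ?thesis using o not_G not_Neg_G X_G Y_G by (intro bexI[of _ ?o]) auto
  qed
  then show ?thesis unfolding tEI_def
    using thT consistent_weaker[OF cons] idx fT(1) by blast
qed

theorem theorem3p8:
  shows "\<not> (\<exists>U. minimal_tEI U) \<and>
    (\<exists>A. partial_recursive2 A \<and>
      (\<forall>U u. tEI U \<and> re_index u (thms U) \<longrightarrow>
        (\<exists>T t. A (sig_code (lang U)) u = Some (prod_encode (sig_code (lang T), t)) \<and>
          re_index t (thms T) \<and> tEI T \<and> T \<lhd> U)))"
proof -
  obtain g where g: "computable g" "\<And>u. W (g u) = {x. weaker_pred u x}"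
    using re_weaker_pred by (rule smn) blast
  have weaker: "re_index (g u) (thms (weaker u U)) \<and> tEI (weaker u U) \<and> weaker u U \<lhd> U"
    if U: "tEI U" and u: "re_index u (thms U)" for U u
  proof (intro conjI)
    have th: "is_theory U" using U unfolding tEI_def by blast
    have perf: "perfect u" by (rule tEI_perfect[OF U u])
    show "re_index (g u) (thms (weaker u U))"
      unfolding re_index_def g(2) using weaker_pred_iff[OF th u perf] by blast
    show "tEI (weaker u U)" by (rule tEI_weaker[OF U u])
    have "weaker u U \<unlhd> U"
      by (rule interpretable_star[OF is_theory_weaker[OF th] lang_weaker th]) (simp add: mem_weaker)
    then show "weaker u U \<lhd> U"
      unfolding strictly_weaker_def using weaker_not_interpreting[OF th u perf] by blast
  qed
  \<comment> \<open>The new signature has the arities 0 and 2 in front of the old list of relation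
    symbols; the index depends on the old index only.\<close>
  define a where "a p = prod_encode (prod_encode (pi1 (pi1 p),
    consc 0 (consc 2 (pi2 (pi1 p)))), g (pi2 p))" for p
  have "computable a" unfolding a_def by (intro computable_intros computable_comp[OF g(1)])
  then obtain c where c: "\<And>p. computes c p (a p)" unfolding computable_def by blast
  obtain A where A: "partial_recursive2 A" "\<And>i j y. A i j = Some y \<longleftrightarrow> computes c (prod_encode (i, j)) y"
    using partial_recursive2_computes[of c] by blast
  have "A (sig_code (lang U)) u = Some (prod_encode (sig_code (lang (weaker u U)), g u))" for U u
    using A(2) c[of "prod_encode (sig_code (lang U), u)"] by (simp add: a_def sig_code_def ext_sig_def consc_def)
  with weaker A(1) have eff: "\<exists>A. partial_recursive2 A \<and>
      (\<forall>U u. tEI U \<and> re_index u (thms U) \<longrightarrow>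
        (\<exists>T t. A (sig_code (lang U)) u = Some (prod_encode (sig_code (lang T), t)) \<and>
          re_index t (thms T) \<and> tEI T \<and> T \<lhd> U))"
    by (intro exI[of _ A]) blast
  moreover have "\<not> minimal_tEI U" for U
  proof
    assume "minimal_tEI U"
    moreover from this obtain u where "re_index u (thms U)" unfolding minimal_tEI_def tEI_def by blast
    ultimately show False using weaker unfolding minimal_tEI_def by blast
  qed
  ultimately show ?thesis by blast
qed

end
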